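(* Let $(\Omega,\mathcal{F},(\mathcal{F}_t)_{t\in\mathbb{R}_+},\mathbb{P})$ be a filtered probability space supporting a Brownian motion $W=(W_t)_{t\in\mathbb{R}_+}$. Let $\alpha=(\alpha_t)_{t\in\mathbb{R}_+}$ and $\beta=(\beta_t)_{t\in\mathbb{R}_+}$ be real-valued adapted processes satisfying $$\int_0^T\mathbb{E}\left[\alpha_t^2+\beta_t^2\right]\mathrm{d}t<\infty\quad\text{for all }T>0.$$ Suppose that $\alpha$ has continuous paths and $\beta$ is predictable. Define the Itô process $$Y_t=\int_0^t\alpha_s\,\mathrm{d}s+\int_0^t\beta_s\,\mathrm{d}W_s,\quad t\geq 0.$$ 1. (Finite time horizon.) Let $T>0$ and assume that the finite-time power spectral density of $\mathrm{d}Y$ vanishes in the limit of infinitely high frequencies, i.e. $$S^{(T)}_{\mathrm{d}Y}(\omega):=\mathbb{E}\left[\frac{1}{T}\left|\int_0^T\exp(-i\omega t)\,\mathrm{d}Y_t\right|^2\right]\longrightarrow 0\quad\text{as }\omega\to\infty.$$ Then $\beta_t=0$ $\mathbb{P}$-a.s. for almost all $t\in[0,T]$. 2. (Infinite time horizon.) Assume that $\alpha$ and $\beta$ are stationary processes and that $\alpha$ is centered around $0$ with an absolutely integrable autocovariance function $R_\alpha(\tau)$. Assume that the power spectral density $S_{\mathrm{d}Y}(\omega)$ of $\mathrm{d}Y$ on an infinite time horizon exists. If it vanishes in the limit of infinitely high frequencies, i.e. $$S_{\mathrm{d}Y}(\omega)\longrightarrow 0\quad\text{as }\omega\to\infty,$$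 then $\beta_t=0$ $\mathbb{P}$-a.s. for all $t\geq 0$.
   Context: $W$ is a Brownian motion with respect to the filtration $(\mathcal{F}_t)_{t\in\mathbb{R}_+}$; adaptedness and predictability are with respect to this filtration. Stochastic integrals are Itô integrals, and $$\int_0^T\exp(-i\omega t)\,\mathrm{d}Y_t=\int_0^T\exp(-i\omega t)\alpha_t\,\mathrm{d}t+\int_0^T\exp(-i\omega t)\beta_t\,\mathrm{d}W_t .$$ The power spectral density (PSD) of $\mathrm{d}Y$ (on an infinite time horizon) is defined for $\omega\in\mathbb{R}$ as $$S_{\mathrm{d}Y}(\omega):=\lim_{T\to\infty}\mathbb{E}\left[\frac{1}{T}\left|\int_0^T\exp(-i\omega t)\,\mathrm{d}Y_t\right|^2\right],$$ if the limit exists. "Stationary" means strictly stationary (the finite-dimensional distributions are invariant under time shifts), each of $\alpha$ and $\beta$ being stationary. "Centered around $0$" means $\mathbb{E}[\alpha_t]=0$ for all $t\geq 0$. The autocovariance function of $\alpha$ is $R_\alpha(\tau)=\mathrm{Cov}(\alpha_t,\alpha_{t+|\tau|})$ for $\tau\in\mathbb{R}$, which does not depend on $t$ by stationarity; absolute integrability means $\int_{-\infty}^\infty|R_\alpha(\tau)|\,\mathrm{d}\tau<\infty$. *)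

theory Defs
  imports "HOL-Probability.Probability"
begin

section \<open>Filtrations and processes indexed by the nonnegative reals\<close>

text \<open>Processes and filtrations are functions on all of \<^typ>\<open>real\<close>, but only times \<open>t \<ge> 0\<close> are
  ever constrained or used. Neither completeness nor right-continuity of the filtration is
  required.\<close>

definition filtration_on :: "'a measure \<Rightarrow> (real \<Rightarrow> 'a measure) \<Rightarrow> bool" where
  "filtration_on M F \<longleftrightarrow>
     (\<forall>t\<ge>0. subalgebra M (F t)) \<and> (\<forall>s t. 0 \<le> s \<and> s \<le> t \<longrightarrow> sets (F s) \<subseteq> sets (F t))"

definition adapted :: "(real \<Rightarrow> 'a measure) \<Rightarrow> (real \<Rightarrow> 'a \<Rightarrow> real) \<Rightarrow> bool" where
  "adapted F X \<longleftrightarrow> (\<forall>t\<ge>0. X t \<in> borel_measurable (F t))"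

definition continuous_paths :: "'a measure \<Rightarrow> (real \<Rightarrow> 'a \<Rightarrow> real) \<Rightarrow> bool" where
  "continuous_paths M X \<longleftrightarrow> (\<forall>x\<in>space M. continuous_on {0..} (\<lambda>t. X t x))"

definition predictable_sigma :: "'a measure \<Rightarrow> (real \<Rightarrow> 'a measure) \<Rightarrow> (real \<times> 'a) measure" where
  "predictable_sigma M F = sigma ({0..} \<times> space M)
     ({{0} \<times> A | A. A \<in> sets (F 0)} \<union>
      {{s<..t} \<times> A | s t A. 0 \<le> s \<and> s \<le> t \<and> A \<in> sets (F s)})"

definition predictable :: "'a measure \<Rightarrow> (real \<Rightarrow> 'a measure) \<Rightarrow> (real \<Rightarrow> 'a \<Rightarrow> real) \<Rightarrow> bool" where
  "predictable M F X \<longleftrightarrow> (\<lambda>(t, x). X t x) \<in> borel_measurable (predictable_sigma M F)"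

definition brownian_motion ::
    "'a measure \<Rightarrow> (real \<Rightarrow> 'a measure) \<Rightarrow> (real \<Rightarrow> 'a \<Rightarrow> real) \<Rightarrow> bool" where
  "brownian_motion M F W \<longleftrightarrow>
     adapted F W \<and>
     (AE x in M. W 0 x = 0) \<and>
     (AE x in M. continuous_on {0..} (\<lambda>t. W t x)) \<and>
     (\<forall>s t. 0 \<le> s \<and> s < t \<longrightarrow>
        distributed M lborel (\<lambda>x. W t x - W s x) (normal_density 0 (sqrt (t - s))) \<and>
        prob_space.indep_set M (sets (F s))
          {(\<lambda>x. W t x - W s x) -` B \<inter> space M | B. B \<in> sets borel})"

definition strictly_stationary :: "'a measure \<Rightarrow> (real \<Rightarrow> 'a \<Rightarrow> real) \<Rightarrow> bool" where
  "strictly_stationary M X \<longleftrightarrow>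
     (\<forall>(n::nat) (t :: nat \<Rightarrow> real) h. (\<forall>i<n. 0 \<le> t i) \<and> 0 \<le> h \<longrightarrow>
        distr M (PiM {..<n} (\<lambda>_. borel)) (\<lambda>x. \<lambda>i\<in>{..<n}. X (t i + h) x) =
        distr M (PiM {..<n} (\<lambda>_. borel)) (\<lambda>x. \<lambda>i\<in>{..<n}. X (t i) x))"

definition covariance :: "'a measure \<Rightarrow> ('a \<Rightarrow> real) \<Rightarrow> ('a \<Rightarrow> real) \<Rightarrow> real" where
  "covariance M X Y =
     (\<integral>x. (X x - (\<integral>y. X y \<partial>M)) * (Y x - (\<integral>y. Y y \<partial>M)) \<partial>M)"

text \<open>Only meaningful for stationary \<open>X\<close>, where the base time \<open>0\<close> may be replaced by any
  \<open>t \<ge> 0\<close>.\<close>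

definition autocovariance :: "'a measure \<Rightarrow> (real \<Rightarrow> 'a \<Rightarrow> real) \<Rightarrow> real \<Rightarrow> real" where
  "autocovariance M X \<tau> = covariance M (X 0) (X \<bar>\<tau>\<bar>)"

section \<open>The Ito integral\<close>

text \<open>Elementary integrands \<open>\<Sum>i<n. \<xi> i * indicator {\<tau> i<..\<tau> (i + 1)}\<close>, with \<open>\<xi> i\<close> bounded and
  measurable with respect to the information at the left end point.\<close>

definition elementary_data ::
    "'a measure \<Rightarrow> (real \<Rightarrow> 'a measure) \<Rightarrow> nat \<Rightarrow> (nat \<Rightarrow> real) \<Rightarrow> (nat \<Rightarrow> 'a \<Rightarrow> real) \<Rightarrow> bool" where
  "elementary_data M F n \<tau> \<xi> \<longleftrightarrow>
     0 \<le> \<tau> 0 \<and> (\<forall>i<n. \<tau> i \<le> \<tau> (Suc i)) \<and>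
     (\<forall>i<n. \<xi> i \<in> borel_measurable (F (\<tau> i)) \<and> (\<exists>C. \<forall>x\<in>space M. \<bar>\<xi> i x\<bar> \<le> C))"

definition elementary_process ::
    "nat \<Rightarrow> (nat \<Rightarrow> real) \<Rightarrow> (nat \<Rightarrow> 'a \<Rightarrow> real) \<Rightarrow> real \<Rightarrow> 'a \<Rightarrow> real" where
  "elementary_process n \<tau> \<xi> t x = (\<Sum>i<n. \<xi> i x * indicator {\<tau> i<..\<tau> (Suc i)} t)"

definition elementary_integral ::
    "(real \<Rightarrow> 'a \<Rightarrow> real) \<Rightarrow> nat \<Rightarrow> (nat \<Rightarrow> real) \<Rightarrow> (nat \<Rightarrow> 'a \<Rightarrow> real) \<Rightarrow> real \<Rightarrow> 'a \<Rightarrow> real" where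
  "elementary_integral W n \<tau> \<xi> T x =
     (\<Sum>i<n. \<xi> i x * (W (min (\<tau> (Suc i)) T) x - W (min (\<tau> i) T) x))"

text \<open>\<open>I\<close> is a version of the Ito integral of \<open>H\<close> over \<open>[0, T]\<close>: it is the limit in \<open>L\<^sup>2(M)\<close> of the
  integrals of elementary integrands that converge to \<open>H\<close> in \<open>L\<^sup>2([0, T] \<times> M)\<close>.\<close>

definition has_ito_integral ::
    "'a measure \<Rightarrow> (real \<Rightarrow> 'a measure) \<Rightarrow> (real \<Rightarrow> 'a \<Rightarrow> real) \<Rightarrow>
     (real \<Rightarrow> 'a \<Rightarrow> real) \<Rightarrow> real \<Rightarrow> ('a \<Rightarrow> real) \<Rightarrow> bool" where
  "has_ito_integral M F W H T I \<longleftrightarrow>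
     I \<in> borel_measurable (F T) \<and>
     (\<exists>n \<tau> \<xi>. (\<forall>k::nat. elementary_data M F (n k) (\<tau> k) (\<xi> k)) \<and>
        ((\<lambda>k. \<integral>\<^sup>+t\<in>{0..T}.
            (\<integral>\<^sup>+x. ennreal ((H t x - elementary_process (n k) (\<tau> k) (\<xi> k) t x)\<^sup>2) \<partial>M) \<partial>lborel)
          \<longlonglongrightarrow> 0) \<and>
        ((\<lambda>k. \<integral>\<^sup>+x. ennreal ((I x - elementary_integral W (n k) (\<tau> k) (\<xi> k) T x)\<^sup>2) \<partial>M)
          \<longlonglongrightarrow> 0))"

text \<open>For predictable \<open>H\<close>, square integrable on \<open>[0, T] \<times> M\<close>, versions exist and any two of them
  agree almost surely, so the choice is immaterial for almost sure statements and expectations.\<close>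

definition ito_integral ::
    "'a measure \<Rightarrow> (real \<Rightarrow> 'a measure) \<Rightarrow> (real \<Rightarrow> 'a \<Rightarrow> real) \<Rightarrow>
     (real \<Rightarrow> 'a \<Rightarrow> real) \<Rightarrow> real \<Rightarrow> 'a \<Rightarrow> real" where
  "ito_integral M F W H T = (SOME I. has_ito_integral M F W H T I)"

definition complex_ito_integral ::
    "'a measure \<Rightarrow> (real \<Rightarrow> 'a measure) \<Rightarrow> (real \<Rightarrow> 'a \<Rightarrow> real) \<Rightarrow>
     (real \<Rightarrow> 'a \<Rightarrow> complex) \<Rightarrow> real \<Rightarrow> 'a \<Rightarrow> complex" where
  "complex_ito_integral M F W H T x =
     Complex (ito_integral M F W (\<lambda>t x. Re (H t x)) T x)
             (ito_integral M F W (\<lambda>t x. Im (H t x)) T x)"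

section \<open>Ito processes and power spectral densities\<close>

text \<open>The Ito integral being determined up to null sets only, \<open>Y\<close> may be any process that has the
  prescribed value almost surely at each time.\<close>

definition ito_process ::
    "'a measure \<Rightarrow> (real \<Rightarrow> 'a measure) \<Rightarrow> (real \<Rightarrow> 'a \<Rightarrow> real) \<Rightarrow>
     (real \<Rightarrow> 'a \<Rightarrow> real) \<Rightarrow> (real \<Rightarrow> 'a \<Rightarrow> real) \<Rightarrow> (real \<Rightarrow> 'a \<Rightarrow> real) \<Rightarrow> bool" where
  "ito_process M F W \<alpha> \<beta> Y \<longleftrightarrow>
     (\<forall>t\<ge>0. AE x in M. Y t x = (LINT s:{0..t}|lborel. \<alpha> s x) + ito_integral M F W \<beta> t x)"

text \<open>The integral of \<open>exp (-i\<omega>t)\<close> over \<open>[0, T]\<close> with respect to \<open>dY = \<alpha> dt + \<beta> dW\<close>. It is a function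
  of the coefficients \<open>\<alpha>\<close> and \<open>\<beta>\<close> of \<open>Y\<close>, and so are the spectral densities below.\<close>

definition fourier_dY ::
    "'a measure \<Rightarrow> (real \<Rightarrow> 'a measure) \<Rightarrow> (real \<Rightarrow> 'a \<Rightarrow> real) \<Rightarrow>
     (real \<Rightarrow> 'a \<Rightarrow> real) \<Rightarrow> (real \<Rightarrow> 'a \<Rightarrow> real) \<Rightarrow> real \<Rightarrow> real \<Rightarrow> 'a \<Rightarrow> complex" where
  "fourier_dY M F W \<alpha> \<beta> T \<omega> x =
     (LINT t:{0..T}|lborel. exp (- \<i> * of_real \<omega> * of_real t) * of_real (\<alpha> t x)) +
     complex_ito_integral M F W (\<lambda>t x. exp (- \<i> * of_real \<omega> * of_real t) * of_real (\<beta> t x)) T x"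

definition finite_psd ::
    "'a measure \<Rightarrow> (real \<Rightarrow> 'a measure) \<Rightarrow> (real \<Rightarrow> 'a \<Rightarrow> real) \<Rightarrow>
     (real \<Rightarrow> 'a \<Rightarrow> real) \<Rightarrow> (real \<Rightarrow> 'a \<Rightarrow> real) \<Rightarrow> real \<Rightarrow> real \<Rightarrow> real" where
  "finite_psd M F W \<alpha> \<beta> T \<omega> = (\<integral>x. 1 / T * (cmod (fourier_dY M F W \<alpha> \<beta> T \<omega> x))\<^sup>2 \<partial>M)"

definition psd_exists ::
    "'a measure \<Rightarrow> (real \<Rightarrow> 'a measure) \<Rightarrow> (real \<Rightarrow> 'a \<Rightarrow> real) \<Rightarrow>
     (real \<Rightarrow> 'a \<Rightarrow> real) \<Rightarrow> (real \<Rightarrow> 'a \<Rightarrow> real) \<Rightarrow> bool" where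
  "psd_exists M F W \<alpha> \<beta> \<longleftrightarrow>
     (\<forall>\<omega>. \<exists>L. ((\<lambda>T. finite_psd M F W \<alpha> \<beta> T \<omega>) \<longlongrightarrow> L) at_top)"

definition psd ::
    "'a measure \<Rightarrow> (real \<Rightarrow> 'a measure) \<Rightarrow> (real \<Rightarrow> 'a \<Rightarrow> real) \<Rightarrow>
     (real \<Rightarrow> 'a \<Rightarrow> real) \<Rightarrow> (real \<Rightarrow> 'a \<Rightarrow> real) \<Rightarrow> real \<Rightarrow> real" where
  "psd M F W \<alpha> \<beta> \<omega> = Lim at_top (\<lambda>T. finite_psd M F W \<alpha> \<beta> T \<omega>)"

end

(*
  Write the Fourier integral of dY over [0, T] as A + B, with A the drift and B the Ito part. By the
  Ito isometry E|B|^2 is the integral of E[beta_t^2] over [0, T], whatever the frequency, and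
  |B|^2 <= 2 |A + B|^2 + 2 |A|^2. Moreover E|A|^2 is the integral of cos(omega (s - t)) C(s, t) over
  [0, T]^2, where C(s, t) = E[alpha_s alpha_t]. Averaged over the frequencies N, ..., N + n - 1 this
  tends to 0 as n tends to infinity by dominated convergence, while the averages of the power
  spectral density are small for large N. For stationary alpha, C(s, t) = R(s - t), and the averaged
  integral is at most T times the integral of |R| against the absolute value of the averaged kernel;
  after division by T this bound no longer depends on T, which permits to let T tend to infinity
  first.
*)

theory Submission
  imports Defs
begin

section \<open>Increments of Brownian motion and the elementary Ito isometry\<close>

text \<open>The cross term E[A conj B] need not vanish, since \<alpha> may depend on W; hence the
  lossy inequality, whose factors 2 are harmless because every bound is sent to 0. The only fact
  about stochastic integrals that enters is the isometry. As \<open>ito_integral\<close> picks by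
  \<open>SOME\<close> an L^2 limit of elementary integrals, the isometry is available only once such
  a limit exists, and existence rests on density of elementary processes among the square integrable
  predictable ones and on completeness; this accounts for most of the length. The complex integral
  is treated as two real ones with integrands cos(\<omega> t) \<beta> and -sin(\<omega> t) \<beta>,
  and cos^2 + sin^2 = 1 removes the frequency from the sum of their second moments. Fixed integer
  frequencies make the average a finite sum, which commutes with the limit in T without any
  uniformity in \<omega>. In the stationary case E[\<beta>_t^2] is a constant, so its vanishing
  concerns every t and not just almost every t.\<close>

locale brownian_space = prob_space M for M :: "'a measure" +
  fixes F :: "real \<Rightarrow> 'a measure" and W :: "real \<Rightarrow> 'a \<Rightarrow> real"
  assumes filtration: "filtration_on M F" and brownian: "brownian_motion M F W"
begin

section \<open>Measurability along the filtration\<close>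

lemma subalgebra_F: "0 \<le> t \<Longrightarrow> subalgebra M (F t)"
  using filtration by (auto simp: filtration_on_def)

lemma space_F: "0 \<le> t \<Longrightarrow> space (F t) = space M"
  using subalgebra_F by (auto simp: subalgebra_def)

lemma sets_F: "0 \<le> t \<Longrightarrow> A \<in> sets (F t) \<Longrightarrow> A \<in> sets M"
  using subalgebra_F by (auto simp: subalgebra_def)

lemma measurable_F: "0 \<le> t \<Longrightarrow> X \<in> borel_measurable (F t) \<Longrightarrow> X \<in> borel_measurable M"
  using measurable_from_subalg subalgebra_F by blast

lemma F_mono: "0 \<le> s \<Longrightarrow> s \<le> t \<Longrightarrow> X \<in> borel_measurable (F s) \<Longrightarrow> X \<in> borel_measurable (F t)"
  using filtration subalgebra_F[of s] subalgebra_F[of t]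
  by (intro measurable_from_subalg[of "F t" "F s"]) (auto simp: filtration_on_def subalgebra_def)

lemma W_adapted: "0 \<le> t \<Longrightarrow> W t \<in> borel_measurable (F t)"
  using brownian by (auto simp: brownian_motion_def adapted_def)

section \<open>Independence and moments of Brownian increments\<close>

lemma indep_set_mono: "indep_set A B \<Longrightarrow> A' \<subseteq> A \<Longrightarrow> B' \<subseteq> B \<Longrightarrow> indep_set A' B'"
  unfolding indep_sets2_eq by blast

text \<open>\<open>brownian_motion\<close> gives independence of \<open>F s\<close> from the family
  of increment preimages, whereas \<open>indep_var\<close> asks for generated sigma-algebras. The
  one generated by X lies inside \<open>F s\<close>; the family of preimages is already a
  sigma-algebra, being the sets of a vimage algebra.\<close>

lemma indep_increment:
  assumes "0 \<le> s" "s < t" and X: "X \<in> borel_measurable (F s)"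
  shows "indep_var borel X borel (\<lambda>x. W t x - W s x)"
  unfolding indep_var_eq
proof (intro conjI)
  have [measurable]: "W t \<in> borel_measurable M" "W s \<in> borel_measurable M"
    using assms W_adapted measurable_F by (auto intro: measurable_F[of s] measurable_F[of t])
  show "random_variable borel X" using assms measurable_F by auto
  show "random_variable borel (\<lambda>x. W t x - W s x)" by simp
  let ?G = "{(\<lambda>x. W t x - W s x) -` B \<inter> space M | B. B \<in> sets borel}"
  have i: "indep_set (sets (F s)) ?G"
    using brownian assms by (auto simp: brownian_motion_def)
  have "{X -` A \<inter> space M |A. A \<in> sets borel} \<subseteq> sets (F s)"
    using X space_F[OF \<open>0 \<le> s\<close>] by (auto dest: measurable_sets)
  note sets.sigma_sets_subset[OF this]
  hence sX: "sigma_sets (space M) {X -` A \<inter> space M |A. A \<in> sets borel} \<subseteq> sets (F s)"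
    by (simp only: space_F[OF \<open>0 \<le> s\<close>])
  have G: "sigma_sets (space M) ?G = ?G"
  proof -
    let ?V = "vimage_algebra (space M) (\<lambda>x. W t x - W s x) borel"
    have "?G = sets ?V" by (simp add: sets_vimage_algebra2)
    thus ?thesis using sets.sigma_sets_eq[of ?V] by (simp only: space_vimage_algebra)
  qed
  show "indep_set (sigma_sets (space M) {X -` A \<inter> space M |A. A \<in> sets borel})
     (sigma_sets (space M) ?G)"
    using indep_set_mono[OF i sX subset_refl] by (simp only: G)
qed

lemma increment_moments:
  assumes "0 \<le> s" "s < t"
  shows "has_bochner_integral M (\<lambda>x. W t x - W s x) 0"
    and "has_bochner_integral M (\<lambda>x. (W t x - W s x)\<^sup>2) (t - s)"
proof -
  let ?d = "normal_density 0 (sqrt (t - s))"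
  have D: "distributed M lborel (\<lambda>x. W t x - W s x) ?d"
    using brownian assms by (auto simp: brownian_motion_def)
  have pos: "0 < sqrt (t - s)" using assms by simp
  note * = distributed_integral[OF D] distributed_integrable[OF D]
  have "has_bochner_integral lborel (\<lambda>x. ?d x * x) 0"
    using normal_moment_odd[OF pos, of 0 0] by simp
  with *(1)[of "\<lambda>x. x"] *(2)[of "\<lambda>x. x"]
  show "has_bochner_integral M (\<lambda>x. W t x - W s x) 0"
    by (simp add: has_bochner_integral_iff)
  have "has_bochner_integral lborel (\<lambda>x. ?d x * x\<^sup>2) (t - s)"
    using normal_moment_even[OF pos, of 0 1] assms by (simp add: diff_divide_distrib)
  with *(1)[of "\<lambda>x. x\<^sup>2"] *(2)[of "\<lambda>x. x\<^sup>2"]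
  show "has_bochner_integral M (\<lambda>x. (W t x - W s x)\<^sup>2) (t - s)"
    by (simp add: has_bochner_integral_iff)
qed

text \<open>The martingale property and E[(W t - W s)^2 | F s] = t - s, tested against
  \<open>F s\<close>-measurable X instead of phrased by conditional expectations. The case s = t is
  kept because clipping at T produces empty intervals.\<close>

lemma has_bochner_integral_mult_increment:
  assumes "0 \<le> s" "s \<le> t" and X: "X \<in> borel_measurable (F s)" "integrable M X"
  shows "has_bochner_integral M (\<lambda>x. X x * (W t x - W s x)) 0"
    and "has_bochner_integral M (\<lambda>x. X x * (W t x - W s x)\<^sup>2) ((t - s) * expectation X)"
proof -
  have "has_bochner_integral M (\<lambda>x. X x * (W t x - W s x)) 0 \<and>
      has_bochner_integral M (\<lambda>x. X x * (W t x - W s x)\<^sup>2) ((t - s) * expectation X)"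
  proof (cases "s = t")
    case False
    hence st: "s < t" using assms by simp
    note m = increment_moments[OF \<open>0 \<le> s\<close> st]
    have i: "indep_var borel X borel (\<lambda>x. W t x - W s x)"
      by (rule indep_increment[OF \<open>0 \<le> s\<close> st X(1)])
    have i2: "indep_var borel X borel (\<lambda>x. (W t x - W s x)\<^sup>2)"
      using indep_var_compose[OF i, of id borel "\<lambda>y. y\<^sup>2" borel] by (simp add: o_def id_def)
    show ?thesis
      using indep_var_lebesgue_integral[OF i X(2)] indep_var_integrable[OF i X(2)]
        indep_var_lebesgue_integral[OF i2 X(2)] indep_var_integrable[OF i2 X(2)] m
      by (simp add: has_bochner_integral_iff)
  qed (auto simp: has_bochner_integral_iff)
  thus "has_bochner_integral M (\<lambda>x. X x * (W t x - W s x)) 0"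
    and "has_bochner_integral M (\<lambda>x. X x * (W t x - W s x)\<^sup>2) ((t - s) * expectation X)"
    by auto
qed

section \<open>Covariances of weighted increments and the isometry for finite families\<close>

lemma integrable_bounded:
  assumes "X \<in> borel_measurable M" "\<And>x. x \<in> space M \<Longrightarrow> \<bar>X x\<bar> \<le> (C::real)"
  shows "integrable M X"
  using assms by (intro integrable_const_bound[of _ C]) auto

lemma integrable_mult_bounded:
  assumes "integrable M X" "Z \<in> borel_measurable M" "\<And>x. x \<in> space M \<Longrightarrow> \<bar>Z x\<bar> \<le> (C::real)"
  shows "integrable M (\<lambda>x. Z x * X x :: real)"
proof (rule Bochner_Integration.integrable_bound[of M "\<lambda>x. C * X x"])
  show "AE x in M. norm (Z x * X x) \<le> norm (C * X x)"
    using assms(3) by (intro AE_I2) (fastforce simp: abs_mult intro: mult_right_mono)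
qed (use assms in auto)

text \<open>Both increments are cut at c and at the end of the overlap. Every product of pieces
  except the square over the overlap is an earlier factor times a later increment and integrates to
  0; with an empty overlap nothing remains.\<close>

lemma has_bochner_integral_increments_ordered:
  assumes ord: "0 \<le> a" "a \<le> b" "a \<le> c" "c \<le> d"
    and \<xi>: "\<xi> \<in> borel_measurable (F a)" "\<And>x. x \<in> space M \<Longrightarrow> \<bar>\<xi> x\<bar> \<le> C"
    and \<eta>: "\<eta> \<in> borel_measurable (F c)" "\<And>x. x \<in> space M \<Longrightarrow> \<bar>\<eta> x\<bar> \<le> D"
  shows "has_bochner_integral M (\<lambda>x. \<xi> x * (W b x - W a x) * (\<eta> x * (W d x - W c x)))
    (expectation (\<lambda>x. \<xi> x * \<eta> x) * max 0 (min b d - max a c))"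
proof -
  have "0 \<le> c" using ord by simp
  have \<xi>c [measurable]: "\<xi> \<in> borel_measurable (F c)" by (rule F_mono[OF ord(1,3) \<xi>(1)])
  note \<eta>(1) [measurable]
  have [measurable]: "\<xi> \<in> borel_measurable M" "\<eta> \<in> borel_measurable M"
    by (rule measurable_F[OF ord(1) \<xi>(1)], rule measurable_F[OF \<open>0 \<le> c\<close> \<eta>(1)])
  have \<xi>i: "integrable M \<xi>" by (rule integrable_bounded[OF _ \<xi>(2)]) simp
  have \<xi>\<eta>: "integrable M (\<lambda>x. \<xi> x * \<eta> x)"
    using integrable_mult_bounded[where Z=\<eta>, OF \<xi>i _ \<eta>(2)] by (simp add: mult.commute)
  \<comment> \<open>Used with u = b for disjoint intervals and with u = c for overlapping ones: the
    part of the first increment up to c, with both coefficients, is known at time c.\<close>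
  have step: "integrable M (\<lambda>x. \<xi> x * (W u x - W a x) * \<eta> x)"
       "(\<lambda>x. \<xi> x * (W u x - W a x) * \<eta> x) \<in> borel_measurable (F c)" if "a \<le> u" "u \<le> c" for u
  proof -
    have "integrable M (\<lambda>x. \<xi> x * (W u x - W a x))"
      using has_bochner_integral_mult_increment(1)[OF ord(1) that(1) \<xi>(1) \<xi>i]
      by (simp add: has_bochner_integral_iff)
    from integrable_mult_bounded[where Z=\<eta>, OF this _ \<eta>(2)]
    show "integrable M (\<lambda>x. \<xi> x * (W u x - W a x) * \<eta> x)" by (simp add: mult_ac)
    have "0 \<le> u" using that ord by simp
    have [measurable]: "W u \<in> borel_measurable (F c)" "W a \<in> borel_measurable (F c)"
      by (rule F_mono[OF _ _ W_adapted]; use that ord \<open>0 \<le> u\<close> in simp)+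
    show "(\<lambda>x. \<xi> x * (W u x - W a x) * \<eta> x) \<in> borel_measurable (F c)" by measurable
  qed
  show ?thesis
  proof (cases "b \<le> c")
    case True
    from has_bochner_integral_mult_increment(1)[OF \<open>0 \<le> c\<close> ord(4) step(2,1)[OF ord(2) True]] True
    have "has_bochner_integral M (\<lambda>x. \<xi> x * (W b x - W a x) * (\<eta> x * (W d x - W c x))) 0"
      by (simp add: mult_ac)
    moreover have "max 0 (min b d - max a c) = 0" using True by simp
    ultimately show ?thesis by (simp only: mult_zero_right)
  next
    case False
    \<comment> \<open>Since e is b or d, the product (W b - W e)(W d - W e) vanishes, which is why
      \<open>eq\<close> has only four summands.\<close>
    define e where "e = min b d"
    have e: "c \<le> e" "e \<le> b" "e \<le> d" "e = b \<or> e = d" using False ord by (auto simp: e_def)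
    hence "0 \<le> e" using \<open>0 \<le> c\<close> by simp
    have meas [measurable]: "W e \<in> borel_measurable (F e)" "W c \<in> borel_measurable (F e)"
      "\<xi> \<in> borel_measurable (F e)" "\<eta> \<in> borel_measurable (F e)"
      by (rule W_adapted[OF \<open>0 \<le> e\<close>],
          (rule F_mono[OF \<open>0 \<le> c\<close> e(1)], intro W_adapted \<xi>c \<eta>(1) \<open>0 \<le> c\<close>)+)
    have X: "(\<lambda>x. \<xi> x * \<eta> x) \<in> borel_measurable (F c)" by measurable
    have Y: "(\<lambda>x. \<xi> x * \<eta> x * (W e x - W c x)) \<in> borel_measurable (F e)" by measurable
    have Yi: "integrable M (\<lambda>x. \<xi> x * \<eta> x * (W e x - W c x))"
      using has_bochner_integral_mult_increment(1)[OF \<open>0 \<le> c\<close> e(1) X \<xi>\<eta>]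
      by (simp add: has_bochner_integral_iff)
    note hs =
      has_bochner_integral_mult_increment(1)[OF \<open>0 \<le> c\<close> ord(4) step(2,1)[OF ord(3) order_refl]]
      has_bochner_integral_mult_increment(2)[OF \<open>0 \<le> c\<close> e(1) X \<xi>\<eta>]
      has_bochner_integral_mult_increment(1)[OF \<open>0 \<le> e\<close> e(3) Y Yi]
      has_bochner_integral_mult_increment(1)[OF \<open>0 \<le> e\<close> e(2) Y Yi]
    have eq: "\<xi> x * (W b x - W a x) * (\<eta> x * (W d x - W c x)) =
       \<xi> x * (W c x - W a x) * \<eta> x * (W d x - W c x) +
       (\<xi> x * \<eta> x * (W e x - W c x)\<^sup>2 +
       (\<xi> x * \<eta> x * (W e x - W c x) * (W d x - W e x) +
        \<xi> x * \<eta> x * (W e x - W c x) * (W b x - W e x)))" for x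
      using e(4) by (auto simp: algebra_simps power2_eq_square)
    have val: "expectation (\<lambda>x. \<xi> x * \<eta> x) * max 0 (min b d - max a c) =
        0 + ((e - c) * expectation (\<lambda>x. \<xi> x * \<eta> x) + (0 + 0))"
      using e(1) ord(3) by (simp add: e_def[symmetric])
    show ?thesis
      unfolding eq val by (intro has_bochner_integral_add hs)
  qed
qed

text \<open>The measure of an intersection is the integral of a product of indicators, the form in
  which both sides of the isometry can be compared. If c < a the two factors change roles.\<close>

lemma has_bochner_integral_increments:
  assumes ab: "0 \<le> a" "a \<le> b" and cd: "0 \<le> c" "c \<le> d"
    and \<xi>: "\<xi> \<in> borel_measurable (F a)" "\<And>x. x \<in> space M \<Longrightarrow> \<bar>\<xi> x\<bar> \<le> C"
    and \<eta>: "\<eta> \<in> borel_measurable (F c)" "\<And>x. x \<in> space M \<Longrightarrow> \<bar>\<eta> x\<bar> \<le> D"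
  shows "has_bochner_integral M (\<lambda>x. \<xi> x * (W b x - W a x) * (\<eta> x * (W d x - W c x)))
    (expectation (\<lambda>x. \<xi> x * \<eta> x) * measure lborel ({a<..b} \<inter> {c<..d}))"
proof -
  have Ioc: "measure lborel {u<..v} = max 0 (v - u)" for u v :: real
  proof (cases "u \<le> v")
    case True
    thus ?thesis by (simp only: measure_lborel_Ioc max_absorb2 diff_ge_0_iff_ge)
  next
    case False
    hence "{u<..v} = {}" "max 0 (v - u) = 0" by (auto simp: max_def)
    thus ?thesis by (simp only: measure_empty)
  qed
  have eq: "measure lborel ({a<..b} \<inter> {c<..d}) = max 0 (min b d - max a c)"
    unfolding Int_greaterThanAtMost by (rule Ioc)
  show ?thesis
  proof (cases "a \<le> c")
    case True
    show ?thesis unfolding eq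
      by (rule has_bochner_integral_increments_ordered[OF _ _ True _ \<xi> \<eta>]) (use ab cd in auto)
  next
    case False
    have "has_bochner_integral M (\<lambda>x. \<eta> x * (W d x - W c x) * (\<xi> x * (W b x - W a x)))
      (expectation (\<lambda>x. \<eta> x * \<xi> x) * max 0 (min d b - max c a))"
      by (rule has_bochner_integral_increments_ordered[OF _ _ _ _ \<eta> \<xi>]) (use ab cd False in auto)
    thus ?thesis unfolding eq by (simp only: mult.commute min.commute max.commute)
  qed
qed

text \<open>The intervals may overlap and the index type is arbitrary, so that differences of
  elementary processes on unrelated partitions are covered. After expanding the squares both sides
  equal the double sum V.\<close>

lemma isometry_family:
  fixes \<xi> :: "'i \<Rightarrow> 'a \<Rightarrow> real"
  assumes fin: "finite J"
    and st: "\<And>j. j \<in> J \<Longrightarrow> 0 \<le> s j \<and> s j \<le> t j \<and> t j \<le> T"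
    and \<xi>: "\<And>j. j \<in> J \<Longrightarrow> \<xi> j \<in> borel_measurable (F (s j))"
      "\<And>j x. j \<in> J \<Longrightarrow> x \<in> space M \<Longrightarrow> \<bar>\<xi> j x\<bar> \<le> C j"
  shows "(\<integral>\<^sup>+x. ennreal ((\<Sum>j\<in>J. \<xi> j x * (W (t j) x - W (s j) x))\<^sup>2) \<partial>M) =
    (\<integral>\<^sup>+u\<in>{0..T}. (\<integral>\<^sup>+x. ennreal ((\<Sum>j\<in>J. \<xi> j x * indicator {s j<..t j} u)\<^sup>2) \<partial>M) \<partial>lborel)"
proof -
  define c where "c i j = expectation (\<lambda>x. \<xi> i x * \<xi> j x)" for i j
  define V where "V = (\<Sum>i\<in>J. \<Sum>j\<in>J. c i j * measure lborel ({s i<..t i} \<inter> {s j<..t j}))"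
  define g where "g u = (\<Sum>i\<in>J. \<Sum>j\<in>J. c i j * indicator ({s i<..t i} \<inter> {s j<..t j}) u)" for u :: real
  have lhs: "has_bochner_integral M (\<lambda>x. (\<Sum>j\<in>J. \<xi> j x * (W (t j) x - W (s j) x))\<^sup>2) V"
    unfolding power2_eq_square sum_product V_def c_def using st
    by (intro has_bochner_integral_sum has_bochner_integral_increments[OF _ _ _ _ \<xi> \<xi>]) simp_all
  have \<xi>M: "\<xi> j \<in> borel_measurable M" if "j \<in> J" for j
    by (rule measurable_F[OF _ \<xi>(1)]) (use st that in auto)
  have inner: "has_bochner_integral M (\<lambda>x. (\<Sum>j\<in>J. \<xi> j x * indicator {s j<..t j} u)\<^sup>2) (g u)" for u
  proof -
    have 1: "has_bochner_integral M (\<lambda>x. \<xi> i x * \<xi> j x) (c i j)" if "i \<in> J" "j \<in> J" for i j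
      unfolding c_def
      by (rule has_bochner_integral_integrable, rule integrable_mult_bounded[OF
        integrable_bounded[OF \<xi>M[OF that(2)] \<xi>(2)[OF that(2)]] \<xi>M[OF that(1)] \<xi>(2)[OF that(1)]])
    have eq: "(\<Sum>j\<in>J. \<xi> j x * indicator {s j<..t j} u)\<^sup>2 =
        (\<Sum>i\<in>J. \<Sum>j\<in>J. \<xi> i x * \<xi> j x * indicator ({s i<..t i} \<inter> {s j<..t j}) u)" for x
      unfolding power2_eq_square sum_product by (intro sum.cong refl) (simp only: indicator_inter_arith mult_ac)
    show ?thesis unfolding eq g_def
      by (intro has_bochner_integral_sum has_bochner_integral_mult_left 1)
  qed
  have outer: "has_bochner_integral lborel g V"
    unfolding g_def V_def
  proof (intro has_bochner_integral_sum has_bochner_integral_mult_right)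
    fix i j assume "i \<in> J" "j \<in> J"
    show "has_bochner_integral lborel (indicator ({s i<..t i} \<inter> {s j<..t j}))
        (measure lborel ({s i<..t i} \<inter> {s j<..t j}))"
      by (rule has_bochner_integral_real_indicator, simp, rule emeasure_bounded_finite,
          rule bounded_subset[OF bounded_closed_interval[of "s i" "t i"]], auto)
  qed
  have g0: "g u \<ge> 0" for u
    unfolding has_bochner_integral_integral_eq[OF inner[of u], symmetric] by simp
  have out: "u \<in> {0..T}" if "g u \<noteq> 0" for u
  proof (rule ccontr)
    assume "u \<notin> {0..T}"
    hence "u \<notin> {s i<..t i}" if "i \<in> J" for i using st[OF that] by auto
    hence "g u = 0" unfolding g_def by (intro sum.neutral ballI) simp
    thus False using that by simp
  qed
  have "(\<integral>\<^sup>+u\<in>{0..T}. (\<integral>\<^sup>+x. ennreal ((\<Sum>j\<in>J. \<xi> j x * indicator {s j<..t j} u)\<^sup>2) \<partial>M) \<partial>lborel)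
      = (\<integral>\<^sup>+u. ennreal (g u) \<partial>lborel)"
  proof (intro nn_integral_cong)
    fix u :: real
    have "(\<integral>\<^sup>+x. ennreal ((\<Sum>j\<in>J. \<xi> j x * indicator {s j<..t j} u)\<^sup>2) \<partial>M) = ennreal (g u)"
      using inner[of u] by (subst nn_integral_eq_integral) (auto simp: has_bochner_integral_iff)
    thus "(\<integral>\<^sup>+x. ennreal ((\<Sum>j\<in>J. \<xi> j x * indicator {s j<..t j} u)\<^sup>2) \<partial>M) * indicator {0..T} u = ennreal (g u)"
      using out[of u] by (cases "g u = 0") simp_all
  qed
  also have "\<dots> = ennreal V"
    using outer g0 by (subst nn_integral_eq_integral) (auto simp: has_bochner_integral_iff)
  also have "\<dots> = (\<integral>\<^sup>+x. ennreal ((\<Sum>j\<in>J. \<xi> j x * (W (t j) x - W (s j) x))\<^sup>2) \<partial>M)"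
    using lhs by (subst nn_integral_eq_integral) (auto simp: has_bochner_integral_iff)
  finally show ?thesis ..
qed

section \<open>Elementary integrals truncated at the horizon\<close>

lemma elementary_data_times:
  assumes "elementary_data M F n \<tau> \<xi>" "i \<le> n"
  shows "0 \<le> \<tau> i"
  using assms(2)
proof (induction i)
  case 0
  thus ?case using assms(1) by (simp add: elementary_data_def)
next
  case (Suc i)
  hence "0 \<le> \<tau> i" "\<tau> i \<le> \<tau> (Suc i)" using assms(1) by (auto simp: elementary_data_def)
  thus ?case by simp
qed

text \<open>Coefficients of intervals that start at or after \<open>T\<close> are dropped: after truncating the interval
  at \<open>T\<close> they would no longer be measurable at its left end point.\<close>

definition clipped :: "real \<Rightarrow> (nat \<Rightarrow> real) \<Rightarrow> (nat \<Rightarrow> 'a \<Rightarrow> real) \<Rightarrow> nat \<Rightarrow> 'a \<Rightarrow> real" where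
  "clipped T \<tau> \<xi> i = (if \<tau> i < T then \<xi> i else (\<lambda>_. 0))"

text \<open>A dropped coefficient was multiplied by W T - W T.\<close>

lemma elementary_integral_clipped:
  assumes "elementary_data M F n \<tau> \<xi>"
  shows "elementary_integral W n \<tau> \<xi> T x =
    (\<Sum>i<n. clipped T \<tau> \<xi> i x * (W (min (\<tau> (Suc i)) T) x - W (min (\<tau> i) T) x))"
  unfolding elementary_integral_def
proof (intro sum.cong refl)
  fix i assume "i \<in> {..<n}"
  hence "\<tau> i \<le> \<tau> (Suc i)" using assms by (simp add: elementary_data_def)
  thus "\<xi> i x * (W (min (\<tau> (Suc i)) T) x - W (min (\<tau> i) T) x) =
      clipped T \<tau> \<xi> i x * (W (min (\<tau> (Suc i)) T) x - W (min (\<tau> i) T) x)"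
    by (cases "\<tau> i < T") (simp_all add: clipped_def min_absorb2)
qed

lemma elementary_process_clipped:
  assumes "u \<le> T"
  shows "elementary_process n \<tau> \<xi> u x =
    (\<Sum>i<n. clipped T \<tau> \<xi> i x * indicator {min (\<tau> i) T<..min (\<tau> (Suc i)) T} u)"
  unfolding elementary_process_def using assms
  by (intro sum.cong refl) (auto simp: clipped_def indicator_def)

lemma clipped_data:
  assumes "elementary_data M F n \<tau> \<xi>" "0 \<le> T" "i < n"
  shows "0 \<le> min (\<tau> i) T \<and> min (\<tau> i) T \<le> min (\<tau> (Suc i)) T \<and> min (\<tau> (Suc i)) T \<le> T"
    and "clipped T \<tau> \<xi> i \<in> borel_measurable (F (min (\<tau> i) T))"
    and "\<exists>C. \<forall>x\<in>space M. \<bar>clipped T \<tau> \<xi> i x\<bar> \<le> C"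
proof -
  have d: "\<tau> i \<le> \<tau> (Suc i)" "\<xi> i \<in> borel_measurable (F (\<tau> i))" "\<exists>C. \<forall>x\<in>space M. \<bar>\<xi> i x\<bar> \<le> C"
    using assms by (simp_all add: elementary_data_def)
  show "0 \<le> min (\<tau> i) T \<and> min (\<tau> i) T \<le> min (\<tau> (Suc i)) T \<and> min (\<tau> (Suc i)) T \<le> T"
    using elementary_data_times[OF assms(1), of i] assms d(1) by auto
  show "clipped T \<tau> \<xi> i \<in> borel_measurable (F (min (\<tau> i) T))"
    using d(2) by (simp add: clipped_def min_absorb1)
  show "\<exists>C. \<forall>x\<in>space M. \<bar>clipped T \<tau> \<xi> i x\<bar> \<le> C"
    using d(3) by (auto simp: clipped_def)
qed

lemma elementary_isometry_diff:
  assumes "elementary_data M F n \<tau> \<xi>" "elementary_data M F m \<sigma> \<eta>" "0 \<le> T"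
  shows "(\<integral>\<^sup>+x. ennreal ((elementary_integral W n \<tau> \<xi> T x - elementary_integral W m \<sigma> \<eta> T x)\<^sup>2) \<partial>M) =
    (\<integral>\<^sup>+u\<in>{0..T}. (\<integral>\<^sup>+x. ennreal ((elementary_process n \<tau> \<xi> u x - elementary_process m \<sigma> \<eta> u x)\<^sup>2) \<partial>M) \<partial>lborel)"
proof -
  \<comment> \<open>The disjoint sum of the index sets, with the second family negated, turns the
    difference into a single family and avoids a common refinement of the partitions.\<close>
  define J where "J = {..<n} <+> {..<m}"
  define s where "s = case_sum (\<lambda>i. min (\<tau> i) T) (\<lambda>i. min (\<sigma> i) T)"
  define t where "t = case_sum (\<lambda>i. min (\<tau> (Suc i)) T) (\<lambda>i. min (\<sigma> (Suc i)) T)"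
  define \<zeta> where "\<zeta> = case_sum (clipped T \<tau> \<xi>) (\<lambda>i x. - clipped T \<sigma> \<eta> i x)"
  note c1 = clipped_data[OF assms(1,3)] and c2 = clipped_data[OF assms(2,3)]
  note defs = J_def s_def t_def \<zeta>_def
  have "\<exists>C. \<forall>j\<in>J. \<forall>x\<in>space M. \<bar>\<zeta> j x\<bar> \<le> C j"
    using c1(3) c2(3) by (intro bchoice) (auto simp: defs)
  then obtain C where C: "\<And>j x. j \<in> J \<Longrightarrow> x \<in> space M \<Longrightarrow> \<bar>\<zeta> j x\<bar> \<le> C j" by blast
  have fam: "finite J" "\<And>j. j \<in> J \<Longrightarrow> 0 \<le> s j \<and> s j \<le> t j \<and> t j \<le> T"
    "\<And>j. j \<in> J \<Longrightarrow> \<zeta> j \<in> borel_measurable (F (s j))"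
    using c1(1,2) c2(1,2) by (auto simp: defs)
  have sum: "(\<Sum>j\<in>J. f j) = (\<Sum>i<n. f (Inl i)) + (\<Sum>i<m. f (Inr i))" for f :: "_ \<Rightarrow> real"
    unfolding J_def by (simp add: sum.Plus)
  have I: "elementary_integral W n \<tau> \<xi> T x - elementary_integral W m \<sigma> \<eta> T x =
      (\<Sum>j\<in>J. \<zeta> j x * (W (t j) x - W (s j) x))" for x
    unfolding sum elementary_integral_clipped[OF assms(1)] elementary_integral_clipped[OF assms(2)]
    by (simp add: defs sum_negf)
  have E: "elementary_process n \<tau> \<xi> u x - elementary_process m \<sigma> \<eta> u x =
      (\<Sum>j\<in>J. \<zeta> j x * indicator {s j<..t j} u)" if "u \<le> T" for u x
    unfolding sum elementary_process_clipped[OF that]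
    by (simp add: defs sum_negf)
  show ?thesis unfolding I
    by (subst isometry_family[OF fam C], assumption+, intro nn_integral_cong)
       (simp add: E indicator_def)
qed

lemma elementary_isometry:
  assumes "elementary_data M F n \<tau> \<xi>" "0 \<le> T"
  shows "(\<integral>\<^sup>+x. ennreal ((elementary_integral W n \<tau> \<xi> T x)\<^sup>2) \<partial>M) =
    (\<integral>\<^sup>+u\<in>{0..T}. (\<integral>\<^sup>+x. ennreal ((elementary_process n \<tau> \<xi> u x)\<^sup>2) \<partial>M) \<partial>lborel)"
  using elementary_isometry_diff[OF assms(1) _ assms(2), of 0 "\<lambda>_. 0" "\<lambda>_ _. 0"]
  by (simp add: elementary_data_def elementary_integral_def elementary_process_def)

lemma elementary_integral_measurable:
  assumes "elementary_data M F n \<tau> \<xi>" "0 \<le> T"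
  shows "elementary_integral W n \<tau> \<xi> T \<in> borel_measurable (F T)"
proof -
  have "(\<lambda>x. \<Sum>i<n. clipped T \<tau> \<xi> i x * (W (min (\<tau> (Suc i)) T) x - W (min (\<tau> i) T) x))
      \<in> borel_measurable (F T)"
  proof (intro borel_measurable_sum borel_measurable_times borel_measurable_diff)
    fix i assume "i \<in> {..<n}"
    with clipped_data[OF assms, of i]
    have c: "0 \<le> min (\<tau> i) T" "min (\<tau> i) T \<le> T" "0 \<le> min (\<tau> (Suc i)) T" "min (\<tau> (Suc i)) T \<le> T"
      "clipped T \<tau> \<xi> i \<in> borel_measurable (F (min (\<tau> i) T))" by auto
    show "clipped T \<tau> \<xi> i \<in> borel_measurable (F T)"
      by (rule F_mono[OF c(1,2,5)])
    show "W (min (\<tau> (Suc i)) T) \<in> borel_measurable (F T)"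
      by (rule F_mono[OF c(3,4) W_adapted[OF c(3)]])
    show "W (min (\<tau> i) T) \<in> borel_measurable (F T)"
      by (rule F_mono[OF c(1,2) W_adapted[OF c(1)]])
  qed
  thus ?thesis
    by (subst measurable_cong[OF elementary_integral_clipped[OF assms(1)]])
qed

end

section \<open>Approximation and completeness in \<open>L\<^sup>2\<close>\<close>

text \<open>A functional monotone class argument whose closure property is L^2(N) convergence. N may
  carry more sets than \<open>sigma \<Omega> G\<close>: f is measurable for the small sigma-algebra,
  while distances are taken in N.\<close>

lemma L2_density:
  fixes f :: "'z \<Rightarrow> real" and Q :: "('z \<Rightarrow> real) \<Rightarrow> bool"
  assumes "finite_measure N" and sub: "subalgebra N (sigma \<Omega> G)" and stable: "Int_stable G" "G \<subseteq> Pow \<Omega>"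
    and basic: "\<And>A. A \<in> G \<Longrightarrow> Q (indicator A)" and top: "Q (indicator \<Omega>)"
    and lin: "\<And>u v a b. Q u \<Longrightarrow> Q v \<Longrightarrow> Q (\<lambda>z. a * u z + b * v z)"
    and closed: "\<And>f u. f \<in> borel_measurable N \<Longrightarrow> (\<And>n. u n \<in> borel_measurable N) \<Longrightarrow> (\<And>n::nat. Q (u n)) \<Longrightarrow>
      (\<lambda>n. \<integral>\<^sup>+z. ennreal ((f z - u n z)\<^sup>2) \<partial>N) \<longlonglongrightarrow> 0 \<Longrightarrow> Q f"
    and f: "f \<in> borel_measurable (sigma \<Omega> G)" "(\<integral>\<^sup>+z. ennreal ((f z)\<^sup>2) \<partial>N) < \<infinity>"
  shows "Q f"
proof -
  interpret finite_measure N by fact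
  let ?P = "sigma \<Omega> G"
  have spN: "space N = \<Omega>" using sub stable by (auto simp: subalgebra_def)
  have PN: "u \<in> borel_measurable N" if "u \<in> borel_measurable ?P" for u :: "'z \<Rightarrow> real"
    using measurable_from_subalg[OF sub that] .
  \<comment> \<open>Turns pointwise into L^2 convergence; each later limit has to supply a square
    integrable majorant w of the errors.\<close>
  have dom: "Q f" if f: "f \<in> borel_measurable N" and u: "\<And>n. u n \<in> borel_measurable N" "\<And>n::nat. Q (u n)"
    and lim: "\<And>z. z \<in> \<Omega> \<Longrightarrow> (\<lambda>n. u n z) \<longlonglongrightarrow> f z"
    and w: "w \<in> borel_measurable N" "(\<integral>\<^sup>+z. ennreal ((w z)\<^sup>2) \<partial>N) < \<infinity>"
    and le: "\<And>n z. z \<in> \<Omega> \<Longrightarrow> \<bar>f z - u n z\<bar> \<le> \<bar>w z\<bar>" for f w :: "'z \<Rightarrow> real" and u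
  proof (rule closed[OF f u])
    have "(\<lambda>n. \<integral>\<^sup>+z. ennreal ((f z - u n z)\<^sup>2) \<partial>N) \<longlonglongrightarrow> (\<integral>\<^sup>+z. 0 \<partial>N)"
    proof (rule nn_integral_dominated_convergence[where w="\<lambda>z. ennreal ((w z)\<^sup>2)"])
      show "AE z in N. ennreal ((f z - u j z)\<^sup>2) \<le> ennreal ((w z)\<^sup>2)" for j
        using le spN by (intro AE_I2 ennreal_leI) (simp add: abs_le_square_iff)
      show "AE z in N. (\<lambda>n. ennreal ((f z - u n z)\<^sup>2)) \<longlonglongrightarrow> 0"
      proof (intro AE_I2)
        fix z assume "z \<in> space N"
        hence "(\<lambda>n. (f z - u n z)\<^sup>2) \<longlonglongrightarrow> (f z - f z)\<^sup>2"
          using lim spN by (intro tendsto_intros) auto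
        thus "(\<lambda>n. ennreal ((f z - u n z)\<^sup>2)) \<longlonglongrightarrow> 0"
          using tendsto_ennrealI by fastforce
      qed
    qed (use f u(1) w in auto)
    thus "(\<lambda>n. \<integral>\<^sup>+z. ennreal ((f z - u n z)\<^sup>2) \<partial>N) \<longlonglongrightarrow> 0" by simp
  qed
  have zero: "Q (\<lambda>_. 0)" using lin[OF top top, of 0 0] by simp
  have set: "Q (indicator A)" if "A \<in> sigma_sets \<Omega> G" for A
    using stable that
  proof (induction rule: sigma_sets_induct_disjoint)
    case (basic A)
    thus ?case by (rule assms(5))
  next
    case empty
    thus ?case using zero by (simp add: indicator_def)
  next
    case (compl A)
    have "A \<subseteq> \<Omega>" using sigma_sets_into_sp[OF stable(2) compl(1)] .
    hence "indicator (\<Omega> - A) = (\<lambda>z. 1 * indicator \<Omega> z + (-1) * (indicator A z :: real))"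
      by (auto simp: fun_eq_iff indicator_def)
    thus ?case using lin[OF top compl(2), of 1 "-1"] by simp
  next
    case (union A)
    have A: "range A \<subseteq> sets ?P" using union stable(2) by simp
    have sums: "(\<lambda>i. indicator (A i) z :: real) sums indicator (\<Union>i. A i) z" for z
      using union(1) by (intro indicator_sums) (auto simp: disjoint_family_on_def)
    have Qn: "Q (\<lambda>z. \<Sum>i<n. indicator (A i) z)" for n
    proof (induction n)
      case (Suc n)
      thus ?case using lin[OF Suc union(3)[of n], of 1 1] by (simp add: add.commute)
    qed (simp add: zero)
    show ?case
    \<comment> \<open>Partial sums over disjoint sets stay between 0 and 1, and the constant 1 is
      square integrable as N is finite.\<close>
    proof (rule dom[where w="\<lambda>_. 1" and u="\<lambda>n z. \<Sum>i<n. indicator (A i) z"])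
      have AN: "A i \<in> sets N" for i using A sub by (auto simp: subalgebra_def)
      thus "indicat_real (\<Union>i. A i) \<in> borel_measurable N" by auto
      show "(\<lambda>z. \<Sum>i<n. indicat_real (A i) z) \<in> borel_measurable N" for n using AN by auto
      show "(\<lambda>n. \<Sum>i<n. indicat_real (A i) z) \<longlonglongrightarrow> indicat_real (\<Union>i. A i) z" for z
        using sums[of z] by (simp add: sums_def)
      show "(\<integral>\<^sup>+z. ennreal (1\<^sup>2) \<partial>N) < \<infinity>" using emeasure_finite by (simp add: less_top[symmetric])
      show "\<bar>indicat_real (\<Union>i. A i) z - (\<Sum>i<n. indicat_real (A i) z)\<bar> \<le> \<bar>1\<bar>" for n z
      proof -
        have "(\<Sum>i<n. indicat_real (A i) z) \<le> indicat_real (\<Union>i. A i) z"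
          using sum_le_suminf[of "\<lambda>i. indicat_real (A i) z" "{..<n}"] sums[of z]
          by (simp add: sums_iff)
        moreover have "0 \<le> (\<Sum>i<n. indicat_real (A i) z)" by (intro sum_nonneg) simp
        moreover have "indicat_real (\<Union>i. A i) z \<le> 1" by (simp add: indicator_def)
        ultimately show ?thesis by linarith
      qed
    qed (use Qn in auto)
  qed
  have nonneg: "Q u" if u: "u \<in> borel_measurable ?P" "\<And>z. 0 \<le> u z"
    and fin: "(\<integral>\<^sup>+z. ennreal ((u z)\<^sup>2) \<partial>N) < \<infinity>" for u
    using u fin
  proof (induction rule: borel_measurable_induct_real)
    case (set A)
    thus ?case using \<open>A \<in> sigma_sets \<Omega> G \<Longrightarrow> Q (indicator A)\<close> stable(2) assms by simp
  next
    case (mult u c)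
    show ?case
    \<comment> \<open>For c = 0 a finite norm of c u says nothing about u, so the induction
      hypothesis is out of reach.\<close>
    proof (cases "c = 0")
      case True
      thus ?thesis using zero by simp
    next
      case False
      have "(\<integral>\<^sup>+z. ennreal ((c * u z)\<^sup>2) \<partial>N) = ennreal (c\<^sup>2) * (\<integral>\<^sup>+z. ennreal ((u z)\<^sup>2) \<partial>N)"
        using PN[OF mult(2)] by (subst nn_integral_cmult[symmetric]) (auto simp: ennreal_mult power_mult_distrib)
      hence "(\<integral>\<^sup>+z. ennreal ((u z)\<^sup>2) \<partial>N) < \<infinity>"
        using mult.prems False by (auto simp: ennreal_mult_less_top)
      hence "Q u" by (rule mult.IH)
      from lin[OF this zero, of c 0] show ?thesis by simp
    qed
  next
    case (add u v)
    have "(\<integral>\<^sup>+z. ennreal ((u z)\<^sup>2) \<partial>N) \<le> (\<integral>\<^sup>+z. ennreal ((v z + u z)\<^sup>2) \<partial>N)"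
         "(\<integral>\<^sup>+z. ennreal ((v z)\<^sup>2) \<partial>N) \<le> (\<integral>\<^sup>+z. ennreal ((v z + u z)\<^sup>2) \<partial>N)"
      using add.hyps by (auto intro!: nn_integral_mono ennreal_leI power_mono)
    hence "Q u" "Q v" using add.prems add.IH by (auto dest: le_less_trans)
    from lin[OF this(2,1), of 1 1] show ?case by simp
  next
    case (seq U)
    have le: "U i z \<le> u z" if "z \<in> \<Omega>" for i z
    proof -
      have "incseq (\<lambda>i. U i z)" using seq.hyps(3) by (auto simp: incseq_def le_fun_def)
      thus ?thesis using seq.hyps(4)[of z] that stable(2) by (intro incseq_le) auto
    qed
    have "Q (U i)" for i
    proof (rule seq.IH)
      have "(\<integral>\<^sup>+z. ennreal ((U i z)\<^sup>2) \<partial>N) \<le> (\<integral>\<^sup>+z. ennreal ((u z)\<^sup>2) \<partial>N)"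
        using le seq.hyps(2) spN by (intro nn_integral_mono ennreal_leI power_mono) auto
      thus "(\<integral>\<^sup>+z. ennreal ((U i z)\<^sup>2) \<partial>N) < \<infinity>" using seq.prems by (rule le_less_trans)
    qed
    note QU = this
    show ?case
    proof (rule dom[where w=u and u=U])
      show "u \<in> borel_measurable N" "u \<in> borel_measurable N" by (rule PN[OF u(1)])+
      show "U n \<in> borel_measurable N" for n by (rule PN[OF seq.hyps(1)])
      show "Q (U n)" for n by (rule QU)
      show "(\<lambda>n. U n z) \<longlonglongrightarrow> u z" if "z \<in> \<Omega>" for z
        using seq.hyps(4)[of z] that stable(2) by simp
      show "(\<integral>\<^sup>+z. ennreal ((u z)\<^sup>2) \<partial>N) < \<infinity>" by (rule seq.prems)
      show "\<bar>u z - U n z\<bar> \<le> \<bar>u z\<bar>" if "z \<in> \<Omega>" for n z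
        using le[OF that, of n] seq.hyps(2)[of n z] by linarith
    qed
  qed
  \<comment> \<open>The signs s = 1 and s = -1 treat the positive and the negative part of f
    together.\<close>
  have fm: "(\<integral>\<^sup>+z. ennreal ((max 0 (s * f z))\<^sup>2) \<partial>N) < \<infinity>" if "\<bar>s\<bar> = 1" for s
  proof -
    have "s\<^sup>2 = 1" using that by (metis power2_abs power_one)
    hence "(max 0 (s * f z))\<^sup>2 \<le> (f z)\<^sup>2" for z by (auto simp: max_def power_mult_distrib)
    hence "(\<integral>\<^sup>+z. ennreal ((max 0 (s * f z))\<^sup>2) \<partial>N) \<le> (\<integral>\<^sup>+z. ennreal ((f z)\<^sup>2) \<partial>N)"
      by (intro nn_integral_mono ennreal_leI) auto
    thus ?thesis using f(2) by (rule le_less_trans)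
  qed
  have Qm: "Q (\<lambda>z. max 0 (s * f z))" if "\<bar>s\<bar> = 1" for s
    by (rule nonneg[OF _ _ fm[OF that]]) (use f(1) in auto)
  from lin[OF Qm[of 1] Qm[of "-1"], of 1 "-1"] have "Q (\<lambda>z. max 0 (f z) - max 0 (- f z))" by simp
  moreover have "(\<lambda>z. max 0 (f z) - max 0 (- f z)) = f" by (auto simp: max_def)
  ultimately show ?thesis by simp
qed

text \<open>The constant 2 replaces square roots, so the inequality can be stated in
  \<open>ennreal\<close> and covers infinite distances.\<close>

lemma L2_triangle:
  fixes f g h :: "'z \<Rightarrow> real"
  assumes [measurable]: "f \<in> borel_measurable N" "g \<in> borel_measurable N" "h \<in> borel_measurable N"
  shows "(\<integral>\<^sup>+z. ennreal ((f z - h z)\<^sup>2) \<partial>N) \<le>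
    2 * (\<integral>\<^sup>+z. ennreal ((f z - g z)\<^sup>2) \<partial>N) + 2 * (\<integral>\<^sup>+z. ennreal ((g z - h z)\<^sup>2) \<partial>N)"
proof -
  have "(\<integral>\<^sup>+z. ennreal ((f z - h z)\<^sup>2) \<partial>N) \<le>
      (\<integral>\<^sup>+z. 2 * ennreal ((f z - g z)\<^sup>2) + 2 * ennreal ((g z - h z)\<^sup>2) \<partial>N)"
  proof (rule nn_integral_mono)
    fix z
    have "(f z - h z)\<^sup>2 \<le> 2 * (f z - g z)\<^sup>2 + 2 * (g z - h z)\<^sup>2"
      using zero_le_power2[of "f z - g z - (g z - h z)"] by (simp add: power2_eq_square algebra_simps)
    hence "ennreal ((f z - h z)\<^sup>2) \<le> ennreal (2 * (f z - g z)\<^sup>2 + 2 * (g z - h z)\<^sup>2)" by (rule ennreal_leI)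
    thus "ennreal ((f z - h z)\<^sup>2) \<le> 2 * ennreal ((f z - g z)\<^sup>2) + 2 * ennreal ((g z - h z)\<^sup>2)"
      by (simp add: ennreal_plus ennreal_mult)
  qed
  thus ?thesis by (simp add: nn_integral_add nn_integral_cmult)
qed

text \<open>\<open>L2_triangle\<close> would lose a factor 2 in the limit. Instead \<open>w\<close>
  carries a free parameter d, which is sent to 0 more slowly than the squared distance D k.\<close>

lemma L2_tendsto_norm:
  fixes f :: "'z \<Rightarrow> real" and g :: "nat \<Rightarrow> 'z \<Rightarrow> real"
  assumes [measurable]: "f \<in> borel_measurable N" "\<And>k. g k \<in> borel_measurable N"
    and fin: "(\<integral>\<^sup>+z. ennreal ((f z)\<^sup>2) \<partial>N) < \<infinity>"
    and lim: "(\<lambda>k. \<integral>\<^sup>+z. ennreal ((f z - g k z)\<^sup>2) \<partial>N) \<longlonglongrightarrow> 0"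
  shows "(\<lambda>k. \<integral>\<^sup>+z. ennreal ((g k z)\<^sup>2) \<partial>N) \<longlonglongrightarrow> (\<integral>\<^sup>+z. ennreal ((f z)\<^sup>2) \<partial>N)"
proof -
  let ?n = "\<lambda>h. \<integral>\<^sup>+z. ennreal ((h z)\<^sup>2) \<partial>N"
  have w: "?n u \<le> ennreal (1 + d) * ?n v + ennreal (1 + 1 / d) * ?n (\<lambda>z. u z - v z)"
    if "d > 0" and [measurable]: "u \<in> borel_measurable N" "v \<in> borel_measurable N" for u v and d :: real
  proof -
    have "?n u \<le> (\<integral>\<^sup>+z. ennreal (1 + d) * ennreal ((v z)\<^sup>2) + ennreal (1 + 1 / d) * ennreal ((u z - v z)\<^sup>2) \<partial>N)"
    proof (rule nn_integral_mono)
      fix z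
      \<comment> \<open>This square divided by d is exactly the gap between the two sides of the
        inequality wanted.\<close>
      have "0 \<le> (d * v z - (u z - v z))\<^sup>2 / d" using that by simp
      also have "\<dots> = (1 + d) * (v z)\<^sup>2 + (1 + 1 / d) * (u z - v z)\<^sup>2 - (u z)\<^sup>2"
        using that by (simp add: power2_eq_square field_simps)
      finally have "ennreal ((u z)\<^sup>2) \<le> ennreal ((1 + d) * (v z)\<^sup>2 + (1 + 1 / d) * (u z - v z)\<^sup>2)"
        by (intro ennreal_leI) simp
      thus "ennreal ((u z)\<^sup>2) \<le> ennreal (1 + d) * ennreal ((v z)\<^sup>2) + ennreal (1 + 1 / d) * ennreal ((u z - v z)\<^sup>2)"
        using that by (simp add: ennreal_plus ennreal_mult)
    qed
    thus ?thesis by (simp add: nn_integral_add nn_integral_cmult)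
  qed
  have sym: "?n (\<lambda>z. g k z - f z) = ?n (\<lambda>z. f z - g k z)" for k
    by (simp add: power2_commute)
  obtain L where L: "?n f = ennreal L" "0 \<le> L" using fin by (cases "?n f") auto
  define D where "D k = enn2real (?n (\<lambda>z. f z - g k z))" for k
  define X where "X k = enn2real (?n (g k))" for k
  \<comment> \<open>The square root balances the error terms: (1 + 1 / e k) D k is at most D k +
    sqrt (D k). The summand 1 / (k + 1) keeps e k positive when D k = 0.\<close>
  define e where "e k = sqrt (D k) + 1 / real (Suc k)" for k
  have D0: "0 \<le> D k" for k by (simp add: D_def)
  have e0: "0 < e k" for k using D0[of k] by (simp add: e_def add_nonneg_pos)
  have D: "D \<longlonglongrightarrow> 0" unfolding D_def using lim by (intro tendsto_enn2real) auto
  have "e \<longlonglongrightarrow> sqrt 0 + 0"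
    unfolding e_def by (intro tendsto_intros D LIMSEQ_Suc[OF lim_inverse_n'])
  hence e: "e \<longlonglongrightarrow> 0" by simp
  have De: "(1 + 1 / e k) * D k \<le> D k + sqrt (D k)" for k
  proof -
    have "D k = sqrt (D k) * sqrt (D k)" using D0[of k] by simp
    also have "\<dots> \<le> sqrt (D k) * e k" using D0[of k] by (intro mult_left_mono) (simp_all add: e_def)
    finally show ?thesis using e0[of k] by (simp add: field_simps)
  qed
  \<comment> \<open>The distance is eventually below 1, hence finite, and the passage to reals by
    \<open>enn2real\<close> loses nothing.\<close>
  have ev: "eventually (\<lambda>k. ?n (g k) = ennreal (X k) \<and> X k \<le> (1 + e k) * L + (D k + sqrt (D k)) \<and>
      L \<le> (1 + e k) * X k + (D k + sqrt (D k))) sequentially"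
    using order_tendstoD(2)[OF lim, of 1, simplified]
  proof eventually_elim
    case (elim k)
    hence Dk: "?n (\<lambda>z. f z - g k z) = ennreal (D k)" unfolding D_def
      by (subst ennreal_enn2real) (auto intro: less_trans)
    have c: "ennreal (1 + 1 / e k) * ennreal (D k) \<le> ennreal (D k + sqrt (D k))"
    proof -
      have "ennreal (1 + 1 / e k) * ennreal (D k) = ennreal ((1 + 1 / e k) * D k)"
        using e0[of k] D0[of k] by (intro ennreal_mult[symmetric]) simp_all
      thus ?thesis using ennreal_leI[OF De[of k]] by (simp only:)
    qed
    have "?n (g k) \<le> ennreal (1 + e k) * ennreal L + ennreal (1 + 1 / e k) * ennreal (D k)"
      using w[OF e0, of "g k" f k] unfolding sym Dk L(1) by simp
    also have "\<dots> \<le> ennreal (1 + e k) * ennreal L + ennreal (D k + sqrt (D k))"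
      using c by (rule add_left_mono)
    also have "\<dots> = ennreal ((1 + e k) * L + (D k + sqrt (D k)))"
      using D0[of k] L(2) e0[of k] by (subst ennreal_plus) (simp_all add: ennreal_mult)
    finally have u: "?n (g k) \<le> ennreal ((1 + e k) * L + (D k + sqrt (D k)))" .
    hence X: "?n (g k) = ennreal (X k)" unfolding X_def
      by (subst ennreal_enn2real) (auto intro: le_less_trans)
    have "0 \<le> X k" by (simp add: X_def)
    have "?n f \<le> ennreal (1 + e k) * ennreal (X k) + ennreal (1 + 1 / e k) * ennreal (D k)"
      using w[OF e0, of f "g k" k] unfolding X Dk by simp
    also have "\<dots> \<le> ennreal (1 + e k) * ennreal (X k) + ennreal (D k + sqrt (D k))"
      using c by (rule add_left_mono)
    also have "\<dots> = ennreal ((1 + e k) * X k + (D k + sqrt (D k)))"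
      using D0[of k] \<open>0 \<le> X k\<close> e0[of k] by (subst ennreal_plus) (simp_all add: ennreal_mult)
    finally have "ennreal L \<le> ennreal ((1 + e k) * X k + (D k + sqrt (D k)))" unfolding L(1) .
    hence "L \<le> (1 + e k) * X k + (D k + sqrt (D k))"
      by (subst (asm) ennreal_le_iff) (use D0[of k] \<open>0 \<le> X k\<close> e0[of k] in simp_all)
    moreover have "X k \<le> (1 + e k) * L + (D k + sqrt (D k))"
      using u unfolding X
      by (subst (asm) ennreal_le_iff) (use D0[of k] L(2) e0[of k] in simp_all)
    ultimately show ?case using X by simp
  qed
  have "X \<longlonglongrightarrow> L"
  proof (rule tendsto_sandwich)
    show "eventually (\<lambda>k. (L - (D k + sqrt (D k))) / (1 + e k) \<le> X k) sequentially"
      using ev by eventually_elim (use e0 in \<open>simp add: divide_le_eq add_pos_pos algebra_simps\<close>)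
    show "eventually (\<lambda>k. X k \<le> (1 + e k) * L + (D k + sqrt (D k))) sequentially"
      using ev by eventually_elim simp
    have "(\<lambda>k. (L - (D k + sqrt (D k))) / (1 + e k)) \<longlonglongrightarrow> (L - (0 + sqrt 0)) / (1 + 0)"
      by (intro tendsto_intros D e) simp
    thus "(\<lambda>k. (L - (D k + sqrt (D k))) / (1 + e k)) \<longlonglongrightarrow> L" by simp
    have "(\<lambda>k. (1 + e k) * L + (D k + sqrt (D k))) \<longlonglongrightarrow> (1 + 0) * L + (0 + sqrt 0)"
      by (intro tendsto_intros D e)
    thus "(\<lambda>k. (1 + e k) * L + (D k + sqrt (D k))) \<longlonglongrightarrow> L" by simp
  qed
  hence "(\<lambda>k. ennreal (X k)) \<longlonglongrightarrow> ennreal L" by (rule tendsto_ennrealI)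
  moreover have "eventually (\<lambda>k. ?n (g k) = ennreal (X k)) sequentially"
    using ev by eventually_elim simp
  ultimately show ?thesis unfolding L(1) by (simp cong: filterlim_cong add: tendsto_cong)
qed

text \<open>The geometric rate makes the increments almost surely absolutely summable, so no subsequence
  has to be extracted.\<close>

lemma L2_complete:
  fixes X :: "nat \<Rightarrow> 'z \<Rightarrow> real"
  assumes "finite_measure N" and sub: "subalgebra N A" and X: "\<And>k. X k \<in> borel_measurable A"
    and cauchy: "\<And>k l. k \<le> l \<Longrightarrow> (\<integral>\<^sup>+z. ennreal ((X l z - X k z)\<^sup>2) \<partial>N) \<le> ennreal (C * (1/4) ^ k)"
    and "0 \<le> C"
  shows "\<exists>Y\<in>borel_measurable A. (\<lambda>k. \<integral>\<^sup>+z. ennreal ((Y z - X k z)\<^sup>2) \<partial>N) \<longlonglongrightarrow> 0"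
proof -
  interpret finite_measure N by fact
  have XN [measurable]: "X k \<in> borel_measurable N" for k
    by (rule measurable_from_subalg[OF sub X])
  \<comment> \<open>Taking \<open>lim\<close> at every point keeps Y measurable for A itself; a
    correction on a null set of N could leave A.\<close>
  define Y where "Y z = lim (\<lambda>k. X k z)" for z
  have YA: "Y \<in> borel_measurable A" unfolding Y_def
    by (rule borel_measurable_lim_metric) (rule X)
  hence [measurable]: "Y \<in> borel_measurable N" by (rule measurable_from_subalg[OF sub])
  define c where "c = C + measure N (space N)"
  have c0: "0 \<le> c" using assms by (simp add: c_def)
  \<comment> \<open>An L^1 bound from the L^2 bound through |a| \<le> p a^2 + 1 / p with p = 2^k;
    against the rate (1/4)^k this choice leaves the summable (1/2)^k.\<close>
  have d: "(\<integral>\<^sup>+z. ennreal \<bar>X (Suc k) z - X k z\<bar> \<partial>N) \<le> ennreal (c * (1/2) ^ k)" for k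
  proof -
    have "(\<integral>\<^sup>+z. ennreal \<bar>X (Suc k) z - X k z\<bar> \<partial>N) \<le>
        (\<integral>\<^sup>+z. ennreal (2 ^ k) * ennreal ((X (Suc k) z - X k z)\<^sup>2) + ennreal ((1/2) ^ k) \<partial>N)"
    proof (rule nn_integral_mono)
      fix z
      define a where "a = \<bar>X (Suc k) z - X k z\<bar>"
      define p :: real where "p = 2 ^ k"
      have "p > 0" "(1/2) ^ k = 1 / p" by (simp_all add: p_def power_one_over)
      moreover have "0 \<le> (p * a - 1/2)\<^sup>2 / p" using \<open>p > 0\<close> by simp
      moreover have "(p * a - 1/2)\<^sup>2 / p = p * a\<^sup>2 - a + 1 / (4 * p)"
        using \<open>p > 0\<close> by (simp add: power2_eq_square field_simps)
      moreover have "1 / (4 * p) \<le> 1 / p" using \<open>p > 0\<close> by (simp add: field_simps)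
      ultimately have "a \<le> p * a\<^sup>2 + (1/2) ^ k" by linarith
      hence "ennreal a \<le> ennreal (p * a\<^sup>2 + (1/2) ^ k)" by (rule ennreal_leI)
      also have "\<dots> = ennreal p * ennreal (a\<^sup>2) + ennreal ((1/2) ^ k)"
        using \<open>p > 0\<close> by (subst ennreal_plus) (simp_all add: ennreal_mult)
      finally show "ennreal \<bar>X (Suc k) z - X k z\<bar> \<le>
          ennreal (2 ^ k) * ennreal ((X (Suc k) z - X k z)\<^sup>2) + ennreal ((1/2) ^ k)"
        by (simp add: a_def p_def)
    qed
    also have "\<dots> = ennreal (2 ^ k) * (\<integral>\<^sup>+z. ennreal ((X (Suc k) z - X k z)\<^sup>2) \<partial>N) +
        ennreal ((1/2) ^ k) * emeasure N (space N)"
      by (simp add: nn_integral_add nn_integral_cmult)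
    also have "\<dots> \<le> ennreal (2 ^ k) * ennreal (C * (1/4) ^ k) + ennreal ((1/2) ^ k) * ennreal (measure N (space N))"
      using cauchy[of k "Suc k"] by (intro add_mono mult_left_mono) (simp_all add: emeasure_eq_measure)
    also have "\<dots> = ennreal (2 ^ k * (C * (1/4) ^ k) + (1/2) ^ k * measure N (space N))"
      using \<open>0 \<le> C\<close> by (simp add: ennreal_mult[symmetric] ennreal_plus[symmetric] del: ennreal_plus)
    also have "2 ^ k * (C * (1/4) ^ k) = C * (1/2 :: real) ^ k"
      by (simp add: power_mult_distrib[symmetric] mult.left_commute)
    finally show ?thesis by (simp add: c_def algebra_simps)
  qed
  have "(\<integral>\<^sup>+z. (\<Sum>k. ennreal \<bar>X (Suc k) z - X k z\<bar>) \<partial>N) = (\<Sum>k. \<integral>\<^sup>+z. ennreal \<bar>X (Suc k) z - X k z\<bar> \<partial>N)"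
    by (rule nn_integral_suminf) simp
  also have "\<dots> \<le> (\<Sum>k. ennreal (c * (1/2) ^ k))" by (intro suminf_le d) auto
  also have "\<dots> = ennreal (\<Sum>k. c * (1/2) ^ k)"
    using c0 by (intro suminf_ennreal2) (auto intro!: summable_mult summable_geometric)
  finally have "(\<integral>\<^sup>+z. (\<Sum>k. ennreal \<bar>X (Suc k) z - X k z\<bar>) \<partial>N) \<noteq> \<infinity>"
    by (auto simp: top_unique)
  hence "AE z in N. (\<Sum>k. ennreal \<bar>X (Suc k) z - X k z\<bar>) \<noteq> \<infinity>"
    by (intro nn_integral_PInf_AE) auto
  hence conv: "AE z in N. (\<lambda>k. X k z) \<longlonglongrightarrow> Y z"
  proof eventually_elim
    case (elim z)
    hence "summable (\<lambda>k. \<bar>X (Suc k) z - X k z\<bar>)"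
      by (intro summable_suminf_not_top) auto
    hence "summable (\<lambda>k. X (Suc k) z - X k z)" by (rule summable_rabs_cancel)
    hence "convergent (\<lambda>n. \<Sum>k<n. X (Suc k) z - X k z)" by (simp add: summable_iff_convergent)
    hence "convergent (\<lambda>n. X n z - X 0 z)" by (simp only: sum_lessThan_telescope[of "\<lambda>k. X k z"])
    hence "convergent (\<lambda>n. X n z)"
      using convergent_add[OF _ convergent_const[of "X 0 z"], of "\<lambda>n. X n z - X 0 z"] by simp
    thus ?case by (simp add: Y_def convergent_LIMSEQ_iff)
  qed
  \<comment> \<open>Fatou's lemma as l tends to infinity in the Cauchy estimate for X l and X
    k.\<close>
  have bound: "(\<integral>\<^sup>+z. ennreal ((Y z - X k z)\<^sup>2) \<partial>N) \<le> ennreal (C * (1/4) ^ k)" for k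
  proof -
    have "(\<integral>\<^sup>+z. ennreal ((Y z - X k z)\<^sup>2) \<partial>N) = (\<integral>\<^sup>+z. liminf (\<lambda>l. ennreal ((X l z - X k z)\<^sup>2)) \<partial>N)"
    proof (rule nn_integral_cong_AE, use conv in eventually_elim)
      case (elim z)
      hence "(\<lambda>l. ennreal ((X l z - X k z)\<^sup>2)) \<longlonglongrightarrow> ennreal ((Y z - X k z)\<^sup>2)"
        by (intro tendsto_intros)
      thus ?case by (rule lim_imp_Liminf[OF sequentially_bot, symmetric])
    qed
    also have "\<dots> \<le> liminf (\<lambda>l. \<integral>\<^sup>+z. ennreal ((X l z - X k z)\<^sup>2) \<partial>N)"
      by (rule nn_integral_liminf) simp
    also have "\<dots> \<le> liminf (\<lambda>l. ennreal (C * (1/4) ^ k))"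
      by (rule Liminf_mono) (use cauchy in \<open>auto intro: eventually_mono[OF eventually_ge_at_top[of k]]\<close>)
    also have "\<dots> = ennreal (C * (1/4) ^ k)" by (simp add: Liminf_const)
    finally show ?thesis .
  qed
  have "(\<lambda>k. C * (1/4) ^ k) \<longlonglongrightarrow> C * 0"
    by (intro tendsto_intros LIMSEQ_power_zero) simp
  hence lim: "(\<lambda>k. ennreal (C * (1/4) ^ k)) \<longlonglongrightarrow> 0"
    using tendsto_ennrealI by fastforce
  have "(\<lambda>k. \<integral>\<^sup>+z. ennreal ((Y z - X k z)\<^sup>2) \<partial>N) \<longlonglongrightarrow> 0"
    by (rule tendsto_sandwich[OF _ _ tendsto_const lim]) (use bound in auto)
  with YA show ?thesis by blast
qed

section \<open>The Ito integral of predictable integrands\<close>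

text \<open>Lebesgue measure on [0, T], but carried by the space {0..}: the predictable
  sigma-algebra has the space \<open>{0..} \<times> space M\<close> for every T, and a subalgebra
  must share its space with the product measure.\<close>

definition time_measure :: "real \<Rightarrow> real measure" where
  "time_measure T = density (restrict_space lborel {0..}) (indicator {0..T})"

lemma space_time_measure [simp]: "space (time_measure T) = {0..}"
  by (simp add: time_measure_def space_restrict_space)

lemma sets_time_measure [measurable_cong]: "sets (time_measure T) = sets (restrict_space borel {0..})"
  unfolding time_measure_def sets_density by (rule sets_restrict_space_cong) simp

lemma nn_integral_time_measure:
  assumes "g \<in> borel_measurable (time_measure T)"
  shows "(\<integral>\<^sup>+t. g t \<partial>time_measure T) = (\<integral>\<^sup>+t\<in>{0..T}. g t \<partial>lborel)"
proof -
  have g: "g \<in> borel_measurable (restrict_space lborel {0..})"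
    using assms by (simp add: time_measure_def)
  have "(\<lambda>t. indicator {0..T} t :: ennreal) \<in> borel_measurable (restrict_space lborel {0..})"
    by (rule measurable_restrict_space1) simp
  with g have "(\<integral>\<^sup>+t. g t \<partial>time_measure T) = (\<integral>\<^sup>+t. indicator {0..T} t * g t \<partial>restrict_space lborel {0..})"
    unfolding time_measure_def by (subst nn_integral_density) auto
  also have "\<dots> = (\<integral>\<^sup>+t. indicator {0..T} t * g t * indicator {0..} t \<partial>lborel)"
    by (rule nn_integral_restrict_space) simp
  also have "\<dots> = (\<integral>\<^sup>+t\<in>{0..T}. g t \<partial>lborel)"
    by (intro nn_integral_cong) (auto simp: indicator_def)
  finally show ?thesis .
qed

lemma emeasure_time_measure:
  assumes "0 \<le> T"
  shows "emeasure (time_measure T) {0..} = ennreal T"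
proof -
  have "emeasure (time_measure T) (space (time_measure T)) = (\<integral>\<^sup>+t. 1 \<partial>time_measure T)" by simp
  also have "\<dots> = (\<integral>\<^sup>+t\<in>{0..T}. 1 \<partial>lborel)" by (rule nn_integral_time_measure) simp
  also have "\<dots> = ennreal T" using assms by simp
  finally show ?thesis by simp
qed

lemma finite_measure_time_measure: "finite_measure (time_measure T)"
proof (cases "0 \<le> T")
  case True
  thus ?thesis by (intro finite_measureI) (simp add: emeasure_time_measure)
next
  case False
  have "emeasure (time_measure T) (space (time_measure T)) = (\<integral>\<^sup>+t. 1 \<partial>time_measure T)" by simp
  also have "\<dots> = (\<integral>\<^sup>+t\<in>{0..T}. 1 \<partial>lborel)" by (rule nn_integral_time_measure) simp
  also have "\<dots> = 0" using False by simp
  finally show ?thesis by (intro finite_measureI) simp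
qed

lemma measurable_fst_time [measurable]: "fst \<in> borel_measurable (time_measure T \<Otimes>\<^sub>M N)"
proof -
  have "(\<lambda>t. t) \<in> borel_measurable (time_measure T)"
    by (simp add: measurable_cong_sets[OF sets_time_measure refl] measurable_restrict_space1)
  from measurable_compose[OF measurable_fst[of _ N] this] show ?thesis by simp
qed

section \<open>The predictable sigma-algebra inside the product of time and probability
  space\<close>

context brownian_space
begin

sublocale time: pair_sigma_finite "time_measure T" M for T
proof -
  interpret T: finite_measure "time_measure T" by (rule finite_measure_time_measure)
  show "pair_sigma_finite (time_measure T) M" ..
qed

abbreviation process_measure :: "real \<Rightarrow> (real \<times> 'a) measure" where
  "process_measure T \<equiv> time_measure T \<Otimes>\<^sub>M M"

lemma finite_process_measure: "finite_measure (process_measure T)"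
  by (rule finite_measure_pair_measure[OF _ finite_measure_time_measure]) unfold_locales

lemma nn_integral_process_measure:
  assumes "f \<in> borel_measurable (process_measure T)"
  shows "(\<integral>\<^sup>+z. f z \<partial>process_measure T) = (\<integral>\<^sup>+t\<in>{0..T}. (\<integral>\<^sup>+x. f (t, x) \<partial>M) \<partial>lborel)"
  unfolding nn_integral_fst[OF assms, symmetric]
  by (rule nn_integral_time_measure) (rule borel_measurable_nn_integral_fst[OF assms])

text \<open>Stability under intersection is what Dynkin's lemma inside \<open>L2_density\<close>
  asks of the generator.\<close>

lemma predictable_generator:
  defines "G \<equiv> {{0} \<times> A | A. A \<in> sets (F 0)} \<union>
      {{s<..t} \<times> A | s t A. 0 \<le> s \<and> s \<le> t \<and> A \<in> sets (F s)}"
  shows "G \<subseteq> Pow ({0..} \<times> space M)" "Int_stable G"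
proof -
  show "G \<subseteq> Pow ({0..} \<times> space M)"
  proof
    fix a assume "a \<in> G"
    then consider A where "a = {0} \<times> A" "A \<in> sets (F 0)"
      | s t A where "a = {s<..t} \<times> A" "0 \<le> s" "A \<in> sets (F s)"
      unfolding G_def by blast
    thus "a \<in> Pow ({0..} \<times> space M)"
    proof cases
      case 1
      thus ?thesis using sets.sets_into_space[OF sets_F[OF order_refl 1(2)]] by auto
    next
      case 2
      thus ?thesis using sets.sets_into_space[OF sets_F[OF 2(2,3)]] by auto
    qed
  qed
  show "Int_stable G"
  proof (rule Int_stableI)
    \<comment> \<open>The outer maximum keeps the right end point at or above the left one when the
      time intervals are disjoint; a generator requires s \<le> t.\<close>
    have fin: "{max s s'<..max (max s s') (min t t')} \<times> (A \<inter> B) \<in> G"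
      if "0 \<le> s" "0 \<le> s'" "A \<in> sets (F s)" "B \<in> sets (F s')" for s s' t t' A B
    proof -
      have "A \<in> sets (F (max s s'))" "B \<in> sets (F (max s s'))"
        using filtration that unfolding filtration_on_def by (meson max.cobounded1 max.cobounded2 subsetD)+
      hence "A \<inter> B \<in> sets (F (max s s'))" by (rule sets.Int)
      thus ?thesis unfolding G_def using that(1)
        by (intro UnI2 CollectI exI[of _ "max s s'"] exI[of _ "max (max s s') (min t t')"]
            exI[of _ "A \<inter> B"] conjI refl) auto
    qed
    have empty: "{} \<in> G"
      unfolding G_def by (intro UnI1 CollectI exI[of _ "{}"]) simp
    fix a b assume "a \<in> G" "b \<in> G"
    then consider (00) A B where "a = {0} \<times> A" "b = {0} \<times> B" "A \<in> sets (F 0)" "B \<in> sets (F 0)"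
      | (0) s t A B where "a = {0} \<times> A \<and> b = {s<..t} \<times> B \<or> a = {s<..t} \<times> A \<and> b = {0} \<times> B" "0 \<le> s"
      | (1) s t A s' t' B where "a = {s<..t} \<times> A" "b = {s'<..t'} \<times> B" "0 \<le> s" "0 \<le> s'"
          "A \<in> sets (F s)" "B \<in> sets (F s')"
      unfolding G_def by blast
    thus "a \<inter> b \<in> G"
    proof cases
      case 00
      hence "a \<inter> b = {0} \<times> (A \<inter> B)" by auto
      thus ?thesis unfolding G_def using 00 by blast
    next
      case 0
      hence "a \<inter> b = {}" by auto
      thus ?thesis using empty by simp
    next
      case 1
      hence "a \<inter> b = {max s s'<..max (max s s') (min t t')} \<times> (A \<inter> B)" by auto
      thus ?thesis using fin 1 by simp
    qed
  qed
qed

lemma subalgebra_predictable: "subalgebra (process_measure T) (predictable_sigma M F)"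
  unfolding subalgebra_def
proof
  show "space (predictable_sigma M F) = space (process_measure T)"
    unfolding predictable_sigma_def using predictable_generator(1) by (simp add: space_pair_measure)
  have t: "{0} \<in> sets (time_measure T)" "0 \<le> s \<Longrightarrow> {s<..t} \<in> sets (time_measure T)" for s t
    by (auto simp: sets_time_measure sets_restrict_space_iff)
  have "sets (predictable_sigma M F) = sigma_sets (space (process_measure T))
      ({{0} \<times> A | A. A \<in> sets (F 0)} \<union> {{s<..t} \<times> A | s t A. 0 \<le> s \<and> s \<le> t \<and> A \<in> sets (F s)})"
    unfolding predictable_sigma_def using predictable_generator(1) by (simp add: space_pair_measure)
  also have "\<dots> \<subseteq> sets (process_measure T)"
  proof (rule sets.sigma_sets_subset, rule subsetI)
    fix a assume "a \<in> {{0} \<times> A | A. A \<in> sets (F 0)} \<union> {{s<..t} \<times> A | s t A. 0 \<le> s \<and> s \<le> t \<and> A \<in> sets (F s)}"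
    thus "a \<in> sets (process_measure T)"
      using t sets_F[OF order_refl] sets_F by (auto intro: pair_measureI)
  qed
  finally show "sets (predictable_sigma M F) \<subseteq> sets (process_measure T)" .
qed

lemma elementary_process_measurable:
  assumes "elementary_data M F n \<tau> \<xi>"
  shows "(\<lambda>z. elementary_process n \<tau> \<xi> (fst z) (snd z)) \<in> borel_measurable (process_measure T)"
  unfolding elementary_process_def
proof (intro borel_measurable_sum borel_measurable_times)
  fix i assume "i \<in> {..<n}"
  hence [measurable]: "\<xi> i \<in> borel_measurable M"
    using assms elementary_data_times[OF assms, of i] measurable_F[of "\<tau> i"] by (auto simp: elementary_data_def)
  show "(\<lambda>z. \<xi> i (snd z)) \<in> borel_measurable (process_measure T)" by measurable
  show "(\<lambda>z. indicat_real {\<tau> i<..\<tau> (Suc i)} (fst z)) \<in> borel_measurable (process_measure T)" by measurable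
qed

section \<open>Approximation of predictable processes on uniform grids\<close>

definition grid :: "real \<Rightarrow> nat \<Rightarrow> nat \<Rightarrow> real" where
  "grid T k i = real i * T / real k"

lemma grid_process:
  assumes "0 < u" "u \<le> T" "0 < k"
  shows "\<exists>j<k. grid T k j < u \<and> u \<le> grid T k j + T / k \<and>
    (\<forall>(\<xi> :: nat \<Rightarrow> 'a \<Rightarrow> real) x. elementary_process k (grid T k) \<xi> u x = \<xi> j x)"
proof -
  have T: "0 < T" using assms by simp
  define r where "r = u * k / T"
  have r: "0 < r" "r \<le> k" using assms T by (auto simp: r_def field_simps)
  \<comment> \<open>Cells are open on the left and closed on the right, so the index is the ceiling
    minus 1 and not the floor.\<close>
  define j where "j = nat \<lceil>r\<rceil> - 1"
  have j: "real j < r" "r \<le> real j + 1"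
    using r by (auto simp: j_def of_nat_diff, linarith+)
  have iff: "grid T k i < u \<longleftrightarrow> real i < r" "u \<le> grid T k i \<longleftrightarrow> r \<le> real i" for i
    using assms T by (auto simp: grid_def r_def field_simps)
  show ?thesis
  proof (intro exI[of _ j] conjI allI)
    show "j < k" using j r by linarith
    show "grid T k j < u" using iff j by simp
    show "u \<le> grid T k j + T / k"
      using iff(2)[of "Suc j"] j(2) by (simp add: grid_def field_simps add_divide_distrib)
    fix \<xi> :: "nat \<Rightarrow> 'a \<Rightarrow> real" and x
    have "indicator {grid T k i<..grid T k (Suc i)} u = (if i = j then 1 else 0 :: real)" for i
      using j iff(1)[of i] iff(2)[of "Suc i"] by (auto simp: indicator_def)
    thus "elementary_process k (grid T k) \<xi> u x = \<xi> j x"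
      using \<open>j < k\<close> by (simp add: elementary_process_def if_distrib[of "\<lambda>y. _ * y"] cong: if_cong)
  qed
qed

lemma grid_data:
  assumes "0 \<le> T" "\<And>i. i < k \<Longrightarrow> \<xi> i \<in> borel_measurable (F (grid T k i))"
    "\<And>i x. \<bar>\<xi> i x\<bar> \<le> 1"
  shows "elementary_data M F k (grid T k) \<xi>"
  unfolding elementary_data_def using assms
  by (auto simp: grid_def divide_right_mono mult_right_mono)

lemma distance_le_emeasure:
  assumes "\<And>t x. t \<in> {0..T} \<Longrightarrow> x \<in> space M \<Longrightarrow> (f (t, x))\<^sup>2 \<le> indicator B t"
    and [measurable]: "f \<in> borel_measurable (process_measure T)" "B \<in> sets borel"
  shows "(\<integral>\<^sup>+z. ennreal ((f z)\<^sup>2) \<partial>process_measure T) \<le> emeasure lborel B"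
proof -
  have "(\<integral>\<^sup>+z. ennreal ((f z)\<^sup>2) \<partial>process_measure T) = 
      (\<integral>\<^sup>+t\<in>{0..T}. (\<integral>\<^sup>+x. ennreal ((f (t, x))\<^sup>2) \<partial>M) \<partial>lborel)"
    by (rule nn_integral_process_measure) measurable
  also have "\<dots> \<le> (\<integral>\<^sup>+t. indicator B t \<partial>lborel)"
  proof (rule nn_integral_mono)
    fix t :: real
    show "(\<integral>\<^sup>+x. ennreal ((f (t, x))\<^sup>2) \<partial>M) * indicator {0..T} t \<le> indicator B t"
    proof (cases "t \<in> {0..T}")
      case True
      have "(\<integral>\<^sup>+x. ennreal ((f (t, x))\<^sup>2) \<partial>M) \<le> (\<integral>\<^sup>+x. ennreal (indicator B t) \<partial>M)"
        by (intro nn_integral_mono ennreal_leI assms(1) True)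
      also have "\<dots> = indicator B t" by (simp add: emeasure_space_1 ennreal_indicator)
      finally show ?thesis using True by simp
    qed simp
  qed
  finally show ?thesis by simp
qed

text \<open>Approximation is required on every sufficiently fine uniform grid, so that two approximants can
  be taken on the same grid and linear combinations need no common refinement.\<close>

definition approximable :: "real \<Rightarrow> (real \<times> 'a \<Rightarrow> real) \<Rightarrow> bool" where
  "approximable T f \<longleftrightarrow> f \<in> borel_measurable (process_measure T) \<and>
    (\<forall>e>0. \<forall>\<^sub>F k in sequentially. \<exists>\<xi>. elementary_data M F k (grid T k) \<xi> \<and>
      (\<integral>\<^sup>+z. ennreal ((f z - elementary_process k (grid T k) \<xi> (fst z) (snd z))\<^sup>2) \<partial>process_measure T) < ennreal e)"

lemma approximable_lincomb:
  assumes "approximable T u" "approximable T v"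
  shows "approximable T (\<lambda>z. a * u z + b * v z)"
  unfolding approximable_def
proof (intro conjI allI impI)
  have [measurable]: "u \<in> borel_measurable (process_measure T)" "v \<in> borel_measurable (process_measure T)"
    using assms by (auto simp: approximable_def)
  show "(\<lambda>z. a * u z + b * v z) \<in> borel_measurable (process_measure T)" by measurable
  fix e :: real assume "0 < e"
  \<comment> \<open>The weights come from (a p + b q)^2 \<le> 2 a^2 p^2 + 2 b^2 q^2; the summand 1
    avoids division by 0 for a = b = 0 and makes the estimate strict.\<close>
  define d where "d = e / (2 * a\<^sup>2 + 2 * b\<^sup>2 + 1)"
  have pos: "0 < 2 * a\<^sup>2 + 2 * b\<^sup>2 + 1" by (simp add: add_nonneg_pos)
  have d: "0 < d" "(2 * a\<^sup>2 + 2 * b\<^sup>2) * d < e"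
    using \<open>0 < e\<close> pos by (auto simp: d_def divide_less_eq field_simps)
  let ?E = "\<lambda>k \<xi> z. elementary_process k (grid T k) \<xi> (fst z) (snd z)"
  have "\<forall>\<^sub>F k in sequentially. \<exists>\<xi>. elementary_data M F k (grid T k) \<xi> \<and>
      (\<integral>\<^sup>+z. ennreal ((u z - ?E k \<xi> z)\<^sup>2) \<partial>process_measure T) < ennreal d"
    using assms(1) d(1) by (simp add: approximable_def)
  moreover have "\<forall>\<^sub>F k in sequentially. \<exists>\<xi>. elementary_data M F k (grid T k) \<xi> \<and>
      (\<integral>\<^sup>+z. ennreal ((v z - ?E k \<xi> z)\<^sup>2) \<partial>process_measure T) < ennreal d"
    using assms(2) d(1) by (simp add: approximable_def)
  ultimately show "\<forall>\<^sub>F k in sequentially. \<exists>\<xi>. elementary_data M F k (grid T k) \<xi> \<and>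
      (\<integral>\<^sup>+z. ennreal ((a * u z + b * v z - ?E k \<xi> z)\<^sup>2) \<partial>process_measure T) < ennreal e"
  proof eventually_elim
    case (elim k)
    then obtain \<xi> \<eta> where \<xi>: "elementary_data M F k (grid T k) \<xi>"
        "(\<integral>\<^sup>+z. ennreal ((u z - ?E k \<xi> z)\<^sup>2) \<partial>process_measure T) < ennreal d"
      and \<eta>: "elementary_data M F k (grid T k) \<eta>"
        "(\<integral>\<^sup>+z. ennreal ((v z - ?E k \<eta> z)\<^sup>2) \<partial>process_measure T) < ennreal d" by blast
    note [measurable] = elementary_process_measurable[OF \<xi>(1)] elementary_process_measurable[OF \<eta>(1)]
    define \<zeta> where "\<zeta> i x = a * \<xi> i x + b * \<eta> i x" for i x
    have "elementary_data M F k (grid T k) \<zeta>"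
      unfolding elementary_data_def
    proof (intro conjI allI impI)
      show "0 \<le> grid T k 0" "\<And>i. i < k \<Longrightarrow> grid T k i \<le> grid T k (Suc i)"
        using \<xi>(1) by (auto simp: elementary_data_def)
      fix i assume "i < k"
      hence m: "\<xi> i \<in> borel_measurable (F (grid T k i))" "\<eta> i \<in> borel_measurable (F (grid T k i))"
        and "\<exists>C. \<forall>x\<in>space M. \<bar>\<xi> i x\<bar> \<le> C" "\<exists>C. \<forall>x\<in>space M. \<bar>\<eta> i x\<bar> \<le> C"
        using \<xi>(1) \<eta>(1) by (simp_all add: elementary_data_def)
      then obtain C D where CD: "\<And>x. x \<in> space M \<Longrightarrow> \<bar>\<xi> i x\<bar> \<le> C" "\<And>x. x \<in> space M \<Longrightarrow> \<bar>\<eta> i x\<bar> \<le> D" by blast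
      show "\<zeta> i \<in> borel_measurable (F (grid T k i))" unfolding \<zeta>_def using m by measurable
      have "\<bar>\<zeta> i x\<bar> \<le> \<bar>a\<bar> * C + \<bar>b\<bar> * D" if "x \<in> space M" for x
        unfolding \<zeta>_def using mult_left_mono[OF CD(1)[OF that], of "\<bar>a\<bar>"] mult_left_mono[OF CD(2)[OF that], of "\<bar>b\<bar>"]
          abs_triangle_ineq[of "a * \<xi> i x" "b * \<eta> i x"] by (simp add: abs_mult)
      thus "\<exists>C. \<forall>x\<in>space M. \<bar>\<zeta> i x\<bar> \<le> C" by blast
    qed
    moreover have "(\<integral>\<^sup>+z. ennreal ((a * u z + b * v z - ?E k \<zeta> z)\<^sup>2) \<partial>process_measure T) < ennreal e"
    proof -
      have E: "?E k \<zeta> z = a * ?E k \<xi> z + b * ?E k \<eta> z" for z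
        by (simp only: elementary_process_def \<zeta>_def sum_distrib_left sum.distrib distrib_right mult.assoc)
      have "(\<integral>\<^sup>+z. ennreal ((a * u z + b * v z - ?E k \<zeta> z)\<^sup>2) \<partial>process_measure T) \<le>
          (\<integral>\<^sup>+z. ennreal (2 * a\<^sup>2) * ennreal ((u z - ?E k \<xi> z)\<^sup>2) + ennreal (2 * b\<^sup>2) * ennreal ((v z - ?E k \<eta> z)\<^sup>2) \<partial>process_measure T)"
      proof (rule nn_integral_mono)
        fix z
        define p q where "p = u z - ?E k \<xi> z" and "q = v z - ?E k \<eta> z"
        have "a * u z + b * v z - ?E k \<zeta> z = a * p + b * q"
          unfolding E p_def q_def by (simp add: algebra_simps)
        moreover have "(a * p + b * q)\<^sup>2 \<le> 2 * a\<^sup>2 * p\<^sup>2 + 2 * b\<^sup>2 * q\<^sup>2"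
          using zero_le_power2[of "a * p - b * q"] by (simp add: power2_eq_square algebra_simps)
        hence "ennreal ((a * p + b * q)\<^sup>2) \<le> ennreal (2 * a\<^sup>2 * p\<^sup>2 + 2 * b\<^sup>2 * q\<^sup>2)" by (rule ennreal_leI)
        moreover have "\<dots> = ennreal (2 * a\<^sup>2) * ennreal (p\<^sup>2) + ennreal (2 * b\<^sup>2) * ennreal (q\<^sup>2)"
          by (subst ennreal_plus) (simp_all add: ennreal_mult)
        ultimately show "ennreal ((a * u z + b * v z - ?E k \<zeta> z)\<^sup>2) \<le>
            ennreal (2 * a\<^sup>2) * ennreal ((u z - ?E k \<xi> z)\<^sup>2) + ennreal (2 * b\<^sup>2) * ennreal ((v z - ?E k \<eta> z)\<^sup>2)"
          unfolding p_def[symmetric] q_def[symmetric] by simp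
      qed
      also have "\<dots> = ennreal (2 * a\<^sup>2) * (\<integral>\<^sup>+z. ennreal ((u z - ?E k \<xi> z)\<^sup>2) \<partial>process_measure T)
          + ennreal (2 * b\<^sup>2) * (\<integral>\<^sup>+z. ennreal ((v z - ?E k \<eta> z)\<^sup>2) \<partial>process_measure T)"
        by (simp add: nn_integral_add nn_integral_cmult)
      also have "\<dots> \<le> ennreal (2 * a\<^sup>2) * ennreal d + ennreal (2 * b\<^sup>2) * ennreal d"
        using \<xi>(2) \<eta>(2) by (intro add_mono mult_left_mono) auto
      also have "\<dots> = ennreal ((2 * a\<^sup>2 + 2 * b\<^sup>2) * d)"
        using d(1) by (simp add: ennreal_mult[symmetric] ennreal_plus[symmetric] distrib_right del: ennreal_plus)
      also have "\<dots> < ennreal e" using d \<open>0 < e\<close> by (simp add: ennreal_less_iff)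
      finally show ?thesis .
    qed
    ultimately show ?case by blast
  qed
qed

lemma approximable_closed:
  assumes f: "f \<in> borel_measurable (process_measure T)" and u: "\<And>n::nat. approximable T (u n)"
    and lim: "(\<lambda>n. \<integral>\<^sup>+z. ennreal ((f z - u n z)\<^sup>2) \<partial>process_measure T) \<longlonglongrightarrow> 0"
  shows "approximable T f"
  unfolding approximable_def
proof (intro conjI allI impI f)
  fix e :: real assume "0 < e"
  let ?E = "\<lambda>k \<xi> z. elementary_process k (grid T k) \<xi> (fst z) (snd z)"
  have "\<forall>\<^sub>F n in sequentially. (\<integral>\<^sup>+z. ennreal ((f z - u n z)\<^sup>2) \<partial>process_measure T) < ennreal (e / 4)"
    using \<open>0 < e\<close> by (intro order_tendstoD(2)[OF lim]) simp
  then obtain n where n: "(\<integral>\<^sup>+z. ennreal ((f z - u n z)\<^sup>2) \<partial>process_measure T) < ennreal (e / 4)"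
    by (auto simp: eventually_sequentially)
  have un: "u n \<in> borel_measurable (process_measure T)" using u by (simp add: approximable_def)
  have "\<forall>\<^sub>F k in sequentially. \<exists>\<xi>. elementary_data M F k (grid T k) \<xi> \<and>
      (\<integral>\<^sup>+z. ennreal ((u n z - ?E k \<xi> z)\<^sup>2) \<partial>process_measure T) < ennreal (e / 4)"
    using u[of n] \<open>0 < e\<close> unfolding approximable_def by auto
  thus "\<forall>\<^sub>F k in sequentially. \<exists>\<xi>. elementary_data M F k (grid T k) \<xi> \<and>
      (\<integral>\<^sup>+z. ennreal ((f z - ?E k \<xi> z)\<^sup>2) \<partial>process_measure T) < ennreal e"
  proof eventually_elim
    case (elim k)
    then obtain \<xi> where \<xi>: "elementary_data M F k (grid T k) \<xi>"
        "(\<integral>\<^sup>+z. ennreal ((u n z - ?E k \<xi> z)\<^sup>2) \<partial>process_measure T) < ennreal (e / 4)" by blast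
    have "(\<integral>\<^sup>+z. ennreal ((f z - ?E k \<xi> z)\<^sup>2) \<partial>process_measure T) \<le>
        2 * (\<integral>\<^sup>+z. ennreal ((f z - u n z)\<^sup>2) \<partial>process_measure T) +
        2 * (\<integral>\<^sup>+z. ennreal ((u n z - ?E k \<xi> z)\<^sup>2) \<partial>process_measure T)"
      by (rule L2_triangle[OF f un elementary_process_measurable[OF \<xi>(1)]])
    also have "\<dots> < 2 * ennreal (e / 4) + 2 * ennreal (e / 4)"
      using n \<xi>(2) by (intro add_strict_mono ennreal_mult_strict_left_mono) auto
    also have "\<dots> = ennreal e"
      using \<open>0 < e\<close> by (simp add: ennreal_mult[symmetric] ennreal_plus[symmetric] del: ennreal_plus flip: ennreal_numeral)
    finally show ?case using \<xi>(1) by blast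
  qed
qed

text \<open>Whether a cell is switched on is decided at its left end point, which keeps the
  coefficients adapted. The price is an error within one mesh width after s and after t, on two
  strips of total length 2 T / k.\<close>

lemma approximable_indicator_Ioc:
  assumes "0 < T" "0 \<le> s" "s \<le> t" "A \<in> sets (F s)"
  shows "approximable T (indicator ({s<..t} \<times> A))"
  unfolding approximable_def
proof (intro conjI allI impI)
  have "{s<..t} \<times> A \<in> sets (process_measure T)"
    using assms sets_F by (intro pair_measureI) (auto simp: sets_time_measure sets_restrict_space_iff)
  thus ind [measurable]: "indicat_real ({s<..t} \<times> A) \<in> borel_measurable (process_measure T)" by simp
  fix e :: real assume "0 < e"
  let ?E = "\<lambda>k \<xi> z. elementary_process k (grid T k) \<xi> (fst z) (snd z)"
  obtain k0 where k0: "2 * T / e < real k0" using reals_Archimedean2 by blast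
  have "\<forall>\<^sub>F k in sequentially. max 1 k0 \<le> k" by (rule eventually_ge_at_top)
  thus "\<forall>\<^sub>F k in sequentially. \<exists>\<xi>. elementary_data M F k (grid T k) \<xi> \<and>
      (\<integral>\<^sup>+z. ennreal ((indicator ({s<..t} \<times> A) z - ?E k \<xi> z)\<^sup>2) \<partial>process_measure T) < ennreal e"
  proof eventually_elim
    case (elim k)
    hence k: "0 < k" "2 * T / e < real k" using k0 by auto
    hence small: "T / k + T / k < e" using \<open>0 < e\<close> by (simp add: field_simps)
    define \<xi> :: "nat \<Rightarrow> 'a \<Rightarrow> real" where
      "\<xi> i = (if s \<le> grid T k i \<and> grid T k i < t then indicator A else (\<lambda>_. 0))" for i
    have data: "elementary_data M F k (grid T k) \<xi>"
    proof (rule grid_data)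
      fix i
      show "\<xi> i \<in> borel_measurable (F (grid T k i))"
      proof (cases "s \<le> grid T k i")
        case True
        have "indicat_real A \<in> borel_measurable (F s)" using assms(4) by simp
        from F_mono[OF \<open>0 \<le> s\<close> True this] show ?thesis by (simp add: \<xi>_def)
      qed (simp add: \<xi>_def)
    qed (use assms in \<open>auto simp: \<xi>_def indicator_def\<close>)
    \<comment> \<open>Off the strips, u and the left end of its cell lie on the same side of s and
      of t. Time 0 is set apart because no grid cell contains it.\<close>
    let ?B = "{0} \<union> ({s<..s + T / k} \<union> {t<..t + T / k})"
    have "(\<integral>\<^sup>+z. ennreal ((indicator ({s<..t} \<times> A) z - ?E k \<xi> z)\<^sup>2) \<partial>process_measure T) \<le> emeasure lborel ?B"
    proof (rule distance_le_emeasure)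
      fix u x assume u: "u \<in> {0..T}" and x: "x \<in> space M"
      show "(indicat_real ({s<..t} \<times> A) (u, x) - ?E k \<xi> (u, x))\<^sup>2 \<le> indicat_real ?B u"
      proof (cases "u \<in> ?B")
        case True
        have "\<bar>?E k \<xi> (u, x)\<bar> \<le> 1 \<and> ?E k \<xi> (u, x) \<ge> 0"
        proof (cases "u = 0")
          case True
          have "grid T k i \<ge> 0" for i using \<open>0 < T\<close> by (simp add: grid_def)
          hence "indicat_real {grid T k i<..grid T k (Suc i)} 0 = 0" for i by (auto simp: indicator_def not_less)
          thus ?thesis using True by (simp add: elementary_process_def)
        next
          case False
          hence "0 < u" "u \<le> T" using u by auto
          from grid_process[OF this \<open>0 < k\<close>] obtain j where
            "\<forall>(\<xi> :: nat \<Rightarrow> 'a \<Rightarrow> real) x. elementary_process k (grid T k) \<xi> u x = \<xi> j x"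
            by (elim exE conjE)
          thus ?thesis by (simp add: \<xi>_def indicator_def)
        qed
        hence "\<bar>indicat_real ({s<..t} \<times> A) (u, x) - ?E k \<xi> (u, x)\<bar> \<le> 1"
          by (auto simp: indicator_def)
        thus ?thesis unfolding indicator_simps(1)[OF True] by (simp only: abs_square_le_1)
      next
        case False
        hence "0 < u" "u \<le> T" using u by simp_all
        from grid_process[OF this \<open>0 < k\<close>] obtain j where
          j: "grid T k j < u" "u \<le> grid T k j + T / k"
            "\<forall>(\<xi> :: nat \<Rightarrow> 'a \<Rightarrow> real) x. elementary_process k (grid T k) \<xi> u x = \<xi> j x"
          by (elim exE conjE)
        have "s < u \<and> u \<le> t \<longleftrightarrow> s \<le> grid T k j \<and> grid T k j < t"
          using j(1,2) False by auto
        hence "?E k \<xi> (u, x) = indicat_real ({s<..t} \<times> A) (u, x)"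
          unfolding fst_conv snd_conv j(3)[rule_format] \<xi>_def by (auto simp: indicator_def)
        thus ?thesis by simp
      qed
    qed (use elementary_process_measurable[OF data] in auto)
    also have "\<dots> \<le> emeasure lborel {0::real} + (emeasure lborel {s<..s + T / k} + emeasure lborel {t<..t + T / k})"
      by (intro order_trans[OF emeasure_subadditive] add_left_mono emeasure_subadditive) auto
    also have "\<dots> = ennreal (T / k + T / k)"
      using \<open>0 < T\<close> by (simp add: ennreal_plus[symmetric] del: ennreal_plus)
    also have "\<dots> < ennreal e" using small \<open>0 < e\<close> by (intro ennreal_lessI) auto
    finally show ?case using data by blast
  qed
qed

text \<open>A single time is a null set. This frees the value at time 0, where every elementary
  process vanishes.\<close>

lemma approximable_AE:
  assumes "approximable T f" and [measurable]: "g \<in> borel_measurable (process_measure T)"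
    and "\<And>t x. t \<in> {0<..T} \<Longrightarrow> x \<in> space M \<Longrightarrow> f (t, x) = g (t, x)"
  shows "approximable T g"
proof (rule approximable_closed)
  have [measurable]: "f \<in> borel_measurable (process_measure T)"
    using assms(1) by (simp add: approximable_def)
  have "(\<integral>\<^sup>+z. ennreal ((g z - f z)\<^sup>2) \<partial>process_measure T) = 
      (\<integral>\<^sup>+t\<in>{0..T}. (\<integral>\<^sup>+x. ennreal ((g (t, x) - f (t, x))\<^sup>2) \<partial>M) \<partial>lborel)"
    by (rule nn_integral_process_measure) measurable
  also have "\<dots> = (\<integral>\<^sup>+t. 0 \<partial>(lborel :: real measure))"
  proof (rule nn_integral_cong_AE, use AE_lborel_singleton[of 0] in eventually_elim)
    case (elim t)
    show ?case
    proof (cases "t \<in> {0..T}")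
      case True
      hence "(\<integral>\<^sup>+x. ennreal ((g (t, x) - f (t, x))\<^sup>2) \<partial>M) = (\<integral>\<^sup>+x. 0 \<partial>M)"
        using elim by (intro nn_integral_cong) (simp add: assms(3))
      thus ?thesis by simp
    qed simp
  qed
  finally show "(\<lambda>n. \<integral>\<^sup>+z. ennreal ((g z - f z)\<^sup>2) \<partial>process_measure T) \<longlonglongrightarrow> 0" by simp
qed (use assms in auto)

lemma approximable_predictable:
  assumes "0 < T" and f: "f \<in> borel_measurable (predictable_sigma M F)"
    and fin: "(\<integral>\<^sup>+z. ennreal ((f z)\<^sup>2) \<partial>process_measure T) < \<infinity>"
  shows "approximable T f"
proof (rule L2_density[where Q="approximable T" and N="process_measure T", OF finite_process_measure[of T] subalgebra_predictable[unfolded predictable_sigma_def]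
    predictable_generator(2,1) _ _ approximable_lincomb approximable_closed f[unfolded predictable_sigma_def] fin])
  \<comment> \<open>Time 0 and the times beyond T have no mass, so the rectangle over (0, T]
    represents the constant 1.\<close>
  have full: "approximable T (indicator ({0<..T} \<times> space M))"
    using assms(1) sets.top[of "F 0"] by (intro approximable_indicator_Ioc) (simp_all add: space_F)
  show "approximable T (indicator ({0..} \<times> space M))"
  proof (rule approximable_AE[OF full])
    have "{0..} \<times> space M = space (process_measure T)" by (simp add: space_pair_measure)
    thus "indicat_real ({0..} \<times> space M) \<in> borel_measurable (process_measure T)"
      by (simp only: borel_measurable_indicator sets.top)
  qed auto
  have zero: "approximable T (\<lambda>_. 0)" using approximable_lincomb[OF full full, of 0 0] by simp
  fix A assume "A \<in> {{0} \<times> A | A. A \<in> sets (F 0)} \<union>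
      {{s<..t} \<times> A | s t A. 0 \<le> s \<and> s \<le> t \<and> A \<in> sets (F s)}"
  then consider B where "A = {0} \<times> B" "B \<in> sets (F 0)" |
    s t B where "A = {s<..t} \<times> B" "0 \<le> s" "s \<le> t" "B \<in> sets (F s)" by blast
  thus "approximable T (indicator A)"
  proof cases
    case 1
    show ?thesis
    proof (rule approximable_AE[OF zero])
      have "A \<in> sets (process_measure T)" unfolding 1(1)
        by (intro pair_measureI) (auto simp: sets_time_measure sets_restrict_space_iff sets_F[OF _ 1(2)])
      thus "indicat_real A \<in> borel_measurable (process_measure T)" by simp
    qed (simp add: 1(1))
  next
    case 2
    thus ?thesis using approximable_indicator_Ioc[OF assms(1)] by simp
  qed
qed

section \<open>Existence and isometry of the integral\<close>

lemma elementary_isometry_process_measure: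
  assumes "elementary_data M F n \<tau> \<xi>" "0 \<le> T"
  shows "(\<integral>\<^sup>+x. ennreal ((elementary_integral W n \<tau> \<xi> T x)\<^sup>2) \<partial>M) =
    (\<integral>\<^sup>+z. ennreal ((elementary_process n \<tau> \<xi> (fst z) (snd z))\<^sup>2) \<partial>process_measure T)"
proof -
  note [measurable] = elementary_process_measurable[OF assms(1)]
  show ?thesis unfolding elementary_isometry[OF assms]
    by (subst nn_integral_process_measure) simp_all
qed

lemma has_ito_integral_exists:
  assumes "0 < T" and f: "(\<lambda>(t, x). H t x) \<in> borel_measurable (predictable_sigma M F)"
    and fin: "(\<integral>\<^sup>+t\<in>{0..T}. (\<integral>\<^sup>+x. ennreal ((H t x)\<^sup>2) \<partial>M) \<partial>lborel) < \<infinity>"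
  shows "\<exists>I. has_ito_integral M F W H T I"
proof -
  let ?f = "\<lambda>(t, x). H t x"
  let ?E = "\<lambda>n \<tau> \<xi> z. elementary_process n \<tau> \<xi> (fst z) (snd z)"
  let ?d = "\<lambda>u v. \<integral>\<^sup>+z. ennreal ((u z - v z)\<^sup>2) \<partial>process_measure T"
  have fm [measurable]: "?f \<in> borel_measurable (process_measure T)"
    by (rule measurable_from_subalg[OF subalgebra_predictable f])
  have "(\<integral>\<^sup>+z. ennreal ((?f z)\<^sup>2) \<partial>process_measure T) < \<infinity>"
    using fin by (subst nn_integral_process_measure) simp_all
  from approximable_predictable[OF assms(1) f this] have app: "approximable T ?f" .
  \<comment> \<open>The precision (1/4)^m is the rate that \<open>L2_complete\<close> asks
    for.\<close>
  define P where "P m k \<xi> \<longleftrightarrow> elementary_data M F k (grid T k) \<xi> \<and>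
      ?d ?f (?E k (grid T k) \<xi>) < ennreal ((1/4) ^ m)" for m k :: nat and \<xi>
  have "\<exists>k \<xi>. P m k \<xi>" for m
  proof -
    have "\<forall>\<^sub>F k in sequentially. \<exists>\<xi>. P m k \<xi>"
      using app unfolding approximable_def P_def by simp
    thus ?thesis unfolding eventually_sequentially by blast
  qed
  then obtain n \<xi> where "\<And>m. P m (n m) (\<xi> m)" by metis
  hence data: "elementary_data M F (n m) (grid T (n m)) (\<xi> m)"
    and close: "?d ?f (?E (n m) (grid T (n m)) (\<xi> m)) < ennreal ((1/4) ^ m)" for m
    unfolding P_def by simp_all
  define E where "E m = ?E (n m) (grid T (n m)) (\<xi> m)" for m
  define X where "X m = elementary_integral W (n m) (grid T (n m)) (\<xi> m) T" for m
  have [measurable]: "E m \<in> borel_measurable (process_measure T)" for m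
    unfolding E_def by (rule elementary_process_measurable[OF data])
  have iso: "(\<integral>\<^sup>+x. ennreal ((X l x - X k x)\<^sup>2) \<partial>M) = ?d (E l) (E k)" for k l
    unfolding X_def elementary_isometry_diff[OF data data less_imp_le[OF assms(1)]]
    by (subst nn_integral_process_measure, measurable) (simp add: E_def)
  have "\<exists>Y\<in>borel_measurable (F T). (\<lambda>k. \<integral>\<^sup>+x. ennreal ((Y x - X k x)\<^sup>2) \<partial>M) \<longlonglongrightarrow> 0"
  \<comment> \<open>C = 4 is 2 + 2 from \<open>L2_triangle\<close> through H, both distances being
    at most (1/4)^k when k \<le> l.\<close>
  proof (rule L2_complete[where C=4])
    show "X k \<in> borel_measurable (F T)" for k
      unfolding X_def using assms(1) by (intro elementary_integral_measurable data) simp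
    show "subalgebra M (F T)" using assms(1) by (intro subalgebra_F) simp
    fix k l :: nat assume "k \<le> l"
    hence lk: "(1/4 :: real) ^ l \<le> (1/4) ^ k" by (intro power_decreasing) auto
    have "?d (E l) (E k) \<le> 2 * ?d (E l) ?f + 2 * ?d ?f (E k)" by (rule L2_triangle) measurable
    also have "?d (E l) ?f = ?d ?f (E l)" by (simp add: power2_commute)
    also have "2 * ?d ?f (E l) + 2 * ?d ?f (E k) \<le> 2 * ennreal ((1/4) ^ k) + 2 * ennreal ((1/4) ^ k)"
      using close[of l] close[of k] ennreal_leI[OF lk] unfolding E_def
      by (intro add_mono mult_left_mono) (auto intro: less_imp_le order_trans)
    also have "\<dots> = ennreal (4 * (1/4) ^ k)"
      by (simp add: ennreal_mult[symmetric] ennreal_plus[symmetric] del: ennreal_plus flip: ennreal_numeral)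
    finally show "(\<integral>\<^sup>+x. ennreal ((X l x - X k x)\<^sup>2) \<partial>M) \<le> ennreal (4 * (1/4) ^ k)" unfolding iso .
  qed (unfold_locales, simp)
  then obtain Y where Y: "Y \<in> borel_measurable (F T)"
      "(\<lambda>k. \<integral>\<^sup>+x. ennreal ((Y x - X k x)\<^sup>2) \<partial>M) \<longlonglongrightarrow> 0" by blast
  have "(\<lambda>m. (1/4 :: real) ^ m) \<longlonglongrightarrow> 0" by (rule LIMSEQ_power_zero) simp
  hence lim: "(\<lambda>m. ennreal ((1/4) ^ m)) \<longlonglongrightarrow> 0" using tendsto_ennrealI by fastforce
  have "(\<lambda>k. ?d ?f (E k)) \<longlonglongrightarrow> 0"
    by (rule tendsto_sandwich[OF _ _ tendsto_const lim])
       (simp, intro always_eventually allI less_imp_le, unfold E_def, rule close)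
  moreover have "?d ?f (E k) = (\<integral>\<^sup>+t\<in>{0..T}. (\<integral>\<^sup>+x. ennreal ((H t x -
      elementary_process (n k) (grid T (n k)) (\<xi> k) t x)\<^sup>2) \<partial>M) \<partial>lborel)" for k
    by (subst nn_integral_process_measure, measurable) (simp add: E_def)
  ultimately have "has_ito_integral M F W H T Y"
    unfolding has_ito_integral_def using Y data unfolding X_def
    by (intro conjI exI[of _ n] exI[of _ "\<lambda>k. grid T (n k)"] exI[of _ \<xi>]) simp_all
  thus ?thesis by (intro exI[of _ Y])
qed

text \<open>Both norms are limits of norms along one approximating sequence, which agree termwise by
  the elementary isometry. Every version I is covered, hence also the one that \<open>SOME\<close>
  picks.\<close>

lemma ito_isometry:
  assumes "0 \<le> T" and fm [measurable]: "(\<lambda>(t, x). H t x) \<in> borel_measurable (process_measure T)"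
    and fin: "(\<integral>\<^sup>+t\<in>{0..T}. (\<integral>\<^sup>+x. ennreal ((H t x)\<^sup>2) \<partial>M) \<partial>lborel) < \<infinity>"
    and I: "has_ito_integral M F W H T I"
  shows "(\<integral>\<^sup>+x. ennreal ((I x)\<^sup>2) \<partial>M) =
    (\<integral>\<^sup>+t\<in>{0..T}. (\<integral>\<^sup>+x. ennreal ((H t x)\<^sup>2) \<partial>M) \<partial>lborel)"
proof -
  let ?f = "\<lambda>(t, x). H t x"
  obtain n \<tau> \<xi> where data: "\<And>k. elementary_data M F (n k) (\<tau> k) (\<xi> k)"
    and lim: "(\<lambda>k. \<integral>\<^sup>+t\<in>{0..T}. (\<integral>\<^sup>+x. ennreal ((H t x -
        elementary_process (n k) (\<tau> k) (\<xi> k) t x)\<^sup>2) \<partial>M) \<partial>lborel) \<longlonglongrightarrow> 0"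
      "(\<lambda>k. \<integral>\<^sup>+x. ennreal ((I x - elementary_integral W (n k) (\<tau> k) (\<xi> k) T x)\<^sup>2) \<partial>M) \<longlonglongrightarrow> 0"
    and IF: "I \<in> borel_measurable (F T)"
    using I unfolding has_ito_integral_def by blast
  define E where "E k z = elementary_process (n k) (\<tau> k) (\<xi> k) (fst z) (snd z)" for k z
  define X where "X k = elementary_integral W (n k) (\<tau> k) (\<xi> k) T" for k
  have Em [measurable]: "E k \<in> borel_measurable (process_measure T)" for k
    unfolding E_def[abs_def] by (rule elementary_process_measurable[OF data])
  have [measurable]: "I \<in> borel_measurable M" by (rule measurable_F[OF assms(1) IF])
  have [measurable]: "X k \<in> borel_measurable M" for k
    unfolding X_def by (rule measurable_F[OF assms(1) elementary_integral_measurable[OF data assms(1)]])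
  have iso: "(\<integral>\<^sup>+x. ennreal ((X k x)\<^sup>2) \<partial>M) = (\<integral>\<^sup>+z. ennreal ((E k z)\<^sup>2) \<partial>process_measure T)" for k
    unfolding X_def E_def by (rule elementary_isometry_process_measure[OF data assms(1)])
  have H: "(\<integral>\<^sup>+z. ennreal ((?f z)\<^sup>2) \<partial>process_measure T) =
      (\<integral>\<^sup>+t\<in>{0..T}. (\<integral>\<^sup>+x. ennreal ((H t x)\<^sup>2) \<partial>M) \<partial>lborel)"
    by (subst nn_integral_process_measure) simp_all
  have "(\<integral>\<^sup>+z. ennreal ((?f z - E k z)\<^sup>2) \<partial>process_measure T) =
      (\<integral>\<^sup>+t\<in>{0..T}. (\<integral>\<^sup>+x. ennreal ((H t x -
        elementary_process (n k) (\<tau> k) (\<xi> k) t x)\<^sup>2) \<partial>M) \<partial>lborel)" for k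
    by (subst nn_integral_process_measure, measurable) (simp add: E_def)
  with lim(1) have "(\<lambda>k. \<integral>\<^sup>+z. ennreal ((?f z - E k z)\<^sup>2) \<partial>process_measure T) \<longlonglongrightarrow> 0"
    by (simp only:)
  from L2_tendsto_norm[OF fm Em _ this] fin
  have limE: "(\<lambda>k. \<integral>\<^sup>+z. ennreal ((E k z)\<^sup>2) \<partial>process_measure T) \<longlonglongrightarrow>
      (\<integral>\<^sup>+z. ennreal ((?f z)\<^sup>2) \<partial>process_measure T)" by (simp only: H)
  have "(\<integral>\<^sup>+x. ennreal ((I x)\<^sup>2) \<partial>M) < \<infinity>"
  \<comment> \<open>\<open>L2_tendsto_norm\<close> wants a finite norm of I, which
    \<open>has_ito_integral\<close> does not state. One index at which the elementary process has
    finite norm and its integral has finite distance to I is enough.\<close>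
  proof -
    have "\<forall>\<^sub>F k in sequentially. (\<integral>\<^sup>+z. ennreal ((E k z)\<^sup>2) \<partial>process_measure T) < \<infinity>"
      using fin unfolding H[symmetric] by (rule order_tendstoD(2)[OF limE])
    moreover have "\<forall>\<^sub>F k in sequentially. (\<integral>\<^sup>+x. ennreal ((I x - X k x)\<^sup>2) \<partial>M) < \<infinity>"
      unfolding X_def by (rule order_tendstoD(2)[OF lim(2)]) simp
    ultimately have "\<forall>\<^sub>F k in sequentially. (\<integral>\<^sup>+z. ennreal ((E k z)\<^sup>2) \<partial>process_measure T) < \<infinity> \<and>
        (\<integral>\<^sup>+x. ennreal ((I x - X k x)\<^sup>2) \<partial>M) < \<infinity>" by (rule eventually_conj)
    then obtain k where k: "(\<integral>\<^sup>+z. ennreal ((E k z)\<^sup>2) \<partial>process_measure T) < \<infinity>"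
        "(\<integral>\<^sup>+x. ennreal ((I x - X k x)\<^sup>2) \<partial>M) < \<infinity>"
      using eventually_happens'[OF sequentially_bot] by blast
    have "(\<integral>\<^sup>+x. ennreal ((I x - 0)\<^sup>2) \<partial>M) \<le>
        2 * (\<integral>\<^sup>+x. ennreal ((I x - X k x)\<^sup>2) \<partial>M) + 2 * (\<integral>\<^sup>+x. ennreal ((X k x - 0)\<^sup>2) \<partial>M)"
      by (rule L2_triangle) measurable
    also have "\<dots> < \<infinity>" using k iso[of k] by (simp add: ennreal_mult_less_top)
    finally show ?thesis by simp
  qed
  from L2_tendsto_norm[OF _ _ this lim(2)[folded X_def]]
  have "(\<lambda>k. \<integral>\<^sup>+x. ennreal ((X k x)\<^sup>2) \<partial>M) \<longlonglongrightarrow> (\<integral>\<^sup>+x. ennreal ((I x)\<^sup>2) \<partial>M)" by simp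
  from LIMSEQ_unique[OF this limE[folded iso]] show ?thesis unfolding H .
qed

end

section \<open>Fourier transform of the drift\<close>

text \<open>Averaging over integer frequencies replaces the Riemann--Lebesgue lemma: the averaged kernel is
  bounded by 1 and tends to 0 off the null set \<open>2\<pi>\<int>\<close>.\<close>

definition mean_cos :: "nat \<Rightarrow> nat \<Rightarrow> real \<Rightarrow> real" where
  "mean_cos N n \<tau> = (\<Sum>j<n. cos (real (N + j) * \<tau>)) / real n"

lemma mean_cos_measurable [measurable]: "mean_cos N n \<in> borel_measurable borel"
  unfolding mean_cos_def by measurable

lemma mean_cos_le_1: "\<bar>mean_cos N n \<tau>\<bar> \<le> 1"
proof (cases "n = 0")
  case False
  have "\<bar>\<Sum>j<n. cos (real (N + j) * \<tau>)\<bar> \<le> (\<Sum>j<n. 1)"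
    by (rule order_trans[OF sum_abs]) (intro sum_mono, simp)
  thus ?thesis using False by (simp add: mean_cos_def field_simps)
qed (simp add: mean_cos_def)

text \<open>The sum is the real part of z^N times a geometric sum in z = cis \<tau>, bounded by 2 /
  |z - 1| whatever n is.\<close>

lemma mean_cos_tendsto_0:
  assumes "cis \<tau> \<noteq> 1"
  shows "(\<lambda>n. mean_cos N n \<tau>) \<longlonglongrightarrow> 0"
proof (rule Lim_null_comparison)
  let ?z = "cis \<tau>"
  show "\<forall>\<^sub>F n in sequentially. norm (mean_cos N n \<tau>) \<le> 2 / cmod (?z - 1) * (1 / real n)"
  proof (intro always_eventually allI)
    fix n
    have "cos (real (N + j) * \<tau>) = Re (?z ^ N * ?z ^ j)" for j
      unfolding Complex.DeMoivre cis_mult cis.sel by (simp add: distrib_right)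
    hence "(\<Sum>j<n. cos (real (N + j) * \<tau>)) = Re (?z ^ N * (\<Sum>j<n. ?z ^ j))"
      by (simp add: sum_distrib_left)
    also have "\<bar>\<dots>\<bar> \<le> cmod (?z ^ N * (\<Sum>j<n. ?z ^ j))" by (rule abs_Re_le_cmod)
    also have "\<dots> = cmod (?z ^ n - 1) / cmod (?z - 1)"
      using assms by (simp add: geometric_sum norm_mult norm_divide norm_power)
    also have "\<dots> \<le> 2 / cmod (?z - 1)"
      using norm_triangle_ineq4[of "?z ^ n" 1] by (intro divide_right_mono) (simp_all add: norm_power)
    finally have "\<bar>\<Sum>j<n. cos (real (N + j) * \<tau>)\<bar> / real n \<le> 2 / cmod (?z - 1) / real n"
      by (rule divide_right_mono) simp
    thus "norm (mean_cos N n \<tau>) \<le> 2 / cmod (?z - 1) * (1 / real n)"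
      by (simp add: mean_cos_def)
  qed
  have "(\<lambda>n. 2 / cmod (?z - 1) * (1 / real n)) \<longlonglongrightarrow> 2 / cmod (?z - 1) * 0"
    by (intro tendsto_intros lim_1_over_n)
  thus "(\<lambda>n. 2 / cmod (?z - 1) * (1 / real n)) \<longlonglongrightarrow> 0" by simp
qed

lemma countable_cis_eq_1: "countable {\<tau>. cis (s - \<tau>) = 1}"
proof (rule countable_subset)
  show "{\<tau>. cis (s - \<tau>) = 1} \<subseteq> range (\<lambda>m::int. s - real_of_int m * 2 * pi)"
  proof
    fix \<tau> assume "\<tau> \<in> {\<tau>. cis (s - \<tau>) = 1}"
    hence "cos (s - \<tau>) = 1" by (simp add: complex_eq_iff)
    then obtain m :: int where "s - \<tau> = real_of_int m * 2 * pi"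
      by (auto simp: cos_one_2pi_int)
    hence "\<tau> = s - real_of_int m * 2 * pi" by simp
    thus "\<tau> \<in> range (\<lambda>m::int. s - real_of_int m * 2 * pi)" by blast
  qed
qed auto

lemma AE_cis_neq_1: "AE \<tau> in lborel. cis (s - \<tau>) \<noteq> 1"
  using AE_not_in[OF countable_imp_null_set_lborel[OF countable_cis_eq_1[of s]]] by simp

text \<open>The phase \<phi> is the time difference on the square of [0, T] for the finite horizon
  and the identity on the line for the infinite one.\<close>

lemma integral_mean_cos_tendsto_0:
  fixes g \<phi> :: "'z \<Rightarrow> real"
  assumes g [measurable]: "integrable L g" and [measurable]: "\<phi> \<in> borel_measurable L"
    and ae: "AE z in L. cis (\<phi> z) \<noteq> 1"
  shows "(\<lambda>n. \<integral>z. \<bar>mean_cos N n (\<phi> z)\<bar> * \<bar>g z\<bar> \<partial>L) \<longlonglongrightarrow> 0"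
proof -
  have "(\<lambda>n. \<integral>z. \<bar>mean_cos N n (\<phi> z)\<bar> * \<bar>g z\<bar> \<partial>L) \<longlonglongrightarrow> (\<integral>z. 0 \<partial>L)"
  proof (rule integral_dominated_convergence[where w="\<lambda>z. \<bar>g z\<bar>"])
    show "AE z in L. (\<lambda>n. \<bar>mean_cos N n (\<phi> z)\<bar> * \<bar>g z\<bar>) \<longlonglongrightarrow> 0"
      using ae
    proof eventually_elim
      case (elim z)
      from tendsto_mult[OF tendsto_rabs[OF mean_cos_tendsto_0[OF elim]] tendsto_const]
      show ?case by simp
    qed
    show "AE z in L. norm (\<bar>mean_cos N n (\<phi> z)\<bar> * \<bar>g z\<bar>) \<le> \<bar>g z\<bar>" for n
      using mult_right_mono[OF mean_cos_le_1, of "\<bar>g _\<bar>"] by (intro AE_I2) (simp add: abs_mult)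
  qed (use g in auto)
  thus ?thesis by simp
qed

section \<open>Expected energy of the drift as a double integral of its covariance\<close>

lemma integral_mult_pair:
  fixes u v :: "'z \<Rightarrow> real"
  assumes "sigma_finite_measure L" and u: "integrable L u" and v: "integrable L v"
  shows "integrable (L \<Otimes>\<^sub>M L) (\<lambda>z. u (fst z) * v (snd z))"
    and "(\<integral>z. u (fst z) * v (snd z) \<partial>(L \<Otimes>\<^sub>M L)) = (\<integral>s. u s \<partial>L) * (\<integral>t. v t \<partial>L)"
proof -
  interpret sigma_finite_measure L by fact
  interpret pair_sigma_finite L L ..
  note [measurable] = borel_measurable_integrable[OF u] borel_measurable_integrable[OF v]
  show i: "integrable (L \<Otimes>\<^sub>M L) (\<lambda>z. u (fst z) * v (snd z))"
    by (rule Fubini_integrable) (use u v in \<open>simp_all add: abs_mult\<close>)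
  from integral_fst'[OF i] show "(\<integral>z. u (fst z) * v (snd z) \<partial>(L \<Otimes>\<^sub>M L)) = (\<integral>s. u s \<partial>L) * (\<integral>t. v t \<partial>L)"
    by simp
qed

text \<open>The squared modulus of the Fourier integral of f at frequency \<omega>, in real
  terms.\<close>

definition fourier_energy :: "real measure \<Rightarrow> (real \<Rightarrow> real) \<Rightarrow> real \<Rightarrow> real" where
  "fourier_energy L f \<omega> = (\<integral>t. cos (\<omega> * t) * f t \<partial>L)\<^sup>2 + (\<integral>t. sin (\<omega> * t) * f t \<partial>L)\<^sup>2"

text \<open>Squares of integrals become double integrals, and the addition theorem merges the two
  products into one cosine of the time difference.\<close>

lemma fourier_energy_eq:
  assumes "sigma_finite_measure L" and f: "integrable L f" and id [measurable]: "(\<lambda>t. t) \<in> borel_measurable L"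
  shows "fourier_energy L f \<omega> = (\<integral>z. cos (\<omega> * (fst z - snd z)) * (f (fst z) * f (snd z)) \<partial>(L \<Otimes>\<^sub>M L))"
proof -
  note [measurable] = borel_measurable_integrable[OF f]
  have c: "integrable L (\<lambda>t. cos (\<omega> * t) * f t)" "integrable L (\<lambda>t. sin (\<omega> * t) * f t)"
    by (rule Bochner_Integration.integrable_bound[OF f], measurable,
        auto simp: abs_mult intro!: mult_left_le_one_le)+
  note i = integral_mult_pair[OF assms(1) c(1) c(1)] integral_mult_pair[OF assms(1) c(2) c(2)]
  have "fourier_energy L f \<omega> = (\<integral>z. (cos (\<omega> * fst z) * f (fst z)) * (cos (\<omega> * snd z) * f (snd z)) +
      (sin (\<omega> * fst z) * f (fst z)) * (sin (\<omega> * snd z) * f (snd z)) \<partial>(L \<Otimes>\<^sub>M L))"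
    using i by (simp add: fourier_energy_def power2_eq_square)
  also have "\<dots> = (\<integral>z. cos (\<omega> * (fst z - snd z)) * (f (fst z) * f (snd z)) \<partial>(L \<Otimes>\<^sub>M L))"
    by (rule Bochner_Integration.integral_cong[OF refl]) (simp add: right_diff_distrib cos_diff algebra_simps)
  finally show ?thesis .
qed

text \<open>Fubini for M against the square of L, with majorant a_s^2 + a_t^2. It is integrable
  because L is finite and each summand is constant in one of the two times.\<close>

lemma integral_fourier_energy:
  fixes a :: "real \<Rightarrow> 'a \<Rightarrow> real"
  assumes "finite_measure L" "prob_space M" and id [measurable]: "(\<lambda>t. t) \<in> borel_measurable L"
    and am [measurable]: "(\<lambda>(t, x). a t x) \<in> borel_measurable (L \<Otimes>\<^sub>M M)"
    and fin: "(\<integral>\<^sup>+z. ennreal ((a (fst z) (snd z))\<^sup>2) \<partial>(L \<Otimes>\<^sub>M M)) < \<infinity>"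
    and ia: "\<And>x. x \<in> space M \<Longrightarrow> integrable L (\<lambda>t. a t x)"
  defines "C \<equiv> \<lambda>s t. \<integral>x. a s x * a t x \<partial>M"
  shows "integrable (L \<Otimes>\<^sub>M L) (\<lambda>z. C (fst z) (snd z))" (is ?int)
    and "integrable M (\<lambda>x. fourier_energy L (\<lambda>t. a t x) \<omega>)" (is "?intE \<omega>")
    and "(\<integral>x. fourier_energy L (\<lambda>t. a t x) \<omega> \<partial>M) =
      (\<integral>z. cos (\<omega> * (fst z - snd z)) * C (fst z) (snd z) \<partial>(L \<Otimes>\<^sub>M L))" (is "?eq \<omega>")
proof -
  interpret L: finite_measure L by fact
  interpret M: prob_space M by fact
  interpret LL: pair_sigma_finite L L ..
  interpret LM: pair_sigma_finite L M ..
  interpret K: pair_sigma_finite "L \<Otimes>\<^sub>M L" M ..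
  let ?K = "L \<Otimes>\<^sub>M L"
  have a1: "(\<lambda>(z, x). a (fst z) x) \<in> borel_measurable (?K \<Otimes>\<^sub>M M)"
    using measurable_compose[OF _ am, of "\<lambda>p. (fst (fst p), snd p)" "?K \<Otimes>\<^sub>M M"] by (simp add: case_prod_beta')
  have a2: "(\<lambda>(z, x). a (snd z) x) \<in> borel_measurable (?K \<Otimes>\<^sub>M M)"
    using measurable_compose[OF _ am, of "\<lambda>p. (snd (fst p), snd p)" "?K \<Otimes>\<^sub>M M"] by (simp add: case_prod_beta')
  note [measurable] = a1[unfolded case_prod_beta'] a2[unfolded case_prod_beta']
  let ?h = "\<lambda>t. \<integral>\<^sup>+x. ennreal ((a t x)\<^sup>2) \<partial>M"
  have am': "(\<lambda>z. ennreal ((a (fst z) (snd z))\<^sup>2)) \<in> borel_measurable (L \<Otimes>\<^sub>M M)"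
    using am by (simp add: case_prod_beta')
  from M.borel_measurable_nn_integral_fst[OF am'] have hm [measurable]: "?h \<in> borel_measurable L" by simp
  have hfin: "(\<integral>\<^sup>+t. ?h t \<partial>L) < \<infinity>"
    using fin M.nn_integral_fst[OF am'] by simp
  have Lfin: "emeasure L (space L) < \<top>"
    using L.emeasure_finite[of "space L"] by (simp add: less_top[symmetric])
  have K1: "(\<integral>\<^sup>+p. ennreal ((a (fst (fst p)) (snd p))\<^sup>2) \<partial>(?K \<Otimes>\<^sub>M M)) < \<infinity>"
  proof -
    have "(\<integral>\<^sup>+p. ennreal ((a (fst (fst p)) (snd p))\<^sup>2) \<partial>(?K \<Otimes>\<^sub>M M)) = (\<integral>\<^sup>+z. ?h (fst z) \<partial>?K)"
      by (subst M.nn_integral_fst[symmetric]) simp_all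
    also have "\<dots> = (\<integral>\<^sup>+s. \<integral>\<^sup>+t. ?h s \<partial>L \<partial>L)"
      by (subst L.nn_integral_fst[symmetric]) simp_all
    also have "\<dots> = (\<integral>\<^sup>+s. ?h s \<partial>L) * emeasure L (space L)"
      by (simp add: nn_integral_multc)
    finally show ?thesis using hfin Lfin by (simp add: ennreal_mult_less_top)
  qed
  have K2: "(\<integral>\<^sup>+p. ennreal ((a (snd (fst p)) (snd p))\<^sup>2) \<partial>(?K \<Otimes>\<^sub>M M)) < \<infinity>"
  proof -
    have "(\<integral>\<^sup>+p. ennreal ((a (snd (fst p)) (snd p))\<^sup>2) \<partial>(?K \<Otimes>\<^sub>M M)) = (\<integral>\<^sup>+z. ?h (snd z) \<partial>?K)"
      by (subst M.nn_integral_fst[symmetric]) simp_all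
    also have "\<dots> = (\<integral>\<^sup>+s. \<integral>\<^sup>+t. ?h t \<partial>L \<partial>L)"
      by (subst L.nn_integral_fst[symmetric]) simp_all
    also have "\<dots> = (\<integral>\<^sup>+s. ?h s \<partial>L) * emeasure L (space L)"
      by (simp add: mult.commute)
    finally show ?thesis using hfin Lfin by (simp add: ennreal_mult_less_top)
  qed
  have int0: "integrable (?K \<Otimes>\<^sub>M M) (\<lambda>p. (a (fst (fst p)) (snd p))\<^sup>2 + (a (snd (fst p)) (snd p))\<^sup>2)"
    using K1 K2 by (intro Bochner_Integration.integrable_add integrableI_bounded) simp_all
  \<comment> \<open>The bounded factor c will be the constant 1 for the covariance and a cosine for
    the energy.\<close>
  have int: "integrable (?K \<Otimes>\<^sub>M M) (\<lambda>(z, x). c z * (a (fst z) x * a (snd z) x))"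
    if [measurable]: "c \<in> borel_measurable ?K" and c: "\<And>z. \<bar>c z\<bar> \<le> 1" for c
  proof (rule Bochner_Integration.integrable_bound[OF int0])
    show "(\<lambda>(z, x). c z * (a (fst z) x * a (snd z) x)) \<in> borel_measurable (?K \<Otimes>\<^sub>M M)"
      unfolding case_prod_beta' by measurable
    have "\<bar>c z * (u * v)\<bar> \<le> u\<^sup>2 + v\<^sup>2" for z and u v :: real
    proof -
      have "\<bar>c z * (u * v)\<bar> \<le> \<bar>u * v\<bar>"
        using mult_right_mono[OF c[of z], of "\<bar>u * v\<bar>"] by (simp add: abs_mult)
      also have "\<dots> \<le> u\<^sup>2 + v\<^sup>2"
        using zero_le_power2[of "\<bar>u\<bar> - \<bar>v\<bar>"] mult_nonneg_nonneg[of "\<bar>u\<bar>" "\<bar>v\<bar>"]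
        unfolding power2_diff abs_mult power2_abs by linarith
      finally show ?thesis .
    qed
    thus "AE p in ?K \<Otimes>\<^sub>M M. norm (case p of (z, x) \<Rightarrow> c z * (a (fst z) x * a (snd z) x)) \<le>
        norm ((a (fst (fst p)) (snd p))\<^sup>2 + (a (snd (fst p)) (snd p))\<^sup>2)"
      by (intro AE_I2) (simp add: case_prod_beta')
  qed
  from K.integrable_fst'[OF int[of "\<lambda>_. 1"]] show ?int by (simp add: C_def)
  have E: "fourier_energy L (\<lambda>t. a t x) \<omega> =
      (\<integral>z. cos (\<omega> * (fst z - snd z)) * (a (fst z) x * a (snd z) x) \<partial>?K)" if "x \<in> space M" for x \<omega>
    by (rule fourier_energy_eq[OF L.sigma_finite_measure_axioms ia[OF that] id])
  have cm: "(\<lambda>z. cos (\<omega> * (fst z - snd z))) \<in> borel_measurable ?K" for \<omega> by measurable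
  have ic: "integrable (?K \<Otimes>\<^sub>M M) (\<lambda>(z, x). cos (\<omega> * (fst z - snd z)) * (a (fst z) x * a (snd z) x))" for \<omega>
    by (rule int[OF cm]) simp
  show "?intE \<omega>"
    using K.integrable_snd[OF ic[of \<omega>]] by (subst Bochner_Integration.integrable_cong[OF refl E]) auto
  have "(\<integral>x. fourier_energy L (\<lambda>t. a t x) \<omega> \<partial>M) =
      (\<integral>x. (\<integral>z. cos (\<omega> * (fst z - snd z)) * (a (fst z) x * a (snd z) x) \<partial>?K) \<partial>M)"
    by (intro Bochner_Integration.integral_cong refl E)
  also have "\<dots> = (\<integral>z. (\<integral>x. cos (\<omega> * (fst z - snd z)) * (a (fst z) x * a (snd z) x) \<partial>M) \<partial>?K)"
    by (rule K.Fubini_integral[OF ic])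
  finally show "?eq \<omega>" by (simp add: C_def)
qed

text \<open>Averaging moves inside the integral by linearity; absolute values are taken only
  afterwards, so the cancellation in \<open>mean_cos\<close> survives.\<close>

lemma mean_fourier_energy_le:
  fixes a :: "real \<Rightarrow> 'a \<Rightarrow> real"
  assumes "finite_measure L" "prob_space M" and id [measurable]: "(\<lambda>t. t) \<in> borel_measurable L"
    and am [measurable]: "(\<lambda>(t, x). a t x) \<in> borel_measurable (L \<Otimes>\<^sub>M M)"
    and fin: "(\<integral>\<^sup>+z. ennreal ((a (fst z) (snd z))\<^sup>2) \<partial>(L \<Otimes>\<^sub>M M)) < \<infinity>"
    and ia: "\<And>x. x \<in> space M \<Longrightarrow> integrable L (\<lambda>t. a t x)"
  shows "(\<Sum>j<n. \<integral>x. fourier_energy L (\<lambda>t. a t x) (real (N + j)) \<partial>M) / real n \<le>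
    (\<integral>z. \<bar>mean_cos N n (fst z - snd z)\<bar> * \<bar>\<integral>x. a (fst z) x * a (snd z) x \<partial>M\<bar> \<partial>(L \<Otimes>\<^sub>M L))"
proof -
  note e = integral_fourier_energy[OF assms]
  define C where "C z = (\<integral>x. a (fst z) x * a (snd z) x \<partial>M)" for z
  have C [measurable]: "integrable (L \<Otimes>\<^sub>M L) C" unfolding C_def by (rule e(1))
  have ic: "integrable (L \<Otimes>\<^sub>M L) (\<lambda>z. c z * C z)"
    if [measurable]: "c \<in> borel_measurable (L \<Otimes>\<^sub>M L)" and c: "\<And>z. \<bar>c z\<bar> \<le> 1" for c
    by (rule Bochner_Integration.integrable_bound[OF C], measurable)
       (use mult_right_mono[OF c] in \<open>auto simp: abs_mult\<close>)
  have m: "(\<lambda>z. mean_cos N n (fst z - snd z)) \<in> borel_measurable (L \<Otimes>\<^sub>M L)"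
    by (rule measurable_compose[OF _ mean_cos_measurable]) measurable
  have "(\<Sum>j<n. \<integral>x. fourier_energy L (\<lambda>t. a t x) (real (N + j)) \<partial>M) / real n =
      (\<Sum>j<n. \<integral>z. cos (real (N + j) * (fst z - snd z)) * C z \<partial>(L \<Otimes>\<^sub>M L)) / real n"
    unfolding C_def by (simp only: e(3))
  also have "\<dots> = (\<integral>z. (\<Sum>j<n. cos (real (N + j) * (fst z - snd z)) * C z) \<partial>(L \<Otimes>\<^sub>M L)) / real n"
    by (subst Bochner_Integration.integral_sum) (auto intro!: ic)
  also have "\<dots> = (\<integral>z. mean_cos N n (fst z - snd z) * C z \<partial>(L \<Otimes>\<^sub>M L))"
  proof -
    have "mean_cos N n (fst z - snd z) * C z =
        (\<Sum>j<n. cos (real (N + j) * (fst z - snd z)) * C z) / real n" for z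
      by (simp add: mean_cos_def sum_distrib_right)
    thus ?thesis by (simp only: integral_divide_zero)
  qed
  also have "\<dots> \<le> (\<integral>z. \<bar>mean_cos N n (fst z - snd z)\<bar> * \<bar>C z\<bar> \<partial>(L \<Otimes>\<^sub>M L))"
  proof (rule integral_mono[OF ic[OF m mean_cos_le_1]])
    have "integrable (L \<Otimes>\<^sub>M L) (\<lambda>z. \<bar>mean_cos N n (fst z - snd z) * C z\<bar>)"
      by (intro integrable_abs ic[OF m mean_cos_le_1])
    thus "integrable (L \<Otimes>\<^sub>M L) (\<lambda>z. \<bar>mean_cos N n (fst z - snd z)\<bar> * \<bar>C z\<bar>)" by (simp only: abs_mult)
    show "mean_cos N n (fst z - snd z) * C z \<le> \<bar>mean_cos N n (fst z - snd z)\<bar> * \<bar>C z\<bar>" for z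
      by (simp only: abs_mult[symmetric] abs_ge_self)
  qed
  finally show ?thesis unfolding C_def .
qed

section \<open>Lower bounds for the power spectral density\<close>

lemma time_measure_real: "time_measure T = density (restrict_space lborel {0..}) (\<lambda>t. ennreal (indicat_real {0..T} t))"
  by (simp add: time_measure_def ennreal_indicator)

lemma
  fixes f :: "real \<Rightarrow> 'b::{banach, second_countable_topology}"
  assumes "f \<in> borel_measurable (time_measure T)"
  shows integral_time_measure: "(\<integral>t. f t \<partial>time_measure T) = (LINT t:{0..T}|lborel. f t)"
    and integrable_time_measure: "integrable (time_measure T) f \<longleftrightarrow> set_integrable lborel {0..T} f"
proof -
  have f: "f \<in> borel_measurable (restrict_space lborel {0..})"
    using assms by (simp add: time_measure_def)
  have i: "indicat_real {0..T} \<in> borel_measurable (restrict_space lborel {0..})"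
    by (rule measurable_restrict_space1) simp
  have eq: "indicat_real {0..} t * indicat_real {0..T} t = indicat_real {0..T} t" for t
    by (auto simp: indicator_def)
  show "(\<integral>t. f t \<partial>time_measure T) = (LINT t:{0..T}|lborel. f t)"
    unfolding time_measure_real set_lebesgue_integral_def
    by (subst integral_density[OF f i]) (simp_all add: integral_restrict_space eq)
  show "integrable (time_measure T) f \<longleftrightarrow> set_integrable lborel {0..T} f"
    unfolding time_measure_real set_integrable_def
    by (subst integrable_density[OF f i]) (simp_all add: integrable_restrict_space eq)
qed

lemma AE_time_measure:
  "(AE t in time_measure T. P t) \<longleftrightarrow> (AE t in lborel. t \<in> {0..T} \<longrightarrow> P t)"
proof -
  have i: "indicator {0..T} \<in> borel_measurable (restrict_space lborel {0..})"
    by (rule measurable_restrict_space1) simp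
  have "(AE t in time_measure T. P t) \<longleftrightarrow> (AE t in lborel. t \<in> {0..} \<longrightarrow> 0 < (indicator {0..T} t :: ennreal) \<longrightarrow> P t)"
    unfolding time_measure_def by (subst AE_density[OF i], subst AE_restrict_space_iff) simp_all
  also have "\<dots> \<longleftrightarrow> (AE t in lborel. t \<in> {0..T} \<longrightarrow> P t)"
    by (intro AE_cong) (auto simp: indicator_def)
  finally show ?thesis .
qed

lemma id_measurable_time_measure [measurable]: "(\<lambda>t. t) \<in> borel_measurable (time_measure T)"
  by (simp add: measurable_cong_sets[OF sets_time_measure refl] measurable_restrict_space1)

text \<open>For fixed s the exceptional t form a countable set, and a measurable set with null
  sections is null.\<close>

lemma AE_cis_neq_1_time_measure:
  "AE z in time_measure T \<Otimes>\<^sub>M time_measure T. cis (fst z - snd z) \<noteq> 1"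
proof -
  interpret finite_measure "time_measure T" by (rule finite_measure_time_measure)
  interpret pair_sigma_finite "time_measure T" "time_measure T" ..
  have "cis \<in> borel_measurable borel"
    by (intro borel_measurable_continuous_onI continuous_intros)
  hence m [measurable]: "(\<lambda>z. cis (fst z - snd z)) \<in> borel_measurable (time_measure T \<Otimes>\<^sub>M time_measure T)"
    by (rule measurable_compose[rotated]) measurable
  show ?thesis
  proof (rule AE_pair_measure)
    show "{z \<in> space (time_measure T \<Otimes>\<^sub>M time_measure T). cis (fst z - snd z) \<noteq> 1}
        \<in> sets (time_measure T \<Otimes>\<^sub>M time_measure T)" by measurable
    have "AE t in time_measure T. cis (s - t) \<noteq> 1" for s
      unfolding AE_time_measure using AE_cis_neq_1[of s] by eventually_elim simp
    thus "AE s in time_measure T. AE t in time_measure T. cis (fst (s, t) - snd (s, t)) \<noteq> 1" by simp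
  qed
qed

text \<open>For fixed s, reflection and translation bound the inner integral by the integral of g
  over the line, uniformly in s. Growth linear in T is exactly what the factor 1 / T of the spectral
  density cancels.\<close>

lemma integral_time_measure_convolution_le:
  fixes g :: "real \<Rightarrow> real"
  assumes g: "integrable lborel g" "\<And>t. 0 \<le> g t" and "0 \<le> T"
  shows "(\<integral>z. g (fst z - snd z) \<partial>(time_measure T \<Otimes>\<^sub>M time_measure T)) \<le> T * (\<integral>t. g t \<partial>lborel)"
proof -
  interpret finite_measure "time_measure T" by (rule finite_measure_time_measure)
  have gm [measurable]: "g \<in> borel_measurable borel" using g(1) by auto
  have m: "(\<lambda>z. g (fst z - snd z)) \<in> borel_measurable (time_measure T \<Otimes>\<^sub>M time_measure T)"
    by (rule measurable_compose[OF _ gm]) measurable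
  have inner: "(\<integral>\<^sup>+t. ennreal (g (s - t)) \<partial>time_measure T) \<le> ennreal (\<integral>t. g t \<partial>lborel)" for s
  proof -
    have "(\<lambda>t. ennreal (g (s - t))) \<in> borel_measurable (time_measure T)"
      by (rule measurable_compose[OF _ measurable_compose[OF gm measurable_ennreal]]) measurable
    hence "(\<integral>\<^sup>+t. ennreal (g (s - t)) \<partial>time_measure T) = (\<integral>\<^sup>+t\<in>{0..T}. ennreal (g (s - t)) \<partial>lborel)"
      by (rule nn_integral_time_measure)
    also have "\<dots> \<le> (\<integral>\<^sup>+t. ennreal (g (s - t)) \<partial>lborel)"
      by (rule nn_integral_mono) (simp add: indicator_def)
    also have "\<dots> = (\<integral>\<^sup>+t. ennreal (g t) \<partial>lborel)"
      using nn_integral_real_affine[of "\<lambda>t. ennreal (g t)" "-1" s] by simp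
    also have "\<dots> = ennreal (\<integral>t. g t \<partial>lborel)"
      using g by (intro nn_integral_eq_integral) auto
    finally show ?thesis .
  qed
  have "(\<integral>\<^sup>+z. ennreal (g (fst z - snd z)) \<partial>(time_measure T \<Otimes>\<^sub>M time_measure T)) =
      (\<integral>\<^sup>+s. \<integral>\<^sup>+t. ennreal (g (s - t)) \<partial>time_measure T \<partial>time_measure T)"
    using m by (subst nn_integral_fst[symmetric]) simp_all
  also have "\<dots> \<le> (\<integral>\<^sup>+s. ennreal (\<integral>t. g t \<partial>lborel) \<partial>time_measure T)"
    by (intro nn_integral_mono inner)
  also have "\<dots> = ennreal (T * (\<integral>t. g t \<partial>lborel))"
    using assms by (simp add: emeasure_time_measure ennreal_mult mult.commute)
  finally show ?thesis
    using m assms by (subst integral_eq_nn_integral) (auto intro!: enn2real_leI)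
qed

section \<open>Measurability and integrability of drift and diffusion integrands\<close>

context brownian_space
begin

text \<open>The time coordinate is itself predictable: for a \<ge> 0 the times beyond a are covered
  by countably many generators over (a, a + n]. Hence the trigonometric factors leave \<beta>
  predictable.\<close>

lemma predictable_mult_time:
  assumes "predictable M F \<beta>" and g: "g \<in> borel_measurable borel"
  shows "(\<lambda>(t, x). g t * \<beta> t x) \<in> borel_measurable (predictable_sigma M F)"
proof -
  let ?P = "predictable_sigma M F"
  have spP: "space ?P = {0..} \<times> space M"
    unfolding predictable_sigma_def using predictable_generator(1) by simp
  have Ioc: "{s<..t} \<times> space M \<in> sets ?P" if "0 \<le> s" "s \<le> t" for s t
  proof -
    have "space M \<in> sets (F s)" using sets.top[of "F s"] space_F[OF that(1)] by simp
    thus ?thesis unfolding predictable_sigma_def using predictable_generator(1) that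
      by (subst sets_measure_of, simp) (intro sigma_sets.Basic UnI2, blast)
  qed
  have "fst \<in> borel_measurable ?P"
    unfolding borel_measurable_iff_greater
  proof
    fix a :: real
    show "{z \<in> space ?P. a < fst z} \<in> sets ?P"
    proof (cases "a < 0")
      case True
      hence "{z \<in> space ?P. a < fst z} = space ?P" by (auto simp: spP)
      thus ?thesis by simp
    next
      case False
      have "{z \<in> space ?P. a < fst z} = (\<Union>n::nat. {a<..a + real n} \<times> space M)"
      proof (intro set_eqI iffI)
        fix z assume z: "z \<in> {z \<in> space ?P. a < fst z}"
        obtain n :: nat where "fst z - a \<le> real n" using real_arch_simple by blast
        hence "z \<in> {a<..a + real n} \<times> space M" using z by (cases z) (auto simp: spP)
        thus "z \<in> (\<Union>n::nat. {a<..a + real n} \<times> space M)" by blast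
      next
        fix z assume "z \<in> (\<Union>n::nat. {a<..a + real n} \<times> space M)"
        thus "z \<in> {z \<in> space ?P. a < fst z}" using False by (auto simp: spP)
      qed
      also have "\<dots> \<in> sets ?P" using False by (intro sets.countable_nat_UN image_subsetI Ioc) auto
      finally show ?thesis .
    qed
  qed
  from measurable_compose[OF this g] assms(1) show ?thesis
    unfolding predictable_def case_prod_beta' by (rule borel_measurable_times)
qed

text \<open>\<alpha> is the pointwise limit of processes sampled at the last multiple of 1 / (n + 1)
  not after t. Each of them depends on time through an integer only, so measurability at fixed times
  suffices.\<close>

lemma continuous_adapted_measurable:
  assumes "adapted F \<alpha>" "continuous_paths M \<alpha>"
  shows "(\<lambda>(t, x). \<alpha> t x) \<in> borel_measurable (process_measure T)"
proof (rule borel_measurable_LIMSEQ_real)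
  \<comment> \<open>The index ranges over all of \<open>int\<close>; the maximum sends negative
    indices to time 0, since adaptedness speaks only of times \<ge> 0.\<close>
  let ?s = "\<lambda>n i. max 0 (real_of_int i / real (Suc n))"
  let ?u = "\<lambda>n z. \<alpha> (?s n \<lfloor>real (Suc n) * fst z\<rfloor>) (snd z)"
  show "?u n \<in> borel_measurable (process_measure T)" for n
  proof (rule measurable_compose_countable[where f="\<lambda>i z. \<alpha> (?s n i) (snd z)"])
    fix i :: int
    have "\<alpha> (?s n i) \<in> borel_measurable M"
      using assms(1) by (intro measurable_F[of "?s n i"]) (auto simp: adapted_def)
    thus "(\<lambda>z. \<alpha> (?s n i) (snd z)) \<in> borel_measurable (process_measure T)"
      by (rule measurable_compose[OF measurable_snd])
  qed measurable
  fix z assume "z \<in> space (process_measure T)"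
  then obtain t x where z: "z = (t, x)" "0 \<le> t" "x \<in> space M" by (auto simp: space_pair_measure)
  have lim: "(\<lambda>n. ?s n \<lfloor>real (Suc n) * t\<rfloor>) \<longlonglongrightarrow> t"
  proof (rule tendsto_sandwich)
    have b: "t - 1 / real (Suc n) \<le> real_of_int \<lfloor>real (Suc n) * t\<rfloor> / real (Suc n) \<and>
        real_of_int \<lfloor>real (Suc n) * t\<rfloor> / real (Suc n) \<le> t" for n
    proof
      have "real (Suc n) * t - 1 \<le> real_of_int \<lfloor>real (Suc n) * t\<rfloor>" by linarith
      from divide_right_mono[OF this, of "real (Suc n)"]
      show "t - 1 / real (Suc n) \<le> real_of_int \<lfloor>real (Suc n) * t\<rfloor> / real (Suc n)"
        by (simp add: diff_divide_distrib del: of_nat_Suc)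
      have "real_of_int \<lfloor>real (Suc n) * t\<rfloor> \<le> real (Suc n) * t" by simp
      from divide_right_mono[OF this, of "real (Suc n)"]
      show "real_of_int \<lfloor>real (Suc n) * t\<rfloor> / real (Suc n) \<le> t"
        by (simp del: of_nat_Suc)
    qed
    show "\<forall>\<^sub>F n in sequentially. t - 1 / real (Suc n) \<le> ?s n \<lfloor>real (Suc n) * t\<rfloor>"
      using b by (intro always_eventually allI) (meson max.coboundedI2)
    show "\<forall>\<^sub>F n in sequentially. ?s n \<lfloor>real (Suc n) * t\<rfloor> \<le> t"
      using b z(2) by (intro always_eventually allI max.boundedI) auto
    have "(\<lambda>n. t - 1 / real (Suc n)) \<longlonglongrightarrow> t - 0"
      by (intro tendsto_intros LIMSEQ_Suc[OF lim_1_over_n])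
    thus "(\<lambda>n. t - 1 / real (Suc n)) \<longlonglongrightarrow> t" by simp
  qed simp
  have cont: "continuous_on {0..} (\<lambda>t. \<alpha> t x)" using assms(2) z by (simp add: continuous_paths_def)
  have "(\<lambda>n. \<alpha> (?s n \<lfloor>real (Suc n) * t\<rfloor>) x) \<longlonglongrightarrow> \<alpha> t x"
    by (rule continuous_on_tendsto_compose[OF cont lim]) (use z in auto)
  thus "(\<lambda>n. ?u n z) \<longlonglongrightarrow> (case z of (t, x) \<Rightarrow> \<alpha> t x)" by (simp add: z)
qed

lemma continuous_paths_integrable:
  assumes "continuous_paths M \<alpha>" "x \<in> space M"
  shows "integrable (time_measure T) (\<lambda>t. \<alpha> t x)"
proof -
  have c: "continuous_on {0..} (\<lambda>t. \<alpha> t x)" using assms by (simp add: continuous_paths_def)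
  have "(\<lambda>t. \<alpha> t x) \<in> borel_measurable (time_measure T)"
    using borel_measurable_continuous_on_restrict[OF c]
    by (simp add: measurable_cong_sets[OF sets_time_measure refl])
  moreover have "set_integrable lborel {0..T} (\<lambda>t. \<alpha> t x)"
    by (rule borel_integrable_atLeastAtMost') (rule continuous_on_subset[OF c], auto)
  ultimately show ?thesis by (simp add: integrable_time_measure)
qed

section \<open>From the spectral density at one frequency to its average\<close>

lemma cmod_fourier_drift:
  assumes "integrable (time_measure T) f"
  shows "(cmod (LINT t:{0..T}|lborel. exp (- \<i> * of_real \<omega> * of_real t) * of_real (f t)))\<^sup>2 =
    fourier_energy (time_measure T) f \<omega>"
proof -
  note [measurable] = borel_measurable_integrable[OF assms]
  let ?g = "\<lambda>t. exp (- \<i> * of_real \<omega> * of_real t) * of_real (f t) :: complex"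
  have [measurable]: "(\<lambda>t. exp (- \<i> * of_real \<omega> * of_real t)) \<in> borel_measurable (time_measure T)"
    by (rule measurable_compose[OF id_measurable_time_measure])
       (intro borel_measurable_continuous_onI continuous_intros)
  have gm: "?g \<in> borel_measurable (time_measure T)" by measurable
  have gi: "integrable (time_measure T) ?g"
    by (rule Bochner_Integration.integrable_bound[OF assms gm]) (simp add: norm_mult)
  have re: "Re (?g t) = cos (\<omega> * t) * f t" and im: "Im (?g t) = - (sin (\<omega> * t) * f t)" for t
    by (simp_all add: Re_exp Im_exp)
  have "(cmod (\<integral>t. ?g t \<partial>time_measure T))\<^sup>2 =
      (\<integral>t. Re (?g t) \<partial>time_measure T)\<^sup>2 + (\<integral>t. Im (?g t) \<partial>time_measure T)\<^sup>2"
    unfolding cmod_power2 integral_Re[OF gi] integral_Im[OF gi] ..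
  also have "\<dots> = fourier_energy (time_measure T) f \<omega>"
    unfolding re im by (simp add: fourier_energy_def)
  finally show ?thesis unfolding integral_time_measure[OF gm] .
qed

lemma finite_psd_lower_bound:
  assumes T: "0 < T" and "adapted F \<alpha>" and cont: "continuous_paths M \<alpha>" and \<beta>: "predictable M F \<beta>"
    and fin\<alpha>: "(\<integral>\<^sup>+t\<in>{0..T}. (\<integral>\<^sup>+x. ennreal ((\<alpha> t x)\<^sup>2) \<partial>M) \<partial>lborel) < \<infinity>"
    and fin\<beta>: "(\<integral>\<^sup>+t\<in>{0..T}. (\<integral>\<^sup>+x. ennreal ((\<beta> t x)\<^sup>2) \<partial>M) \<partial>lborel) < \<infinity>"
  shows "enn2real (\<integral>\<^sup>+t\<in>{0..T}. (\<integral>\<^sup>+x. ennreal ((\<beta> t x)\<^sup>2) \<partial>M) \<partial>lborel) \<le>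
    2 * T * finite_psd M F W \<alpha> \<beta> T \<omega> + 2 * expectation (\<lambda>x. fourier_energy (time_measure T) (\<lambda>t. \<alpha> t x) \<omega>)"
proof -
  let ?e = "\<lambda>t. exp (- \<i> * of_real \<omega> * of_real t) :: complex"
  have \<alpha>m [measurable]: "(\<lambda>(t, x). \<alpha> t x) \<in> borel_measurable (process_measure T)"
    by (rule continuous_adapted_measurable) fact+
  have \<beta>m: "(\<lambda>(t, x). \<beta> t x) \<in> borel_measurable (process_measure T)"
    using \<beta> unfolding predictable_def by (rule measurable_from_subalg[OF subalgebra_predictable])
  have int\<alpha>: "integrable (time_measure T) (\<lambda>t. \<alpha> t x)" if "x \<in> space M" for x
    by (rule continuous_paths_integrable[OF cont that])
  define A where "A x = (LINT t:{0..T}|lborel. ?e t * of_real (\<alpha> t x))" for x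
  \<comment> \<open>A general factor g bounded by 1 covers cos and -sin at once. The bound keeps g
    \<beta> square integrable, so a version exists and \<open>SOME\<close> returns one.\<close>
  have ito: "\<exists>I. has_ito_integral M F W (\<lambda>t x. g t * \<beta> t x) T I \<and> ito_integral M F W (\<lambda>t x. g t * \<beta> t x) T = I
      \<and> I \<in> borel_measurable M \<and>
      (\<integral>\<^sup>+x. ennreal ((I x)\<^sup>2) \<partial>M) = (\<integral>\<^sup>+z. ennreal ((g (fst z) * \<beta> (fst z) (snd z))\<^sup>2) \<partial>process_measure T)
      \<and> (\<integral>\<^sup>+x. ennreal ((I x)\<^sup>2) \<partial>M) < \<infinity>"
    if g: "g \<in> borel_measurable borel" and g1: "\<And>t. \<bar>g t\<bar> \<le> 1" for g
  proof -
    let ?I = "ito_integral M F W (\<lambda>t x. g t * \<beta> t x) T"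
    note pm = predictable_mult_time[OF \<beta> g]
    have gm: "(\<lambda>(t, x). g t * \<beta> t x) \<in> borel_measurable (process_measure T)"
      by (rule measurable_from_subalg[OF subalgebra_predictable pm])
    have "(\<integral>\<^sup>+t\<in>{0..T}. (\<integral>\<^sup>+x. ennreal ((g t * \<beta> t x)\<^sup>2) \<partial>M) \<partial>lborel) \<le>
        (\<integral>\<^sup>+t\<in>{0..T}. (\<integral>\<^sup>+x. ennreal ((\<beta> t x)\<^sup>2) \<partial>M) \<partial>lborel)"
    proof (intro nn_integral_mono mult_right_mono ennreal_leI)
      fix t x
      have "(g t)\<^sup>2 \<le> 1" using g1 by (simp add: abs_square_le_1)
      from mult_right_mono[OF this zero_le_power2[of "\<beta> t x"]]
      show "(g t * \<beta> t x)\<^sup>2 \<le> (\<beta> t x)\<^sup>2" by (simp add: power_mult_distrib)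
    qed simp
    hence gfin: "(\<integral>\<^sup>+t\<in>{0..T}. (\<integral>\<^sup>+x. ennreal ((g t * \<beta> t x)\<^sup>2) \<partial>M) \<partial>lborel) < \<infinity>"
      using fin\<beta> by (rule le_less_trans)
    have I: "has_ito_integral M F W (\<lambda>t x. g t * \<beta> t x) T ?I"
      unfolding ito_integral_def by (rule someI_ex[OF has_ito_integral_exists[OF T pm gfin]])
    hence "?I \<in> borel_measurable (F T)" unfolding has_ito_integral_def by blast
    hence "?I \<in> borel_measurable M" by (rule measurable_F[OF less_imp_le[OF T]])
    moreover have "(\<integral>\<^sup>+x. ennreal ((?I x)\<^sup>2) \<partial>M) = (\<integral>\<^sup>+t\<in>{0..T}. (\<integral>\<^sup>+x. ennreal ((g t * \<beta> t x)\<^sup>2) \<partial>M) \<partial>lborel)"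
      by (rule ito_isometry[OF less_imp_le[OF T] gm gfin I])
    moreover have "\<dots> = (\<integral>\<^sup>+z. ennreal ((g (fst z) * \<beta> (fst z) (snd z))\<^sup>2) \<partial>process_measure T)"
      using gm by (subst nn_integral_process_measure) (simp_all add: case_prod_beta')
    ultimately show ?thesis using I gfin by auto
  qed
  obtain Ic where Ic: "ito_integral M F W (\<lambda>t x. cos (\<omega> * t) * \<beta> t x) T = Ic" "Ic \<in> borel_measurable M"
      "(\<integral>\<^sup>+x. ennreal ((Ic x)\<^sup>2) \<partial>M) = (\<integral>\<^sup>+z. ennreal ((cos (\<omega> * fst z) * \<beta> (fst z) (snd z))\<^sup>2) \<partial>process_measure T)"
      "(\<integral>\<^sup>+x. ennreal ((Ic x)\<^sup>2) \<partial>M) < \<infinity>"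
    using ito[of "\<lambda>t. cos (\<omega> * t)"] by auto
  obtain Is where Is: "ito_integral M F W (\<lambda>t x. - sin (\<omega> * t) * \<beta> t x) T = Is" "Is \<in> borel_measurable M"
      "(\<integral>\<^sup>+x. ennreal ((Is x)\<^sup>2) \<partial>M) = (\<integral>\<^sup>+z. ennreal ((- sin (\<omega> * fst z) * \<beta> (fst z) (snd z))\<^sup>2) \<partial>process_measure T)"
      "(\<integral>\<^sup>+x. ennreal ((Is x)\<^sup>2) \<partial>M) < \<infinity>"
    using ito[of "\<lambda>t. - sin (\<omega> * t)"] by auto
  note [measurable] = Ic(2) Is(2)
  define B where "B x = Complex (Ic x) (Is x)" for x
  have re: "Re (?e t * of_real b) = cos (\<omega> * t) * b" and im: "Im (?e t * of_real b) = - sin (\<omega> * t) * b" for t b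
    by (simp_all add: Re_exp Im_exp)
  have F: "fourier_dY M F W \<alpha> \<beta> T \<omega> x = A x + B x" for x
    unfolding fourier_dY_def complex_ito_integral_def A_def B_def re im Ic(1) Is(1) ..
  have B2: "(cmod (B x))\<^sup>2 = (Ic x)\<^sup>2 + (Is x)\<^sup>2" for x by (simp add: B_def cmod_power2)
  have Bi: "integrable M (\<lambda>x. (cmod (B x))\<^sup>2)"
    unfolding B2 using Ic(4) Is(4) by (intro Bochner_Integration.integrable_add integrableI_bounded) simp_all
  have EB: "ennreal (expectation (\<lambda>x. (cmod (B x))\<^sup>2)) =
      (\<integral>\<^sup>+t\<in>{0..T}. (\<integral>\<^sup>+x. ennreal ((\<beta> t x)\<^sup>2) \<partial>M) \<partial>lborel)"
  proof -
    note [measurable] = \<beta>m[unfolded case_prod_beta']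
    have "ennreal (expectation (\<lambda>x. (cmod (B x))\<^sup>2)) = (\<integral>\<^sup>+x. ennreal ((cmod (B x))\<^sup>2) \<partial>M)"
      using Bi by (intro nn_integral_eq_integral[symmetric]) auto
    also have "\<dots> = (\<integral>\<^sup>+x. ennreal ((Ic x)\<^sup>2) \<partial>M) + (\<integral>\<^sup>+x. ennreal ((Is x)\<^sup>2) \<partial>M)"
      unfolding B2 by (subst nn_integral_add[symmetric]) simp_all
    also have "\<dots> = (\<integral>\<^sup>+z. ennreal ((cos (\<omega> * fst z) * \<beta> (fst z) (snd z))\<^sup>2) +
        ennreal ((- sin (\<omega> * fst z) * \<beta> (fst z) (snd z))\<^sup>2) \<partial>process_measure T)"
      unfolding Ic(3) Is(3) by (subst nn_integral_add[symmetric]) simp_all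
    also have "\<dots> = (\<integral>\<^sup>+z. ennreal ((\<beta> (fst z) (snd z))\<^sup>2) \<partial>process_measure T)"
    proof (rule nn_integral_cong)
      fix z :: "real \<times> 'a"
      have "(cos (\<omega> * fst z) * \<beta> (fst z) (snd z))\<^sup>2 + (- sin (\<omega> * fst z) * \<beta> (fst z) (snd z))\<^sup>2 =
          ((cos (\<omega> * fst z))\<^sup>2 + (sin (\<omega> * fst z))\<^sup>2) * (\<beta> (fst z) (snd z))\<^sup>2"
        unfolding power_mult_distrib power2_minus by (rule distrib_right[symmetric])
      also have "\<dots> = (\<beta> (fst z) (snd z))\<^sup>2" by (simp only: sin_cos_squared_add2 mult_1_left)
      finally show "ennreal ((cos (\<omega> * fst z) * \<beta> (fst z) (snd z))\<^sup>2) + ennreal ((- sin (\<omega> * fst z) * \<beta> (fst z) (snd z))\<^sup>2) =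
          ennreal ((\<beta> (fst z) (snd z))\<^sup>2)"
        unfolding ennreal_plus[OF zero_le_power2 zero_le_power2, symmetric] by (rule arg_cong)
    qed
    also have "\<dots> = (\<integral>\<^sup>+t\<in>{0..T}. (\<integral>\<^sup>+x. ennreal ((\<beta> t x)\<^sup>2) \<partial>M) \<partial>lborel)"
      by (subst nn_integral_process_measure) simp_all
    finally show ?thesis .
  qed
  have A2: "(cmod (A x))\<^sup>2 = fourier_energy (time_measure T) (\<lambda>t. \<alpha> t x) \<omega>" if "x \<in> space M" for x
    unfolding A_def by (rule cmod_fourier_drift[OF int\<alpha>[OF that]])
  have fin\<alpha>': "(\<integral>\<^sup>+z. ennreal ((\<alpha> (fst z) (snd z))\<^sup>2) \<partial>process_measure T) < \<infinity>"
    using fin\<alpha> \<alpha>m by (subst nn_integral_process_measure) (simp_all add: case_prod_beta')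
  have "integrable M (\<lambda>x. fourier_energy (time_measure T) (\<lambda>t. \<alpha> t x) \<omega>)"
    by (rule integral_fourier_energy(2)[OF finite_measure_time_measure prob_space_axioms
        id_measurable_time_measure \<alpha>m fin\<alpha>' int\<alpha>])
  hence Ai: "integrable M (\<lambda>x. (cmod (A x))\<^sup>2)"
    by (subst Bochner_Integration.integrable_cong[OF refl A2])
  have EA: "expectation (\<lambda>x. (cmod (A x))\<^sup>2) = expectation (\<lambda>x. fourier_energy (time_measure T) (\<lambda>t. \<alpha> t x) \<omega>)"
    by (intro Bochner_Integration.integral_cong refl A2)
  \<comment> \<open>Over \<open>time_measure T\<close> the set integral becomes a parameter integral
    of a jointly measurable function.\<close>
  have Am [measurable]: "A \<in> borel_measurable M"
  proof -
    have e: "?e \<in> borel_measurable borel" by (intro borel_measurable_continuous_onI continuous_intros)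
    have "(\<lambda>(x, t). \<alpha> t x) \<in> borel_measurable (M \<Otimes>\<^sub>M time_measure T)"
      using measurable_compose[OF measurable_pair_swap' \<alpha>m] by (simp add: case_prod_beta')
    note this[unfolded case_prod_beta', measurable]
    have "(\<lambda>z. ?e (snd z)) \<in> borel_measurable (M \<Otimes>\<^sub>M time_measure T)"
      by (rule measurable_compose[OF measurable_compose[OF measurable_snd id_measurable_time_measure] e])
    hence "(\<lambda>(x, t). ?e t * of_real (\<alpha> t x)) \<in> borel_measurable (M \<Otimes>\<^sub>M time_measure T)"
      unfolding case_prod_beta' by measurable
    hence "(\<lambda>x. \<integral>t. ?e t * of_real (\<alpha> t x) \<partial>time_measure T) \<in> borel_measurable M"
      by (rule time.M1.borel_measurable_lebesgue_integral)
    moreover have "A x = (\<integral>t. ?e t * of_real (\<alpha> t x) \<partial>time_measure T)" if "x \<in> space M" for x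
    proof -
      have "?e \<in> borel_measurable (time_measure T)" by (rule measurable_compose[OF id_measurable_time_measure e])
      moreover note [measurable] = borel_measurable_integrable[OF int\<alpha>[OF that]]
      ultimately have "(\<lambda>t. ?e t * of_real (\<alpha> t x)) \<in> borel_measurable (time_measure T)" by measurable
      thus ?thesis unfolding A_def by (rule integral_time_measure[symmetric])
    qed
    ultimately show ?thesis by (subst measurable_cong)
  qed
  have Bm [measurable]: "B \<in> borel_measurable M"
    unfolding B_def Complex_eq by measurable
  have sq: "(cmod (u + v))\<^sup>2 \<le> 2 * (cmod u)\<^sup>2 + 2 * (cmod v)\<^sup>2" for u v
  proof -
    have "(p + q)\<^sup>2 \<le> 2 * p\<^sup>2 + 2 * q\<^sup>2" for p q :: real
      using zero_le_power2[of "p - q"] by (simp add: power2_eq_square algebra_simps)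
    from add_mono[OF this[of "Re u" "Re v"] this[of "Im u" "Im v"]] show ?thesis
      unfolding cmod_power2 by simp
  qed
  \<comment> \<open>\<open>finite_psd\<close> is a Bochner integral, equal to 0 for a non-integrable
    integrand; this excludes that default, under which a small value would carry no
    information.\<close>
  have Fi: "integrable M (\<lambda>x. (cmod (A x + B x))\<^sup>2)"
    by (rule Bochner_Integration.integrable_bound[of M "\<lambda>x. 2 * (cmod (A x))\<^sup>2 + 2 * (cmod (B x))\<^sup>2"])
       (use Ai Bi sq in auto)
  have "expectation (\<lambda>x. (cmod (B x))\<^sup>2) \<le> expectation (\<lambda>x. 2 * (cmod (A x + B x))\<^sup>2 + 2 * (cmod (A x))\<^sup>2)"
  proof (rule integral_mono[OF Bi])
    show "integrable M (\<lambda>x. 2 * (cmod (A x + B x))\<^sup>2 + 2 * (cmod (A x))\<^sup>2)" using Ai Fi by simp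
    show "(cmod (B x))\<^sup>2 \<le> 2 * (cmod (A x + B x))\<^sup>2 + 2 * (cmod (A x))\<^sup>2" for x
      using sq[of "A x + B x" "- A x"] by simp
  qed
  also have "\<dots> = 2 * expectation (\<lambda>x. (cmod (A x + B x))\<^sup>2) + 2 * expectation (\<lambda>x. (cmod (A x))\<^sup>2)"
    using Ai Fi by simp
  also have "expectation (\<lambda>x. (cmod (A x + B x))\<^sup>2) = T * finite_psd M F W \<alpha> \<beta> T \<omega>"
    using T by (simp add: finite_psd_def F)
  finally have "expectation (\<lambda>x. (cmod (B x))\<^sup>2) \<le> 2 * T * finite_psd M F W \<alpha> \<beta> T \<omega> +
      2 * expectation (\<lambda>x. fourier_energy (time_measure T) (\<lambda>t. \<alpha> t x) \<omega>)" by (simp add: EA)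
  moreover have "enn2real (\<integral>\<^sup>+t\<in>{0..T}. (\<integral>\<^sup>+x. ennreal ((\<beta> t x)\<^sup>2) \<partial>M) \<partial>lborel) = expectation (\<lambda>x. (cmod (B x))\<^sup>2)"
    unfolding EB[symmetric] by simp
  ultimately show ?thesis by simp
qed

text \<open>The left side is the same at every frequency, hence its own average over N, ..., N + n -
  1; the averaged energies are controlled by \<open>mean_cos\<close>.\<close>

lemma mean_psd_lower_bound:
  assumes T: "0 < T" and n: "0 < n" and \<alpha>: "adapted F \<alpha>" "continuous_paths M \<alpha>" and \<beta>: "predictable M F \<beta>"
    and fin\<alpha>: "(\<integral>\<^sup>+t\<in>{0..T}. (\<integral>\<^sup>+x. ennreal ((\<alpha> t x)\<^sup>2) \<partial>M) \<partial>lborel) < \<infinity>"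
    and fin\<beta>: "(\<integral>\<^sup>+t\<in>{0..T}. (\<integral>\<^sup>+x. ennreal ((\<beta> t x)\<^sup>2) \<partial>M) \<partial>lborel) < \<infinity>"
  defines "C \<equiv> \<lambda>s t. expectation (\<lambda>x. \<alpha> s x * \<alpha> t x)"
  shows "integrable (time_measure T \<Otimes>\<^sub>M time_measure T) (\<lambda>z. C (fst z) (snd z))"
    and "enn2real (\<integral>\<^sup>+t\<in>{0..T}. (\<integral>\<^sup>+x. ennreal ((\<beta> t x)\<^sup>2) \<partial>M) \<partial>lborel) \<le>
    2 * T * ((\<Sum>j<n. finite_psd M F W \<alpha> \<beta> T (real (N + j))) / n) +
    2 * (\<integral>z. \<bar>mean_cos N n (fst z - snd z)\<bar> * \<bar>C (fst z) (snd z)\<bar> \<partial>(time_measure T \<Otimes>\<^sub>M time_measure T))"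
proof -
  let ?D = "enn2real (\<integral>\<^sup>+t\<in>{0..T}. (\<integral>\<^sup>+x. ennreal ((\<beta> t x)\<^sup>2) \<partial>M) \<partial>lborel)"
  let ?P = "\<lambda>j. finite_psd M F W \<alpha> \<beta> T (real (N + j))"
  let ?E = "\<lambda>j. expectation (\<lambda>x. fourier_energy (time_measure T) (\<lambda>t. \<alpha> t x) (real (N + j)))"
  have \<alpha>m: "(\<lambda>(t, x). \<alpha> t x) \<in> borel_measurable (process_measure T)"
    by (rule continuous_adapted_measurable[OF \<alpha>])
  have fin\<alpha>': "(\<integral>\<^sup>+z. ennreal ((\<alpha> (fst z) (snd z))\<^sup>2) \<partial>process_measure T) < \<infinity>"
    using fin\<alpha> \<alpha>m by (subst nn_integral_process_measure) (simp_all add: case_prod_beta')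
  note pre = finite_measure_time_measure prob_space_axioms id_measurable_time_measure \<alpha>m fin\<alpha>'
    continuous_paths_integrable[OF \<alpha>(2)]
  show "integrable (time_measure T \<Otimes>\<^sub>M time_measure T) (\<lambda>z. C (fst z) (snd z))"
    unfolding C_def by (rule integral_fourier_energy(1)[OF pre])
  have "real n * ?D = (\<Sum>j<n. ?D)" by simp
  also have "\<dots> \<le> (\<Sum>j<n. 2 * T * ?P j + 2 * ?E j)"
    by (intro sum_mono finite_psd_lower_bound[OF T \<alpha> \<beta> fin\<alpha> fin\<beta>])
  also have "\<dots> = real n * (2 * T * ((\<Sum>j<n. ?P j) / n) + 2 * ((\<Sum>j<n. ?E j) / n))"
    using n by (simp add: sum.distrib sum_distrib_left field_simps)
  finally have "?D \<le> 2 * T * ((\<Sum>j<n. ?P j) / n) + 2 * ((\<Sum>j<n. ?E j) / n)"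
    using n by (simp only: mult_le_cancel_left_pos of_nat_0_less_iff)
  also have "(\<Sum>j<n. ?E j) / n \<le> (\<integral>z. \<bar>mean_cos N n (fst z - snd z)\<bar> * \<bar>C (fst z) (snd z)\<bar> \<partial>(time_measure T \<Otimes>\<^sub>M time_measure T))"
    unfolding C_def by (rule mean_fourier_energy_le[OF pre])
  finally show "?D \<le> 2 * T * ((\<Sum>j<n. ?P j) / n) +
    2 * (\<integral>z. \<bar>mean_cos N n (fst z - snd z)\<bar> * \<bar>C (fst z) (snd z)\<bar> \<partial>(time_measure T \<Otimes>\<^sub>M time_measure T))"
    by simp
qed

end

section \<open>Moments of stationary processes\<close>

lemma stationary_pair:
  assumes st: "strictly_stationary M X" and m: "\<And>t. 0 \<le> t \<Longrightarrow> X t \<in> borel_measurable M"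
    and t: "0 \<le> s" "0 \<le> t" "0 \<le> h"
  shows "distr M (borel \<Otimes>\<^sub>M borel) (\<lambda>x. (X (s + h) x, X (t + h) x)) =
    distr M (borel \<Otimes>\<^sub>M borel) (\<lambda>x. (X s x, X t x))"
proof -
  let ?P = "PiM {..<2::nat} (\<lambda>_. borel :: real measure)"
  define u where "u i = (if i = 0 then s else t)" for i :: nat
  let ?p = "\<lambda>f :: nat \<Rightarrow> real. (f 0, f 1)"
  have u: "0 \<le> u i" for i using t by (simp add: u_def)
  have p: "?p \<in> ?P \<rightarrow>\<^sub>M borel \<Otimes>\<^sub>M borel"
    by (intro measurable_Pair measurable_component_singleton) auto
  have r: "(\<lambda>x. \<lambda>i\<in>{..<2}. X (u i + k) x) \<in> M \<rightarrow>\<^sub>M ?P" if "0 \<le> k" for k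
    using u that by (intro measurable_restrict m) simp
  \<comment> \<open>Stated for a general shift k, so that k = h and k = 0 give the two
    sides.\<close>
  have d: "distr M (borel \<Otimes>\<^sub>M borel) (\<lambda>x. (X (s + k) x, X (t + k) x)) =
      distr (distr M ?P (\<lambda>x. \<lambda>i\<in>{..<2}. X (u i + k) x)) (borel \<Otimes>\<^sub>M borel) ?p" if "0 \<le> k" for k
    by (subst distr_distr[OF p r[OF that]]) (simp add: o_def u_def)
  have "distr M ?P (\<lambda>x. \<lambda>i\<in>{..<2}. X (u i + h) x) = distr M ?P (\<lambda>x. \<lambda>i\<in>{..<2}. X (u i + 0) x)"
    using st[unfolded strictly_stationary_def, rule_format, of 2 u h] u t by simp
  with d[OF t(3)] d[OF order_refl] show ?thesis by simp
qed

text \<open>One-time laws are read off from the diagonal pair (X t, X t).\<close>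

lemma stationary_second_moment:
  assumes st: "strictly_stationary M X" and m: "\<And>t. 0 \<le> t \<Longrightarrow> X t \<in> borel_measurable M" and "0 \<le> t"
  shows "(\<integral>\<^sup>+x. ennreal ((X t x)\<^sup>2) \<partial>M) = (\<integral>\<^sup>+x. ennreal ((X 0 x)\<^sup>2) \<partial>M)"
proof -
  have "(\<lambda>x. (X s x, X s x)) \<in> M \<rightarrow>\<^sub>M borel \<Otimes>\<^sub>M borel" if "0 \<le> s" for s
    using m[OF that] by simp
  hence i: "(\<integral>\<^sup>+x. ennreal ((X s x)\<^sup>2) \<partial>M) =
      (\<integral>\<^sup>+z. ennreal ((fst z)\<^sup>2) \<partial>distr M (borel \<Otimes>\<^sub>M borel) (\<lambda>x. (X s x, X s x)))" if "0 \<le> s" for s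
    using that by (subst nn_integral_distr) simp_all
  show ?thesis
    using stationary_pair[OF st m order_refl order_refl \<open>0 \<le> t\<close>] i[OF \<open>0 \<le> t\<close>] i[OF order_refl] by simp
qed

text \<open>With mean 0 the covariance is a plain mixed moment. Shifting by the smaller of s and t
  moves the base time to 0, where \<open>autocovariance\<close> is anchored; for s > t the factors
  change places, matching the absolute value in its definition.\<close>

lemma stationary_covariance:
  assumes st: "strictly_stationary M X" and m: "\<And>t. 0 \<le> t \<Longrightarrow> X t \<in> borel_measurable M"
    and mean: "\<And>t. 0 \<le> t \<Longrightarrow> (\<integral>x. X t x \<partial>M) = 0" and "0 \<le> s" "0 \<le> t"
  shows "(\<integral>x. X s x * X t x \<partial>M) = autocovariance M X (s - t)"
proof -
  have shift: "(\<integral>x. X (u + h) x * X (v + h) x \<partial>M) = (\<integral>x. X u x * X v x \<partial>M)"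
    if "0 \<le> u" "0 \<le> v" "0 \<le> h" for u v h
  proof -
    have i: "(\<integral>x. X u x * X v x \<partial>M) =
        (\<integral>z. fst z * snd z \<partial>distr M (borel \<Otimes>\<^sub>M borel) (\<lambda>x. (X u x, X v x)))" if "0 \<le> u" "0 \<le> v" for u v
      using m[OF that(1)] m[OF that(2)] by (subst integral_distr) simp_all
    show ?thesis
      using stationary_pair[OF st m that] i[of "u + h" "v + h"] i[of u v] that by simp
  qed
  have ac: "autocovariance M X \<tau> = (\<integral>x. X 0 x * X \<bar>\<tau>\<bar> x \<partial>M)" for \<tau>
    unfolding autocovariance_def covariance_def by (simp add: mean)
  show ?thesis
  proof (cases "s \<le> t")
    case True
    thus ?thesis using shift[of 0 "t - s" s] assms by (simp add: ac)
  next
    case False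
    thus ?thesis using shift[of "s - t" 0 t] assms by (simp add: ac mult.commute)
  qed
qed

section \<open>The two time horizons\<close>

context brownian_space
begin

lemma finite_horizon:
  assumes T: "0 < T" and \<alpha>: "adapted F \<alpha>" "continuous_paths M \<alpha>" and \<beta>: "predictable M F \<beta>"
    and fin\<alpha>: "(\<integral>\<^sup>+t\<in>{0..T}. (\<integral>\<^sup>+x. ennreal ((\<alpha> t x)\<^sup>2) \<partial>M) \<partial>lborel) < \<infinity>"
    and fin\<beta>: "(\<integral>\<^sup>+t\<in>{0..T}. (\<integral>\<^sup>+x. ennreal ((\<beta> t x)\<^sup>2) \<partial>M) \<partial>lborel) < \<infinity>"
    and lim: "((\<lambda>\<omega>. finite_psd M F W \<alpha> \<beta> T \<omega>) \<longlongrightarrow> 0) at_top"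
  shows "AE t in lborel. t \<in> {0..T} \<longrightarrow> (AE x in M. \<beta> t x = 0)"
proof -
  let ?L = "time_measure T"
  let ?D = "enn2real (\<integral>\<^sup>+t\<in>{0..T}. (\<integral>\<^sup>+x. ennreal ((\<beta> t x)\<^sup>2) \<partial>M) \<partial>lborel)"
  define C where "C z = expectation (\<lambda>x. \<alpha> (fst z) x * \<alpha> (snd z) x)" for z
  note bound = mean_psd_lower_bound[OF T _ \<alpha> \<beta> fin\<alpha> fin\<beta>]
  have "?D \<le> 0 + e" if e: "0 < e" for e
  proof -
    \<comment> \<open>Chosen so that the spectral term 2 T d equals e.\<close>
    define d where "d = e / (2 * T)"
    have d: "0 < d" "2 * T * d = e" using T e by (simp_all add: d_def)
    obtain b where b: "\<And>\<omega>. b \<le> \<omega> \<Longrightarrow> finite_psd M F W \<alpha> \<beta> T \<omega> < d"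
      using order_tendstoD(2)[OF lim d(1)] by (auto simp: eventually_at_top_linorder)
    \<comment> \<open>N depends on e only. All averaged frequencies are at least N whatever n is, so
      n can grow afterwards and remove the drift term.\<close>
    obtain N :: nat where N: "b \<le> real N" using real_arch_simple by blast
    let ?I = "\<lambda>n. \<integral>z. \<bar>mean_cos N n (fst z - snd z)\<bar> * \<bar>C z\<bar> \<partial>(?L \<Otimes>\<^sub>M ?L)"
    have C: "integrable (?L \<Otimes>\<^sub>M ?L) C"
      unfolding C_def by (rule bound(1)[of 1]) simp
    have "?I \<longlonglongrightarrow> 0"
      by (rule integral_mean_cos_tendsto_0[OF C _ AE_cis_neq_1_time_measure]) measurable
    hence "(\<lambda>n. e + 2 * ?I n) \<longlonglongrightarrow> e + 2 * 0" by (intro tendsto_intros)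
    moreover have "\<forall>\<^sub>F n in sequentially. ?D \<le> e + 2 * ?I n"
      using eventually_gt_at_top[of 0]
    proof eventually_elim
      case (elim n)
      have "(\<Sum>j<n. finite_psd M F W \<alpha> \<beta> T (real (N + j))) \<le> (\<Sum>j<n. d)"
        using N by (intro sum_mono less_imp_le[OF b]) simp
      hence "2 * T * ((\<Sum>j<n. finite_psd M F W \<alpha> \<beta> T (real (N + j))) / n) \<le> 2 * T * d"
        using elim T by (intro mult_left_mono) (simp_all add: field_simps)
      thus ?case using bound(2)[OF elim, of N] d(2) unfolding C_def by linarith
    qed
    ultimately show ?thesis
      using tendsto_lowerbound[of "\<lambda>n. e + 2 * ?I n" e sequentially ?D] by simp
  qed
  hence "?D \<le> 0" by (rule field_le_epsilon)
  hence "?D = 0" using enn2real_nonneg[of "\<integral>\<^sup>+t\<in>{0..T}. (\<integral>\<^sup>+x. ennreal ((\<beta> t x)\<^sup>2) \<partial>M) \<partial>lborel"] by simp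
  \<comment> \<open>Finiteness excludes the value infinity, which \<open>enn2real\<close> also maps
    to 0.\<close>
  hence zero: "(\<integral>\<^sup>+t\<in>{0..T}. (\<integral>\<^sup>+x. ennreal ((\<beta> t x)\<^sup>2) \<partial>M) \<partial>lborel) = 0"
    using fin\<beta> by (auto simp: enn2real_eq_0_iff)
  have "(\<lambda>(t, x). \<beta> t x) \<in> borel_measurable (process_measure T)"
    using \<beta> unfolding predictable_def by (rule measurable_from_subalg[OF subalgebra_predictable])
  note m = this[unfolded case_prod_beta', measurable]
  have "(\<integral>\<^sup>+z. ennreal ((\<beta> (fst z) (snd z))\<^sup>2) \<partial>process_measure T) = 0"
    using zero by (subst nn_integral_process_measure) simp_all
  hence "AE z in process_measure T. \<beta> (fst z) (snd z) = 0"
    by (subst (asm) nn_integral_0_iff_AE) simp_all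
  \<comment> \<open>A null set of the product has null sections at almost every time.\<close>
  from time.AE_pair[OF this] show ?thesis by (simp add: AE_time_measure)
qed

text \<open>By stationarity the second moment of \<beta> is a constant v, so the left side of the
  bound is T v and T cancels; v = 0 then settles each single t.\<close>

lemma infinite_horizon:
  assumes \<alpha>: "adapted F \<alpha>" "continuous_paths M \<alpha>" and \<beta>: "predictable M F \<beta>" "adapted F \<beta>"
    and fin\<alpha>: "\<And>T. 0 < T \<Longrightarrow> (\<integral>\<^sup>+t\<in>{0..T}. (\<integral>\<^sup>+x. ennreal ((\<alpha> t x)\<^sup>2) \<partial>M) \<partial>lborel) < \<infinity>"
    and fin\<beta>: "\<And>T. 0 < T \<Longrightarrow> (\<integral>\<^sup>+t\<in>{0..T}. (\<integral>\<^sup>+x. ennreal ((\<beta> t x)\<^sup>2) \<partial>M) \<partial>lborel) < \<infinity>"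
    and st: "strictly_stationary M \<alpha>" "strictly_stationary M \<beta>"
    and mean: "\<And>t. 0 \<le> t \<Longrightarrow> expectation (\<alpha> t) = 0"
    and R: "integrable lborel (autocovariance M \<alpha>)"
    and ex: "psd_exists M F W \<alpha> \<beta>" and lim: "((\<lambda>\<omega>. psd M F W \<alpha> \<beta> \<omega>) \<longlongrightarrow> 0) at_top"
    and "0 \<le> t"
  shows "AE x in M. \<beta> t x = 0"
proof -
  have \<alpha>m: "\<alpha> t \<in> borel_measurable M" and \<beta>m: "\<beta> t \<in> borel_measurable M" if "0 \<le> t" for t
    using \<alpha>(1) \<beta>(2) that by (auto simp: adapted_def intro: measurable_F[OF that])
  define v where "v = (\<integral>\<^sup>+x. ennreal ((\<beta> 0 x)\<^sup>2) \<partial>M)"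
  have D: "(\<integral>\<^sup>+t\<in>{0..T}. (\<integral>\<^sup>+x. ennreal ((\<beta> t x)\<^sup>2) \<partial>M) \<partial>lborel) = v * ennreal T" if "0 < T" for T
  proof -
    have "(\<integral>\<^sup>+t\<in>{0..T}. (\<integral>\<^sup>+x. ennreal ((\<beta> t x)\<^sup>2) \<partial>M) \<partial>lborel) = (\<integral>\<^sup>+t\<in>{0..T}. v \<partial>lborel)"
    proof (rule nn_integral_cong)
      fix t :: real
      show "(\<integral>\<^sup>+x. ennreal ((\<beta> t x)\<^sup>2) \<partial>M) * indicator {0..T} t = v * indicator {0..T} t"
        using stationary_second_moment[OF st(2) \<beta>m, of t] by (cases "t \<in> {0..T}") (simp_all add: v_def)
    qed
    also have "\<dots> = v * ennreal T" using that by (simp add: nn_integral_cmult_indicator)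
    finally show ?thesis .
  qed
  have vfin: "v < \<infinity>" using fin\<beta>[of 1] D[of 1] by simp
  define c where "c N n = (\<integral>\<tau>. \<bar>mean_cos N n \<tau>\<bar> * \<bar>autocovariance M \<alpha> \<tau>\<bar> \<partial>lborel)" for N n
  have bound: "enn2real v \<le> 2 * ((\<Sum>j<n. finite_psd M F W \<alpha> \<beta> T (real (N + j))) / n) + 2 * c N n"
    if T: "0 < T" and n: "0 < n" for T N n
  proof -
    let ?L = "time_measure T"
    let ?g = "\<lambda>\<tau>. \<bar>mean_cos N n \<tau>\<bar> * \<bar>autocovariance M \<alpha> \<tau>\<bar>"
    have gi: "integrable lborel ?g"
    proof (rule Bochner_Integration.integrable_bound[OF R])
      have "autocovariance M \<alpha> \<in> borel_measurable borel" using borel_measurable_integrable[OF R] by simp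
      thus "?g \<in> borel_measurable lborel"
        using mean_cos_measurable[of N n] by (simp add: borel_measurable_times)
      show "AE \<tau> in lborel. norm (?g \<tau>) \<le> norm (autocovariance M \<alpha> \<tau>)"
        using mult_right_mono[OF mean_cos_le_1, of "\<bar>autocovariance M \<alpha> _\<bar>"] by (intro AE_I2) (simp add: abs_mult)
    qed
    \<comment> \<open>Stationarity speaks of times \<ge> 0, and these are exactly the points of
      \<open>space (time_measure T)\<close>.\<close>
    have "(\<integral>z. \<bar>mean_cos N n (fst z - snd z)\<bar> * \<bar>expectation (\<lambda>x. \<alpha> (fst z) x * \<alpha> (snd z) x)\<bar> \<partial>(?L \<Otimes>\<^sub>M ?L)) =
        (\<integral>z. ?g (fst z - snd z) \<partial>(?L \<Otimes>\<^sub>M ?L))"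
      by (intro Bochner_Integration.integral_cong refl)
         (auto simp: space_pair_measure stationary_covariance[OF st(1) \<alpha>m mean])
    also have "\<dots> \<le> T * c N n"
      unfolding c_def using T by (intro integral_time_measure_convolution_le[OF gi]) auto
    finally have "enn2real (v * ennreal T) \<le>
        2 * T * ((\<Sum>j<n. finite_psd M F W \<alpha> \<beta> T (real (N + j))) / n) + 2 * (T * c N n)"
      using mean_psd_lower_bound(2)[OF T n \<alpha> \<beta>(1) fin\<alpha>[OF T] fin\<beta>[OF T], of N] unfolding D[OF T] by linarith
    also have "enn2real (v * ennreal T) = T * enn2real v"
      using T by (simp add: enn2real_mult mult.commute)
    also have "2 * T * ((\<Sum>j<n. finite_psd M F W \<alpha> \<beta> T (real (N + j))) / n) + 2 * (T * c N n) =
        T * (2 * ((\<Sum>j<n. finite_psd M F W \<alpha> \<beta> T (real (N + j))) / n) + 2 * c N n)"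
      by (simp add: algebra_simps)
    finally show ?thesis using T by (simp only: mult_le_cancel_left_pos)
  qed
  \<comment> \<open>\<open>Lim\<close> denotes the limit only where one exists, which
    \<open>psd_exists\<close> supplies at every \<omega>.\<close>
  have psd: "((\<lambda>T. finite_psd M F W \<alpha> \<beta> T \<omega>) \<longlongrightarrow> psd M F W \<alpha> \<beta> \<omega>) at_top" for \<omega>
  proof -
    obtain L where L: "((\<lambda>T. finite_psd M F W \<alpha> \<beta> T \<omega>) \<longlongrightarrow> L) at_top"
      using ex unfolding psd_exists_def by blast
    have "psd M F W \<alpha> \<beta> \<omega> = L" unfolding psd_def by (rule tendsto_Lim[OF _ L]) simp
    thus ?thesis using L by simp
  qed
  \<comment> \<open>N and n are fixed while T grows: a finite sum of convergent terms converges, and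
    \<open>c N n\<close> is free of T.\<close>
  have bound': "enn2real v \<le> 2 * ((\<Sum>j<n. psd M F W \<alpha> \<beta> (real (N + j))) / n) + 2 * c N n" if n: "0 < n" for N n
  proof (rule tendsto_lowerbound)
    show "((\<lambda>T. 2 * ((\<Sum>j<n. finite_psd M F W \<alpha> \<beta> T (real (N + j))) / n) + 2 * c N n) \<longlongrightarrow>
        2 * ((\<Sum>j<n. psd M F W \<alpha> \<beta> (real (N + j))) / n) + 2 * c N n) at_top"
      using n by (intro tendsto_intros psd) simp
    show "\<forall>\<^sub>F T in at_top. enn2real v \<le> 2 * ((\<Sum>j<n. finite_psd M F W \<alpha> \<beta> T (real (N + j))) / n) + 2 * c N n"
      using eventually_gt_at_top[of 0] by eventually_elim (rule bound[OF _ n])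
  qed simp
  have "enn2real v \<le> 0 + e" if e: "0 < e" for e
  proof -
    have "0 < e / 2" using e by simp
    from order_tendstoD(2)[OF lim this]
    obtain b where b: "\<And>\<omega>. b \<le> \<omega> \<Longrightarrow> psd M F W \<alpha> \<beta> \<omega> < e / 2"
      by (auto simp: eventually_at_top_linorder)
    obtain N :: nat where N: "b \<le> real N" using real_arch_simple by blast
    \<comment> \<open>At s = 0 the lemma speaks of -\<tau>, and cis (-\<tau>) = 1 just when cis
      \<tau> = 1.\<close>
    have "AE \<tau> in lborel. cis \<tau> \<noteq> 1"
      using AE_cis_neq_1[of 0] by eventually_elim (simp add: complex_eq_iff)
    hence "c N \<longlonglongrightarrow> 0"
      unfolding c_def by (intro integral_mean_cos_tendsto_0[OF R]) auto
    hence "(\<lambda>n. e + 2 * c N n) \<longlonglongrightarrow> e + 2 * 0" by (intro tendsto_intros)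
    moreover have "\<forall>\<^sub>F n in sequentially. enn2real v \<le> e + 2 * c N n"
      using eventually_gt_at_top[of 0]
    proof eventually_elim
      case (elim n)
      have "(\<Sum>j<n. psd M F W \<alpha> \<beta> (real (N + j))) \<le> (\<Sum>j<n. e / 2)"
        using N by (intro sum_mono less_imp_le[OF b]) simp
      hence "2 * ((\<Sum>j<n. psd M F W \<alpha> \<beta> (real (N + j))) / n) \<le> e"
        using elim by (simp add: field_simps)
      thus ?case using bound'[OF elim, of N] by linarith
    qed
    ultimately show ?thesis
      using tendsto_lowerbound[of "\<lambda>n. e + 2 * c N n" e sequentially "enn2real v"] by simp
  qed
  hence "enn2real v \<le> 0" by (rule field_le_epsilon)
  hence "enn2real v = 0" using enn2real_nonneg[of v] by simp
  hence "v = 0" using vfin by (auto simp: enn2real_eq_0_iff)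
  hence "(\<integral>\<^sup>+x. ennreal ((\<beta> t x)\<^sup>2) \<partial>M) = 0"
    using stationary_second_moment[OF st(2) \<beta>m \<open>0 \<le> t\<close>] by (simp add: v_def)
  thus ?thesis using \<beta>m[OF \<open>0 \<le> t\<close>] by (subst (asm) nn_integral_0_iff_AE) simp_all
qed

end

theorem mainTheorem1:
  fixes M :: "'a measure"
    and F :: "real \<Rightarrow> 'a measure"
    and W \<alpha> \<beta> Y :: "real \<Rightarrow> 'a \<Rightarrow> real"
  assumes "prob_space M"
    and "filtration_on M F"
    and "brownian_motion M F W"
    and "adapted F \<alpha>"
    and "adapted F \<beta>"
    and "\<And>T. T > 0 \<Longrightarrow>
      (\<integral>\<^sup>+t\<in>{0..T}. (\<integral>\<^sup>+x. ennreal ((\<alpha> t x)\<^sup>2 + (\<beta> t x)\<^sup>2) \<partial>M) \<partial>lborel) < \<infinity>"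
    and "continuous_paths M \<alpha>"
    and "predictable M F \<beta>"
    and "ito_process M F W \<alpha> \<beta> Y"
  shows "(\<forall>T>0. ((\<lambda>\<omega>. finite_psd M F W \<alpha> \<beta> T \<omega>) \<longlongrightarrow> 0) at_top \<longrightarrow>
            (AE t in lborel. t \<in> {0..T} \<longrightarrow> (AE x in M. \<beta> t x = 0))) \<and>
         (strictly_stationary M \<alpha> \<and> strictly_stationary M \<beta> \<and>
          (\<forall>t\<ge>0. (\<integral>x. \<alpha> t x \<partial>M) = 0) \<and>
          integrable lborel (autocovariance M \<alpha>) \<and>
          psd_exists M F W \<alpha> \<beta> \<and>
          ((\<lambda>\<omega>. psd M F W \<alpha> \<beta> \<omega>) \<longlongrightarrow> 0) at_top \<longrightarrow>
            (\<forall>t\<ge>0. AE x in M. \<beta> t x = 0))"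
proof -
  interpret brownian_space M F W
    using assms(1-3) by (simp add: brownian_space_def brownian_space_axioms_def)
  \<comment> \<open>The joint moment condition dominates each square, and X stands for either
    process.\<close>
  have fin: "(\<integral>\<^sup>+t\<in>{0..T}. (\<integral>\<^sup>+x. ennreal ((X t x)\<^sup>2) \<partial>M) \<partial>lborel) < \<infinity>"
    if "0 < T" "X \<in> {\<alpha>, \<beta>}" for T X
  proof (rule le_less_trans[OF _ assms(6)[OF that(1)]])
    show "(\<integral>\<^sup>+t\<in>{0..T}. (\<integral>\<^sup>+x. ennreal ((X t x)\<^sup>2) \<partial>M) \<partial>lborel) \<le>
        (\<integral>\<^sup>+t\<in>{0..T}. (\<integral>\<^sup>+x. ennreal ((\<alpha> t x)\<^sup>2 + (\<beta> t x)\<^sup>2) \<partial>M) \<partial>lborel)"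
      using that(2) by (intro nn_integral_mono mult_right_mono ennreal_leI) auto
  qed
  show ?thesis
  proof (intro conjI allI impI)
    fix T :: real assume "0 < T" "((\<lambda>\<omega>. finite_psd M F W \<alpha> \<beta> T \<omega>) \<longlongrightarrow> 0) at_top"
    thus "AE t in lborel. t \<in> {0..T} \<longrightarrow> (AE x in M. \<beta> t x = 0)"
      by (intro finite_horizon[OF _ assms(4,7,8) fin fin]) simp_all
  next
    fix t :: real
    assume "strictly_stationary M \<alpha> \<and> strictly_stationary M \<beta> \<and>
          (\<forall>t\<ge>0. (\<integral>x. \<alpha> t x \<partial>M) = 0) \<and>
          integrable lborel (autocovariance M \<alpha>) \<and>
          psd_exists M F W \<alpha> \<beta> \<and>
          ((\<lambda>\<omega>. psd M F W \<alpha> \<beta> \<omega>) \<longlongrightarrow> 0) at_top" and "0 \<le> t"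
    thus "AE x in M. \<beta> t x = 0"
      by (intro infinite_horizon[OF assms(4,7,8,5) fin fin]) auto
  qed
qed

end
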